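(* Let $\mathbb{X}$ be a (finite or infinite dimensional) Hilbert space and let $d\geq 1$ be an integer. Let $E\subseteq \mathbb{X}$ be a Borel set that is a countable union of sets $E_i$, each of which badly fits $d$-planes. Then $E$ admits a $(d-1)$-dimensional pointwise weak tangent field.
   Context: A $d$-plane in $\mathbb{X}$ is a $d$-dimensional affine subspace. Balls are closed with positive radius. For $E\subseteq\mathbb{X}$ and $\delta>0$, $N_\delta(E)=\{x\in\mathbb{X}:\operatorname{dist}(x,E)\le\delta\}$. A set $E\subseteq\mathbb{X}$ badly fits $d$-planes if there is a constant $\epsilon_0>0$ such that for every $d$-plane $V$ and every ball $B$ in $\mathbb{X}$ with $\operatorname{diam}(V\cap B)>0$, one has $V\cap B\not\subset N_{\epsilon_0\operatorname{diam}(V\cap B)}(E)$. (The constant may differ for different sets $E_i$.) A rectifiable curve in $\mathbb{X}$ is a Lipschitz image of $[0,1]$, equivalently a compact connected set of finite one-dimensional Hausdorff measure $\mathcal{H}^1$. A rectifiable curve $\Gamma$ has a tangent line $\tau_\Gamma(p)$ (a one-dimensional linear subspace) at $\mathcal{H}^1$-a.e. $p\in\Gamma$; it can be defined by fixing an arc-length parametrization $\gamma$ of $\Gamma$ and letting $\tau_\Gamma(\gamma(t))$ be the span of $\gamma'(t)$. Let $\mathcal{L}_j$ denote the collection of $j$-dimensional linear subspaces of $\mathbb{X}$, with its natural topology (e.g. given by the distance between orthogonal projections in operator norm). For a Borel set $E\subseteq \mathbb{X}$ and an integer $k\ge 0$, a $k$-dimensional pointwise weak tangent field to $E$ is a Borel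 map $\tau\colon E\to\bigcup_{j=0}^k\mathcal{L}_j$ such that for every rectifiable curve $\Gamma$ in $\mathbb{X}$, $\tau_\Gamma(p)\subseteq\tau(p)$ for $\mathcal{H}^1$-a.e. $p\in\Gamma\cap E$. *)

theory Defs
  imports "HOL-Analysis.Analysis"
begin

text \<open>The dimension is read off from a finite basis: \<^const>\<open>dim\<close> is \<open>0\<close> on infinite-dimensional
  subspaces.\<close>

definition lin_subspaces :: "nat \<Rightarrow> 'a::real_vector set set" where
  "lin_subspaces j = {W. \<exists>B. finite B \<and> independent B \<and> card B = j \<and> W = span B}"

definition planes :: "nat \<Rightarrow> 'a::real_vector set set" where
  "planes d = {V. \<exists>a. \<exists>W \<in> lin_subspaces d. V = (+) a ` W}"

text \<open>The distance to the empty set is infinite, whereas \<^const>\<open>infdist\<close> gives \<open>0\<close> there.\<close>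

definition closed_nbhd :: "real \<Rightarrow> 'a::metric_space set \<Rightarrow> 'a set" where
  "closed_nbhd \<delta> E = {x. E \<noteq> {} \<and> infdist x E \<le> \<delta>}"

definition badly_fits :: "nat \<Rightarrow> 'a::real_normed_vector set \<Rightarrow> bool" where
  "badly_fits d E \<longleftrightarrow>
     (\<exists>\<epsilon>>0. \<forall>V \<in> planes d. \<forall>c r. r > 0 \<longrightarrow> diameter (V \<inter> cball c r) > 0 \<longrightarrow>
        \<not> V \<inter> cball c r \<subseteq> closed_nbhd (\<epsilon> * diameter (V \<inter> cball c r)) E)"

text \<open>One-dimensional Hausdorff outer measure. Covers consist of bounded sets because
  \<^const>\<open>diameter\<close> is unspecified on unbounded ones.\<close>

definition hausdorff1 :: "'a::metric_space set \<Rightarrow> ennreal" where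
  "hausdorff1 A =
     (SUP \<delta>\<in>{0<..}.
        INF U\<in>{U :: nat \<Rightarrow> 'a set. A \<subseteq> (\<Union>i. U i) \<and> (\<forall>i. bounded (U i) \<and> diameter (U i) \<le> \<delta>)}.
          (\<Sum>i. ennreal (diameter (U i))))"

definition rectifiable_curve :: "'a::metric_space set \<Rightarrow> bool" where
  "rectifiable_curve \<Gamma> \<longleftrightarrow> (\<exists>\<gamma> L. L-lipschitz_on {0..1::real} \<gamma> \<and> \<Gamma> = \<gamma> ` {0..1})"

definition curve_length :: "(real \<Rightarrow> 'a::metric_space) \<Rightarrow> real \<Rightarrow> real \<Rightarrow> ennreal" where
  "curve_length \<gamma> a b =
     (SUP (n, s)\<in>{(n, s :: nat \<Rightarrow> real). mono s \<and> range s \<subseteq> {a..b}}.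
        (\<Sum>i<n. ennreal (dist (\<gamma> (s i)) (\<gamma> (s (Suc i))))))"

definition arclength_param :: "(real \<Rightarrow> 'a::metric_space) \<Rightarrow> real \<Rightarrow> 'a set \<Rightarrow> bool" where
  "arclength_param \<gamma> l \<Gamma> \<longleftrightarrow>
     0 \<le> l \<and> \<gamma> ` {0..l} = \<Gamma> \<and>
     (\<forall>s t. 0 \<le> s \<longrightarrow> s \<le> t \<longrightarrow> t \<le> l \<longrightarrow> curve_length \<gamma> s t = ennreal (t - s))"

text \<open>A curve may pass through \<open>p\<close> several times; \<open>T\<close> is the tangent line at \<open>p\<close> if all passages
  have tangent direction \<open>T\<close>. For an arc-length parametrization this determines a line at almost
  every point of the curve, and the lines of two such parametrizations agree almost everywhere.\<close>

definition tangent_line ::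
    "(real \<Rightarrow> 'a::real_normed_vector) \<Rightarrow> real \<Rightarrow> 'a \<Rightarrow> 'a set \<Rightarrow> bool" where
  "tangent_line \<gamma> l p T \<longleftrightarrow>
     p \<in> \<gamma> ` {0..l} \<and>
     (\<forall>t\<in>{0..l}. \<gamma> t = p \<longrightarrow>
        (\<exists>v. v \<noteq> 0 \<and> (\<gamma> has_vector_derivative v) (at t within {0..l}) \<and> T = span {v}))"

definition orth_proj :: "'a::real_inner set \<Rightarrow> 'a \<Rightarrow>\<^sub>L 'a" where
  "orth_proj W = (THE P. \<forall>x. blinfun_apply P x \<in> W \<and> (\<forall>w\<in>W. (x - blinfun_apply P x) \<bullet> w = 0))"

lemma orth_proj_exists1:
  assumes "W \<in> lin_subspaces j"
  shows "\<exists>!P :: 'a::real_inner \<Rightarrow>\<^sub>L 'a.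
           \<forall>x. blinfun_apply P x \<in> W \<and> (\<forall>w\<in>W. (x - blinfun_apply P x) \<bullet> w = 0)"
proof -
  let ?Q = "\<lambda>W (P :: 'a \<Rightarrow>\<^sub>L 'a).
    \<forall>x. blinfun_apply P x \<in> W \<and> (\<forall>w\<in>W. (x - blinfun_apply P x) \<bullet> w = 0)"
  obtain B where B: "finite B" "W = span B"
    using assms by (auto simp: lin_subspaces_def)
  have "\<exists>P. ?Q (span B) P"
    using B(1)
  proof (induction B rule: finite_induct)
    case empty
    show ?case by (intro exI[of _ 0]) auto
  next
    case (insert b B)
    then obtain P where P: "\<And>x. blinfun_apply P x \<in> span B"
        "\<And>x w. w \<in> span B \<Longrightarrow> (x - blinfun_apply P x) \<bullet> w = 0"
      by blast
    define r where "r = b - blinfun_apply P b"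
    define P' where "P' = P + (blinfun_scaleR_left r o\<^sub>L ((1 / (r \<bullet> r)) *\<^sub>R blinfun_inner_left r))"
    have P'_eq: "blinfun_apply P' x = blinfun_apply P x + ((x \<bullet> r) / (r \<bullet> r)) *\<^sub>R r" for x
      by (simp add: P'_def blinfun.add_left blinfun.scaleR_left)
    have r0: "r \<bullet> w = 0" if "w \<in> span B" for w
      using P(2)[OF that, of b] by (simp add: r_def)
    have sub: "span B \<subseteq> span (insert b B)"
      by (simp add: span_mono subset_insertI)
    have r_in: "r \<in> span (insert b B)"
      unfolding r_def using P(1)[of b] sub
      by (intro span_diff) (auto intro: span_base)
    have orth: "(x - blinfun_apply P' x) \<bullet> w = 0" if wB: "w \<in> span (insert b B)" for x w
    proof -
      obtain k where k: "w - k *\<^sub>R b \<in> span B"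
        using wB unfolding span_insert by blast
      define u where "u = w - k *\<^sub>R b + k *\<^sub>R blinfun_apply P b"
      have u: "u \<in> span B"
        unfolding u_def using k P(1) by (intro span_add span_scale) auto
      have w: "w = u + k *\<^sub>R r"
        by (simp add: u_def r_def algebra_simps)
      have 1: "(x - blinfun_apply P' x) \<bullet> u = 0"
        using P(2)[OF u, of x] r0[OF u] by (simp add: P'_eq inner_diff_left inner_add_left)
      have 2: "(x - blinfun_apply P' x) \<bullet> r = 0"
        using r0[OF P(1)[of x]] inner_commute[of r "blinfun_apply P x"]
        by (cases "r = 0") (simp_all add: P'_eq inner_diff_left inner_add_left)
      show ?thesis using 1 2 by (simp add: w inner_add_right)
    qed
    have "blinfun_apply P' x \<in> span (insert b B)" for x
      unfolding P'_eq using P(1)[of x] sub r_in by (intro span_add span_scale) auto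
    with orth show ?case by blast
  qed
  then obtain P where P: "?Q W P" using B(2) by blast
  moreover have "Q = P" if Q: "?Q W Q" for Q
  proof (rule blinfun_eqI)
    fix x
    let ?y = "blinfun_apply Q x - blinfun_apply P x"
    have "?y \<in> W" using P Q B(2) by (simp add: span_diff)
    then have "(x - blinfun_apply P x) \<bullet> ?y - (x - blinfun_apply Q x) \<bullet> ?y = 0"
      using P Q by simp
    then have "?y \<bullet> ?y = 0" by (simp add: inner_diff_left)
    then show "blinfun_apply Q x = blinfun_apply P x" by simp
  qed
  ultimately show ?thesis by blast
qed

text \<open>The spaces of subspaces carry the metric \<open>norm (orth_proj V - orth_proj W)\<close>, i.e. the topology
  induced by the injection \<open>orth_proj\<close> into the bounded operators. Hence \<open>\<tau>\<close> is Borel iff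
  \<open>orth_proj \<circ> \<tau>\<close> is.\<close>

definition pointwise_weak_tangent_field ::
    "nat \<Rightarrow> 'a::real_inner set \<Rightarrow> ('a \<Rightarrow> 'a set) \<Rightarrow> bool" where
  "pointwise_weak_tangent_field k E \<tau> \<longleftrightarrow>
     (\<forall>p\<in>E. \<tau> p \<in> (\<Union>j\<le>k. lin_subspaces j)) \<and>
     (\<lambda>p. orth_proj (\<tau> p)) \<in> borel_measurable (restrict_space borel E) \<and>
     (\<forall>\<Gamma>. rectifiable_curve \<Gamma> \<longrightarrow>
        (\<forall>\<gamma> l. arclength_param \<gamma> l \<Gamma> \<longrightarrow>
           hausdorff1 {p \<in> \<Gamma> \<inter> E. \<not> (\<exists>T. tangent_line \<gamma> l p T \<and> T \<subseteq> \<tau> p)} = 0))"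

end

theory Submission
  imports Defs
begin

text \<open>
  Passing from a set to its closure preserves bad fit, and Borel fields on countably many pieces can
  be glued, so let a closed set \<open>E\<close> badly fit \<open>d\<close>-planes. Say that \<open>P \<subseteq> E\<close> fits the direction \<open>v\<close> at \<open>p \<in> P\<close> if
  \<open>p + h v\<close> lies within \<open>\<epsilon> \<bar>h\<bar>\<close> of \<open>P\<close> for all small \<open>h\<close>. Two facts drive the proof.

  First, a curve sees its own tangent: at almost every time \<open>t\<close> with \<open>\<gamma> t \<in> P\<close> the set \<open>P\<close> fits \<open>\<gamma>' t\<close>
  at \<open>\<gamma> t\<close>, for every \<open>\<epsilon>\<close>. The reason is that a set of reals \<open>S\<close> satisfies \<open>infdist (t + h) S = o(h)\<close>
  at almost every \<open>t \<in> S\<close>, since the exceptional points form a porous, hence null, set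
  (\<open>negligible_tangent_leaves\<close>).

  Second, directions add up: let \<open>P\<^sub>1\<close> be the set of points where \<open>E\<close> fits \<open>v\<^sub>1\<close>, let \<open>P\<^sub>2\<close> be the set
  of points of \<open>P\<^sub>1\<close> where \<open>P\<^sub>1\<close> fits \<open>v\<^sub>2\<close>, and so on. Walking from a point of \<open>P\<^sub>k\<close> first along \<open>v\<^sub>k\<close>,
  then along the earlier directions, shows that \<open>E\<close> nearly fills a ball of the plane through the
  point spanned by \<open>v\<^sub>1, \<dots>, v\<^sub>k\<close>. If the directions are quantitatively independent and \<open>\<epsilon>\<close> is small,
  bad fit therefore excludes \<open>k \<ge> d\<close> (\<open>badly_fits_bounds_spread_length\<close>).

  Attach to each \<open>p \<in> E\<close> a longest such chain of directions that are \<open>\<delta>\<close>-independent, and let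
  \<open>W p\<close> be its span, of dimension at most \<open>d - 1\<close>. By the first fact a tangent at \<open>p\<close> that is
  \<open>\<delta>\<close>-far from \<open>W p\<close> would prolong the chain; so almost every tangent of every curve is
  \<open>\<delta>\<close>-close to \<open>W\<close> (\<open>approximate_tangent_field\<close>). Carrying this out for \<open>\<delta> = 1/(n+1)\<close> gives fields
  \<open>W\<^sub>n\<close>, and it remains to find one field \<open>\<tau>\<close> of dimension at most \<open>d - 1\<close> that contains every \<open>v\<close>
  whose distance to \<open>W\<^sub>n p\<close> tends to \<open>0\<close>. Where the projections onto \<open>W\<^sub>n p\<close> converge, their limit
  is the projection onto such a subspace. Where they do not, infinitely many pairs \<open>W\<^sub>n p, W\<^sub>k p\<close>
  differ by a fixed amount, and vectors close to both members of a pair are close to a subspace of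
  smaller dimension, so induction on the dimension applies (\<open>ex_borel_asymptotic_field\<close>).

  The space may be nonseparable, so the directions cannot be drawn from a countable dense set.
  They are instead drawn from countably many maps of the base point. For a total orthonormal set
  \<open>B\<close>, almost every \<open>t\<close> satisfies \<open>\<gamma>' t \<bullet> e = 0\<close> for all \<open>e \<in> B\<close> with \<open>\<gamma> t \<bullet> e = 0\<close>, because zeros of
  a coordinate at which it has nonzero derivative are isolated. Hence \<open>\<gamma>' t\<close> is a limit of combinations of those
  \<open>e \<in> B\<close> whose coordinate at \<open>\<gamma> t\<close> exceeds some \<open>1/(n+1)\<close> in absolute value. The finite set of these \<open>e\<close> depends on the
  point in a locally constant way on countably many Borel pieces. Maps of this kind have Borel
  preimages of arbitrary sets, and all choices in the construction preserve them.

  Finally, an arc-length parametrization has a derivative of norm one almost everywhere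
  (\<open>arclength_param_unit_derivative_ae\<close>): on a short interval that nearly realizes the length, the
  component of the curve along the chord grows at almost full speed outside a set of small
  measure, and a difference quotient of norm at most one with such a component is close to
  the direction of the chord.
\<close>

section \<open>Porous sets and steep points of monotone functions\<close>

text \<open>In a disjoint Vitali cover of \<open>S\<close> by balls with a hole of relative size \<open>c\<close> each, the holes
  carry the fraction \<open>c\<close> of the total measure and miss \<open>S\<close>. So a cover of almost minimal measure
  could be improved by a fixed factor unless \<open>S\<close> is null.\<close>

lemma porous_bounded_imp_negligible:
  fixes S :: "real set"
  assumes "bounded S" and c: "0 < c"
    and por: "\<And>x d. x \<in> S \<Longrightarrow> 0 < d \<Longrightarrow>
      \<exists>r y. 0 < r \<and> r < d \<and> cball y (c * r) \<subseteq> cball x r \<and> cball y (c * r) \<inter> S = {}"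
  shows "negligible S"
proof -
  define MM where "MM = {measure lebesgue T | T. S \<subseteq> T \<and> T \<in> lmeasurable}"
  \<comment> \<open>the outer measure of \<open>S\<close>\<close>
  define m where "m = Inf MM"
  have ne: "MM \<noteq> {}"
    using assms(1) bounded_subset_cbox_symmetric[of S] unfolding MM_def
    by (metis (mono_tags, lifting) empty_iff lmeasurable_cbox mem_Collect_eq)
  have bdd: "bdd_below MM"
    unfolding MM_def by (rule bdd_belowI[of _ 0]) auto
  have m0: "0 \<le> m"
    unfolding m_def using ne by (intro cInf_greatest) (auto simp: MM_def)
  have shrink: "c * m \<le> e" if e0: "e > 0" for e
  proof -
    obtain T where T: "S \<subseteq> T" "T \<in> lmeasurable" "measure lebesgue T < m + e/2"
    proof -
      have "\<exists>x\<in>MM. x < m + e/2" using cInf_lessD[OF ne, of "m + e/2"] e0 unfolding m_def[symmetric] by simp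
      with that show ?thesis unfolding MM_def by blast
    qed
    obtain U where U: "open U" "T \<subseteq> U" "U \<in> lmeasurable" "measure lebesgue U < measure lebesgue T + e/2"
    proof -
      obtain U where U: "open U" "T \<subseteq> U" "U - T \<in> lmeasurable" "emeasure lebesgue (U - T) < ennreal (e/2)"
        using sets_lebesgue_outer_open[of T "e/2"] T(2) e0 by (auto simp: fmeasurableD)
      have "U = T \<union> (U - T)" using U by blast
      then have "U \<in> lmeasurable" using T(2) U(3) by (metis fmeasurable.Un)
      moreover have "measure lebesgue U \<le> measure lebesgue T + measure lebesgue (U - T)"
        using \<open>U = T \<union> (U - T)\<close> measure_Un_le[of T lebesgue "U - T"] T(2) U(3) by (metis fmeasurableD)
      moreover have "measure lebesgue (U - T) < e/2"
        using U(3,4) e0 by (simp add: emeasure_eq_measure2 ennreal_less_iff)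
      ultimately show ?thesis using U that by auto
    qed
    define K where "K = {(x, y, r). x \<in> S \<and> 0 < r \<and> cball x r \<subseteq> U \<and>
        cball y (c * r) \<subseteq> cball x r \<and> cball y (c * r) \<inter> S = {}}"
    define a b :: "real \<times> real \<times> real \<Rightarrow> real" where "a = fst" and "b = fst \<circ> snd"
    define r :: "real \<times> real \<times> real \<Rightarrow> real" where "r = snd \<circ> snd"
    obtain C where C: "countable C" "C \<subseteq> K"
      "pairwise (\<lambda>i j. disjnt (cball (a i) (r i)) (cball (a j) (r j))) C"
      "negligible (S - (\<Union>i\<in>C. cball (a i) (r i)))"
    proof (rule Vitali_covering_theorem_cballs[of K r S a])
      show "0 < r i" if "i \<in> K" for i using that by (auto simp: K_def r_def)
      fix x d :: real assume x: "x \<in> S" "0 < d"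
      then obtain d' where d': "d' > 0" "cball x d' \<subseteq> U"
        using U T open_contains_cball by (metis subsetD)
      obtain \<rho> y where "0 < \<rho>" "\<rho> < min d d'" "cball y (c * \<rho>) \<subseteq> cball x \<rho>" "cball y (c * \<rho>) \<inter> S = {}"
        using por[OF x(1), of "min d d'"] x d' by auto
      then have "(x, y, \<rho>) \<in> K \<and> x \<in> cball (a (x, y, \<rho>)) (r (x, y, \<rho>)) \<and> r (x, y, \<rho>) < d"
        using d' x by (auto simp: K_def a_def r_def)
      then show "\<exists>i. i \<in> K \<and> x \<in> cball (a i) (r i) \<and> r i < d" by blast
    qed
    define V where "V = (\<Union>i\<in>C. cball (a i) (r i))"
    define G where "G = (\<Union>i\<in>C. cball (b i) (c * r i))"
    have K: "0 < r i" "cball (a i) (r i) \<subseteq> U" "cball (b i) (c * r i) \<subseteq> cball (a i) (r i)"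
      "cball (b i) (c * r i) \<inter> S = {}" if "i \<in> C" for i
    proof -
      have "i \<in> K" using that C(2) by blast
      then show "0 < r i" "cball (a i) (r i) \<subseteq> U" "cball (b i) (c * r i) \<subseteq> cball (a i) (r i)"
        "cball (b i) (c * r i) \<inter> S = {}"
        unfolding K_def a_def b_def r_def by (cases i, simp del: mem_cball)+
    qed
    have dA: "disjoint_family_on (\<lambda>i. cball (a i) (r i)) C"
      using C(3) by (auto simp: disjoint_family_on_def pairwise_def disjnt_def)
    have dB: "disjoint_family_on (\<lambda>i. cball (b i) (c * r i)) C"
      using dA K(3) unfolding disjoint_family_on_def by blast
    have eV: "emeasure lebesgue V = (\<integral>\<^sup>+i. ennreal (2 * r i) \<partial>count_space C)"
      unfolding V_def using C(1) dA
      apply (subst emeasure_UN_countable)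
         apply (auto intro!: nn_integral_cong simp: cball_eq_atLeastAtMost)
      using K(1) by fastforce
    have eG: "emeasure lebesgue G = (\<integral>\<^sup>+i. ennreal (2 * (c * r i)) \<partial>count_space C)"
    proof -
      have "emeasure lebesgue (cball (b i) (c * r i)) = ennreal (2 * (c * r i))" if "i \<in> C" for i
        using mult_pos_pos[OF c K(1)[OF that]] by (simp add: cball_eq_atLeastAtMost)
      then show ?thesis
        unfolding G_def using C(1) dB
        by (subst emeasure_UN_countable) (auto intro!: nn_integral_cong)
    qed
    have eGV: "emeasure lebesgue G = ennreal c * emeasure lebesgue V"
      unfolding eG eV using c K(1)
      by (subst nn_integral_cmult[symmetric])
        (auto intro!: nn_integral_cong simp: ennreal_mult[symmetric] less_imp_le mult.assoc mult.left_commute)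
    have VU: "V \<subseteq> U" "G \<subseteq> V" using K(2,3) unfolding V_def G_def by blast+
    have sV: "V \<in> sets lebesgue" "G \<in> sets lebesgue"
      unfolding V_def G_def using C(1) by (auto intro!: sets.countable_UN')
    have lV: "V \<in> lmeasurable" "G \<in> lmeasurable"
      using VU sV U(3) fmeasurableI2 by blast+
    have mGV: "measure lebesgue G = c * measure lebesgue V"
      using eGV c by (simp add: measure_def enn2real_mult)
    define N where "N = S - V"
    have N: "N \<in> lmeasurable" "measure lebesgue N = 0"
      using C(4) unfolding N_def V_def by (auto simp: negligible_imp_measurable negligible_imp_measure0)
    have "m \<le> measure lebesgue (V \<union> N)"
    proof -
      have "S \<subseteq> V \<union> N" by (auto simp: N_def)
      moreover have "V \<union> N \<in> lmeasurable" using lV(1) N(1) by (rule fmeasurable.Un)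
      ultimately have "measure lebesgue (V \<union> N) \<in> MM" unfolding MM_def by blast
      then show ?thesis unfolding m_def using bdd by (intro cInf_lower)
    qed
    also have "\<dots> \<le> measure lebesgue V"
      using measure_Un_le[OF sV(1) fmeasurableD[OF N(1)]] N(2) by simp
    finally have mV: "m \<le> measure lebesgue V" .
    have "m \<le> measure lebesgue ((U - G) \<union> N)"
    proof -
      have "S \<subseteq> (U - G) \<union> N" using T(1) U(2) K(4) unfolding G_def N_def by blast
      moreover have "(U - G) \<union> N \<in> lmeasurable" using U(3) lV(2) N(1) by (intro fmeasurable.Un fmeasurable.Diff)
      ultimately have "measure lebesgue ((U - G) \<union> N) \<in> MM" unfolding MM_def by blast
      then show ?thesis unfolding m_def using bdd by (intro cInf_lower)
    qed
    also have "\<dots> \<le> measure lebesgue (U - G) + 0"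
      using measure_Un_le[OF sets.Diff[OF fmeasurableD[OF U(3)] sV(2)] fmeasurableD[OF N(1)]] N(2) by simp
    also have "\<dots> = measure lebesgue U - measure lebesgue G"
      using U lV VU by (simp add: measurable_measure_Diff fmeasurableD)
    also have "\<dots> \<le> (m + e) - c * m"
      using mGV mult_left_mono[OF mV less_imp_le[OF c]] U(4) T(3) by linarith
    finally show ?thesis by simp
  qed
  have "c * m \<le> 0" using shrink by (meson dense_ge)
  then have "m = 0" using m0 c by (simp add: mult_le_0_iff)
  show ?thesis
    unfolding negligible_outer
  proof (intro allI impI)
    fix e :: real assume "0 < e"
    then show "\<exists>T. S \<subseteq> T \<and> T \<in> lmeasurable \<and> measure lebesgue T < e"
      using cInf_lessD[OF ne, of e] \<open>m = 0\<close> unfolding m_def[symmetric] unfolding MM_def by blast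
  qed
qed

lemma porous_imp_negligible:
  fixes S :: "real set"
  assumes c: "0 < c"
    and por: "\<And>x d. x \<in> S \<Longrightarrow> 0 < d \<Longrightarrow>
      \<exists>r y. 0 < r \<and> r < d \<and> cball y (c * r) \<subseteq> cball x r \<and> cball y (c * r) \<inter> S = {}"
  shows "negligible S"
proof -
  have "negligible (S \<inter> cball 0 (real n))" for n
  proof (rule porous_bounded_imp_negligible[OF _ c])
    show "bounded (S \<inter> cball 0 (real n))" by (simp add: bounded_Int)
    fix x d :: real assume "x \<in> S \<inter> cball 0 (real n)" "0 < d"
    then obtain r y where "0 < r \<and> r < d \<and> cball y (c * r) \<subseteq> cball x r \<and> cball y (c * r) \<inter> S = {}"
      using por[of x d] by auto
    then show "\<exists>r y. 0 < r \<and> r < d \<and> cball y (c * r) \<subseteq> cball x r \<and> cball y (c * r) \<inter> (S \<inter> cball 0 (real n)) = {}"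
      by (intro exI[of _ r] exI[of _ y]) auto
  qed
  then have "negligible (\<Union>n. S \<inter> cball 0 (real n))"
    by (intro negligible_countable_Union) auto
  also have "(\<Union>n. S \<inter> cball 0 (real n)) = S"
    using real_arch_simple by auto
  finally show ?thesis .
qed

text \<open>Plays the part of the Lebesgue density theorem. Where the estimate fails, balls of
  radius comparable to \<open>\<bar>h\<bar>\<close> around \<open>t + h\<close> are holes of \<open>S\<close>, so that the exceptional set is porous.\<close>

lemma negligible_not_infdist_little_o:
  fixes S :: "real set"
  assumes "0 < e"
  shows "negligible {t\<in>S. \<forall>d>0. \<exists>h. \<bar>h\<bar> < d \<and> e * \<bar>h\<bar> < infdist (t + h) S}"
    (is "negligible ?B")
proof -
  define e' where "e' = min e 1"
  have e': "0 < e'" "e' \<le> e" "e' \<le> 1" using assms by (auto simp: e'_def)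
  show ?thesis
  proof (rule porous_imp_negligible[of "e'/2"])
    fix x d :: real assume x: "x \<in> ?B" and d: "0 < d"
    then obtain h where h: "\<bar>h\<bar> < d/2" "e * \<bar>h\<bar> < infdist (x + h) S"
    proof -
      have "\<forall>d>0. \<exists>h. \<bar>h\<bar> < d \<and> e * \<bar>h\<bar> < infdist (x + h) S" using x by simp
      from this[rule_format, of "d/2"] d that show ?thesis by auto
    qed
    have h0: "h \<noteq> 0" using h x by auto
    have le: "e' * \<bar>h\<bar> \<le> e * \<bar>h\<bar>" "e' * \<bar>h\<bar> \<le> \<bar>h\<bar>" using e' by (auto simp: mult_right_mono mult_left_le_one_le)
    have 1: "cball (x + h) (e' * \<bar>h\<bar>) \<inter> S = {}"
    proof (rule ccontr)
      assume "\<not> ?thesis"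
      then obtain s where "s \<in> S" "dist (x + h) s \<le> e' * \<bar>h\<bar>" by auto
      then show False using infdist_le2[of s S "x + h" "e' * \<bar>h\<bar>"] le h by linarith
    qed
    have 2: "cball (x + h) (e' * \<bar>h\<bar>) \<subseteq> cball x (2 * \<bar>h\<bar>)"
    proof
      fix y assume "y \<in> cball (x + h) (e' * \<bar>h\<bar>)"
      then have "\<bar>x + h - y\<bar> \<le> \<bar>h\<bar>" using le by (simp add: dist_real_def)
      then show "y \<in> cball x (2 * \<bar>h\<bar>)" by (simp add: dist_real_def)
    qed
    show "\<exists>r y. 0 < r \<and> r < d \<and> cball y (e'/2 * r) \<subseteq> cball x r \<and> cball y (e'/2 * r) \<inter> ?B = {}"
    proof (rule exI[of _ "2 * \<bar>h\<bar>"], rule exI[of _ "x + h"], intro conjI)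
      have eq: "e'/2 * (2 * \<bar>h\<bar>) = e' * \<bar>h\<bar>" by simp
      show "cball (x + h) (e'/2 * (2 * \<bar>h\<bar>)) \<subseteq> cball x (2 * \<bar>h\<bar>)" unfolding eq by (rule 2)
      show "cball (x + h) (e'/2 * (2 * \<bar>h\<bar>)) \<inter> ?B = {}" unfolding eq using 1 by blast
    qed (use h(1) h0 in simp_all)
  qed (use e' in auto)
qed

text \<open>A maximal inequality. Disjoint intervals on which \<open>g\<close> rises with slope more than \<open>\<theta>\<close> are mapped to
  disjoint intervals of \<open>[g a, g b]\<close> that are longer by the factor \<open>\<theta>\<close>.\<close>

lemma mono_steep_measure_le:
  fixes g :: "real \<Rightarrow> real"
  assumes g: "mono_on {a..b} g" and "0 < \<theta>" "a \<le> b"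
  shows "\<exists>T\<in>lmeasurable. {t \<in> {a<..<b}. \<forall>d>0. \<exists>h. \<bar>h\<bar> < d \<and> \<theta> * \<bar>h\<bar> < \<bar>g (t + h) - g t\<bar>} \<subseteq> T \<and>
           measure lebesgue T \<le> (g b - g a) / \<theta>"
    (is "\<exists>T\<in>lmeasurable. ?B \<subseteq> T \<and> _")
proof -
  define K where "K = {(u, v). a < u \<and> u < v \<and> v < b \<and> \<theta> * (v - u) < g v - g u}"
  define c r :: "real \<times> real \<Rightarrow> real" where "c = (\<lambda>(u,v). (u + v)/2)" and "r = (\<lambda>(u,v). (v - u)/2)"
  have cb: "cball (c i) (r i) = {fst i..snd i}" for i
    by (cases i) (simp add: c_def r_def cball_eq_atLeastAtMost field_simps)
  obtain C where C: "countable C" "C \<subseteq> K"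
      "pairwise (\<lambda>i j. disjnt (cball (c i) (r i)) (cball (c j) (r j))) C"
      "negligible (?B - (\<Union>i\<in>C. cball (c i) (r i)))"
  proof (rule Vitali_covering_theorem_cballs[of K r ?B c])
    show "0 < r i" if "i \<in> K" for i using that by (auto simp: K_def r_def)
    fix x d :: real assume x: "x \<in> ?B" "0 < d"
    then obtain h where h: "\<bar>h\<bar> < min d (min (x - a) (b - x))" "\<theta> * \<bar>h\<bar> < \<bar>g (x + h) - g x\<bar>"
    proof -
      have "\<forall>d>0. \<exists>h. \<bar>h\<bar> < d \<and> \<theta> * \<bar>h\<bar> < \<bar>g (x + h) - g x\<bar>" using x by simp
      from this[rule_format, of "min d (min (x - a) (b - x))"] x that show ?thesis by auto
    qed
    have h0: "h \<noteq> 0" using h by auto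
    define i where "i = (min x (x + h), max x (x + h))"
    have xh: "x + h \<in> {a..b}" "x \<in> {a..b}" using h x by auto
    have "i \<in> K"
    proof (cases "h > 0")
      case True
      then have "g x \<le> g (x + h)" using g xh by (intro mono_onD[OF g]) auto
      with True h x show ?thesis by (auto simp: i_def K_def)
    next
      case False
      then have "g (x + h) \<le> g x" using g xh by (intro mono_onD[OF g]) auto
      with False h h0 x show ?thesis by (auto simp: i_def K_def)
    qed
    moreover have "x \<in> cball (c i) (r i)" unfolding cb by (simp add: i_def)
    moreover have "r i < d" using h h0 by (auto simp: i_def r_def)
    ultimately show "\<exists>i. i \<in> K \<and> x \<in> cball (c i) (r i) \<and> r i < d" by blast
  qed
  have K: "a < fst i" "fst i < snd i" "snd i < b" "\<theta> * (snd i - fst i) < g (snd i) - g (fst i)" if "i \<in> C" for i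
    using that C(2) by (auto simp: K_def)
  define V where "V = (\<Union>i\<in>C. {fst i..snd i})"
  define G where "G = (\<Union>i\<in>C. {g (fst i)<..<g (snd i)})"
  have dj: "{fst i..snd i} \<inter> {fst j..snd j} = {}" if "i \<in> C" "j \<in> C" "i \<noteq> j" for i j
    using C(3) that unfolding pairwise_def cb disjnt_def by blast
  have dA: "disjoint_family_on (\<lambda>i. {fst i..snd i}) C"
    using dj by (auto simp: disjoint_family_on_def)
  have dB: "disjoint_family_on (\<lambda>i. {g (fst i)<..<g (snd i)}) C"
    unfolding disjoint_family_on_def
  proof (intro ballI impI)
    fix i j assume ij: "i \<in> C" "j \<in> C" "i \<noteq> j"
    have "snd i < fst j \<or> snd j < fst i"
    proof (rule ccontr)
      assume "\<not> ?thesis"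
      then have "max (fst i) (fst j) \<in> {fst i..snd i} \<inter> {fst j..snd j}"
        using K(2)[OF ij(1)] K(2)[OF ij(2)] by auto
      with dj[OF ij] show False by blast
    qed
    then have "g (snd i) \<le> g (fst j) \<or> g (snd j) \<le> g (fst i)"
      using K[OF ij(1)] K[OF ij(2)] by (auto intro: mono_onD[OF g])
    then show "{g (fst i)<..<g (snd i)} \<inter> {g (fst j)<..<g (snd j)} = {}" by auto
  qed
  have eV: "emeasure lebesgue V = (\<integral>\<^sup>+i. ennreal (snd i - fst i) \<partial>count_space C)"
    unfolding V_def using C(1) dA
    apply (subst emeasure_UN_countable)
       apply (auto intro!: nn_integral_cong)
    using K(2) by fastforce
  have eG: "emeasure lebesgue G = (\<integral>\<^sup>+i. ennreal (g (snd i) - g (fst i)) \<partial>count_space C)"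
  proof -
    have "emeasure lebesgue {g (fst i)<..<g (snd i)} = ennreal (g (snd i) - g (fst i))" if "i \<in> C" for i
      using K[OF that] by (simp add: mono_onD[OF g])
    then show ?thesis
      unfolding G_def using C(1) dB
      by (subst emeasure_UN_countable) (auto intro!: nn_integral_cong)
  qed
  have GU: "G \<subseteq> {g a..g b}"
  proof
    fix y assume "y \<in> G"
    then obtain i where i: "i \<in> C" "g (fst i) < y" "y < g (snd i)" by (auto simp: G_def)
    have "g a \<le> g (fst i)" "g (snd i) \<le> g b" using K[OF i(1)] by (auto intro!: mono_onD[OF g])
    then show "y \<in> {g a..g b}" using i by auto
  qed
  have gab: "g a \<le> g b" using assms by (auto intro: mono_onD[OF g])
  have "ennreal \<theta> * emeasure lebesgue V \<le> emeasure lebesgue G"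
    unfolding eV eG using \<open>0 < \<theta>\<close>
    apply (subst nn_integral_cmult[symmetric])
     apply simp
    apply (rule nn_integral_mono)
    using K by (auto simp: ennreal_mult[symmetric] less_imp_le intro!: ennreal_leI)
  also have "\<dots> \<le> emeasure lebesgue {g a..g b}"
    using GU by (intro emeasure_mono) auto
  also have "\<dots> = ennreal (g b - g a)" using gab by simp
  finally have 1: "ennreal \<theta> * emeasure lebesgue V \<le> ennreal (g b - g a)" .
  have sV: "V \<in> sets lebesgue"
    unfolding V_def using C(1) by (auto intro!: sets.countable_UN')
  have "V \<subseteq> cbox a b"
  proof
    fix y assume "y \<in> V"
    then obtain i where i: "i \<in> C" "y \<in> {fst i..snd i}" unfolding V_def by blast
    then show "y \<in> cbox a b" using K(1,3)[OF i(1)] by simp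
  qed
  then have lV: "V \<in> lmeasurable"
    using sV fmeasurableI2[OF lmeasurable_cbox] by blast
  have "\<theta> * measure lebesgue V \<le> g b - g a"
  proof -
    have "ennreal (\<theta> * measure lebesgue V) \<le> ennreal (g b - g a)"
      using 1 \<open>0 < \<theta>\<close> by (simp add: emeasure_eq_measure2[OF lV] ennreal_mult)
    then show ?thesis using gab by (simp add: ennreal_le_iff)
  qed
  then have mV: "measure lebesgue V \<le> (g b - g a) / \<theta>"
    using \<open>0 < \<theta>\<close> by (simp add: field_simps)
  define N where "N = ?B - V"
  have N: "N \<in> lmeasurable" "measure lebesgue N = 0"
    using C(4) unfolding N_def V_def cb by (auto simp: negligible_imp_measurable negligible_imp_measure0)
  have "measure lebesgue (V \<union> N) \<le> measure lebesgue V"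
    using measure_Un_le[OF sV fmeasurableD[OF N(1)]] N(2) by simp
  with mV have "measure lebesgue (V \<union> N) \<le> (g b - g a) / \<theta>" by simp
  moreover have "?B \<subseteq> V \<union> N" unfolding N_def by blast
  ultimately show ?thesis using fmeasurable.Un[OF lV N(1)] by blast
qed

section \<open>Derivatives of arc-length parametrizations\<close>

text \<open>Near \<open>t\<close> the difference quotients of \<open>\<gamma>\<close> stay within \<open>e\<close> of one unit vector. Steadiness for
  all \<open>e > 0\<close> amounts to a derivative of norm one.\<close>

definition steady :: "(real \<Rightarrow> 'a::real_inner) \<Rightarrow> real \<Rightarrow> real \<Rightarrow> bool" where
  "steady \<gamma> e t \<longleftrightarrow>
     (\<exists>x. norm x = 1 \<and> (\<exists>d>0. \<forall>h. \<bar>h\<bar> < d \<longrightarrow> norm (\<gamma> (t + h) - \<gamma> t - h *\<^sub>R x) \<le> e * \<bar>h\<bar>))"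

text \<open>With \<open>x\<close> the direction of the chord, \<open>g t = t - \<gamma> t \<bullet> x\<close> is nondecreasing and its total increase is the
  excess of the length of the interval over the length of the chord. Where \<open>g\<close> is not steep, an
  increment \<open>D\<close> of \<open>\<gamma>\<close> over \<open>h\<close> satisfies \<open>(norm (D - h x))\<^sup>2 \<le> 2 h (h - D \<bullet> x)\<close>, which is small compared with \<open>h\<^sup>2\<close>.\<close>

lemma not_steady_measure_le:
  fixes \<gamma> :: "real \<Rightarrow> 'a::real_inner"
  assumes lip: "\<And>s t. s \<in> {a..b} \<Longrightarrow> t \<in> {a..b} \<Longrightarrow> norm (\<gamma> s - \<gamma> t) \<le> \<bar>s - t\<bar>"
    and ab: "a \<le> b" and e: "0 < e" "e \<le> 1"
  shows "\<exists>T\<in>lmeasurable. {t \<in> {a<..<b}. \<not> steady \<gamma> e t} \<subseteq> T \<and>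
           measure lebesgue T \<le> 2 / e\<^sup>2 * ((b - a) - norm (\<gamma> b - \<gamma> a))"
proof (cases "\<gamma> b = \<gamma> a")
  case True
  have "e\<^sup>2 \<le> 1" using e by (simp add: power_le_one)
  then have "1 \<le> 2 / e\<^sup>2" using e by (simp add: field_simps)
  then have "1 * (b - a) \<le> 2 / e\<^sup>2 * (b - a)" using ab by (intro mult_right_mono) auto
  then show ?thesis using True ab by (intro bexI[of _ "{a<..<b}"]) auto
next
  case False
  define x where "x = sgn (\<gamma> b - \<gamma> a)"
  have x: "norm x = 1" using False by (simp add: x_def norm_sgn)
  define g where "g t = t - \<gamma> t \<bullet> x" for t
  have "mono_on {a..b} g"
  proof (rule mono_onI)
    fix r s assume rs: "r \<in> {a..b}" "s \<in> {a..b}" "r \<le> s"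
    have "(\<gamma> s - \<gamma> r) \<bullet> x \<le> norm (\<gamma> s - \<gamma> r) * norm x" by (rule norm_cauchy_schwarz)
    also have "\<dots> \<le> s - r" using lip[of s r] rs x by simp
    finally show "g r \<le> g s" by (simp add: g_def inner_diff_left)
  qed
  then obtain T where T: "T \<in> lmeasurable"
      "{t \<in> {a<..<b}. \<forall>d>0. \<exists>h. \<bar>h\<bar> < d \<and> e\<^sup>2/2 * \<bar>h\<bar> < \<bar>g (t + h) - g t\<bar>} \<subseteq> T"
      "measure lebesgue T \<le> (g b - g a) / (e\<^sup>2/2)"
    using mono_steep_measure_le[of a b g "e\<^sup>2/2"] ab e by auto
  have "(\<gamma> b - \<gamma> a) \<bullet> x = norm (\<gamma> b - \<gamma> a)"
    using False by (simp add: x_def sgn_div_norm dot_square_norm power2_eq_square divide_inverse)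
  then have gab: "g b - g a = (b - a) - norm (\<gamma> b - \<gamma> a)"
    by (simp add: g_def inner_diff_left)
  have "steady \<gamma> e t" if t: "t \<in> {a<..<b}" "t \<notin> T" for t
  proof -
    obtain d where d: "d > 0" "\<And>h. \<bar>h\<bar> < d \<Longrightarrow> \<bar>g (t + h) - g t\<bar> \<le> e\<^sup>2/2 * \<bar>h\<bar>"
    proof -
      have "\<not> (\<forall>d>0. \<exists>h. \<bar>h\<bar> < d \<and> e\<^sup>2/2 * \<bar>h\<bar> < \<bar>g (t + h) - g t\<bar>)"
        using t T(2) by blast
      with that show ?thesis by (meson not_less)
    qed
    show ?thesis unfolding steady_def
    proof (intro exI conjI allI impI)
      show "norm x = 1" by fact
      show "0 < min d (min (t - a) (b - t))" using d t by auto
      fix h assume h: "\<bar>h\<bar> < min d (min (t - a) (b - t))"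
      define D where "D = \<gamma> (t + h) - \<gamma> t"
      have "norm D \<le> \<bar>h\<bar>" using lip[of "t + h" t] h t by (auto simp: D_def abs_less_iff)
      then have D2: "D \<bullet> D \<le> h\<^sup>2" using abs_le_square_iff[of "norm D" h] by (simp add: power2_norm_eq_inner)
      have gh: "g (t + h) - g t = h - D \<bullet> x" by (simp add: g_def D_def inner_diff_left)
      have "(norm (D - h *\<^sub>R x))\<^sup>2 = D \<bullet> D - 2 * h * (D \<bullet> x) + h\<^sup>2 * (x \<bullet> x)"
        unfolding power2_norm_eq_inner
        by (simp add: inner_diff_left inner_diff_right inner_commute power2_eq_square algebra_simps)
      also have "\<dots> \<le> 2 * (h * (h - D \<bullet> x))"
        using D2 x by (simp add: dot_square_norm algebra_simps power2_eq_square)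
      also have "\<dots> \<le> 2 * (\<bar>h\<bar> * (e\<^sup>2/2 * \<bar>h\<bar>))"
      proof -
        have "h * (h - D \<bullet> x) \<le> \<bar>h\<bar> * \<bar>h - D \<bullet> x\<bar>" by (metis abs_ge_self abs_mult)
        also have "\<dots> \<le> \<bar>h\<bar> * (e\<^sup>2/2 * \<bar>h\<bar>)"
          using d(2)[of h] h gh by (intro mult_left_mono) auto
        finally show ?thesis by simp
      qed
      also have "\<dots> = (e * \<bar>h\<bar>)\<^sup>2" by (simp add: power2_eq_square)
      finally show "norm (\<gamma> (t + h) - \<gamma> t - h *\<^sub>R x) \<le> e * \<bar>h\<bar>"
        unfolding D_def using e by (auto intro: power2_le_imp_le)
    qed
  qed
  moreover have "(g b - g a) / (e\<^sup>2/2) = 2 / e\<^sup>2 * ((b - a) - norm (\<gamma> b - \<gamma> a))"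
    using e by (simp add: gab field_simps)
  ultimately show ?thesis using T by (intro bexI[of _ T]) auto
qed

lemma not_steady_partition_measure_le:
  fixes \<gamma> :: "real \<Rightarrow> 'a::real_inner" and s :: "nat \<Rightarrow> real"
  assumes lip: "\<And>s t. s \<in> {0..l} \<Longrightarrow> t \<in> {0..l} \<Longrightarrow> norm (\<gamma> s - \<gamma> t) \<le> \<bar>s - t\<bar>"
    and s: "mono s" "range s \<subseteq> {0..l}" and e: "0 < e" "e \<le> 1"
  shows "\<exists>T\<in>lmeasurable. {t \<in> {s 0<..<s n}. \<not> steady \<gamma> e t} \<subseteq> T \<and>
           measure lebesgue T \<le> 2 / e\<^sup>2 * ((s n - s 0) - (\<Sum>i<n. dist (\<gamma> (s i)) (\<gamma> (s (Suc i)))))"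
proof (induction n)
  case 0
  show ?case by (intro bexI[of _ "{}"]) auto
next
  case (Suc n)
  then obtain T where T: "T \<in> lmeasurable" "{t \<in> {s 0<..<s n}. \<not> steady \<gamma> e t} \<subseteq> T"
    "measure lebesgue T \<le> 2 / e\<^sup>2 * ((s n - s 0) - (\<Sum>i<n. dist (\<gamma> (s i)) (\<gamma> (s (Suc i)))))" by auto
  have sn: "s n \<le> s (Suc n)" "s n \<in> {0..l}" "s (Suc n) \<in> {0..l}"
    using s(2) monoD[OF s(1), of n "Suc n"] by (auto simp: subset_iff)
  obtain T' where T': "T' \<in> lmeasurable" "{t \<in> {s n<..<s (Suc n)}. \<not> steady \<gamma> e t} \<subseteq> T'"
    "measure lebesgue T' \<le> 2 / e\<^sup>2 * ((s (Suc n) - s n) - norm (\<gamma> (s (Suc n)) - \<gamma> (s n)))"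
    using not_steady_measure_le[of "s n" "s (Suc n)" \<gamma> e] lip sn e by auto
  have P: "{s n} \<in> lmeasurable" "measure lebesgue {s n} = 0"
    by (auto simp: negligible_imp_measurable negligible_imp_measure0)
  have "measure lebesgue ((T \<union> T') \<union> {s n}) \<le> measure lebesgue (T \<union> T') + measure lebesgue {s n}"
    using T T' P by (intro measure_Un_le) (auto simp: fmeasurableD)
  also have "\<dots> \<le> measure lebesgue T + measure lebesgue T'"
    using measure_Un_le[OF fmeasurableD[OF T(1)] fmeasurableD[OF T'(1)]] P(2) by simp
  also have "\<dots> \<le> 2 / e\<^sup>2 * ((s (Suc n) - s 0) - (\<Sum>i<Suc n. dist (\<gamma> (s i)) (\<gamma> (s (Suc i)))))"
    using T(3) T'(3) by (simp add: dist_norm norm_minus_commute algebra_simps)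
  finally have "measure lebesgue ((T \<union> T') \<union> {s n}) \<le>
      2 / e\<^sup>2 * ((s (Suc n) - s 0) - (\<Sum>i<Suc n. dist (\<gamma> (s i)) (\<gamma> (s (Suc i)))))" .
  moreover have "{t \<in> {s 0<..<s (Suc n)}. \<not> steady \<gamma> e t} \<subseteq> (T \<union> T') \<union> {s n}"
    using T(2) T'(2) by force
  moreover have "(T \<union> T') \<union> {s n} \<in> lmeasurable"
    using T T' P by (intro fmeasurable.Un)
  ultimately show ?case by blast
qed

lemma arclength_param_lipschitz:
  assumes "arclength_param \<gamma> l \<Gamma>" "s \<in> {0..l}" "t \<in> {0..l}"
  shows "dist (\<gamma> s) (\<gamma> t) \<le> \<bar>s - t\<bar>"
proof -
  have *: "dist (\<gamma> s) (\<gamma> t) \<le> t - s" if st: "0 \<le> s" "s \<le> t" "t \<le> l" for s t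
  proof -
    define p :: "nat \<Rightarrow> real" where "p i = (if i = 0 then s else t)" for i
    have "mono p" using st by (auto simp: mono_def p_def)
    then have "(1::nat, p) \<in> {(n, q). mono q \<and> range q \<subseteq> {s..t}}"
      using st by (auto simp: p_def)
    then have "(case (1::nat, p) of (n, q) \<Rightarrow> \<Sum>i<n. ennreal (dist (\<gamma> (q i)) (\<gamma> (q (Suc i))))) \<le> curve_length \<gamma> s t"
      unfolding curve_length_def by (rule SUP_upper)
    then have "ennreal (dist (\<gamma> s) (\<gamma> t)) \<le> curve_length \<gamma> s t" by (simp add: p_def)
    also have "\<dots> = ennreal (t - s)" using assms(1) st by (auto simp: arclength_param_def)
    finally show ?thesis using st by (simp add: ennreal_le_iff)
  qed
  show ?thesis
  proof (cases "s \<le> t")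
    case True then show ?thesis using *[of s t] assms by auto
  next
    case False then show ?thesis using *[of t s] assms by (auto simp: dist_commute)
  qed
qed

lemma negligible_not_steady:
  fixes \<gamma> :: "real \<Rightarrow> 'a::real_inner"
  assumes al: "arclength_param \<gamma> l \<Gamma>" and e: "0 < e" "e \<le> 1"
  shows "negligible {t \<in> {0<..<l}. \<not> steady \<gamma> e t}"
  unfolding negligible_outer_le
proof (intro allI impI)
  fix \<eta> :: real assume eta: "0 < \<eta>"
  have l0: "0 \<le> l" using al by (simp add: arclength_param_def)
  have lip: "\<And>s t. s \<in> {0..l} \<Longrightarrow> t \<in> {0..l} \<Longrightarrow> norm (\<gamma> s - \<gamma> t) \<le> \<bar>s - t\<bar>"
    using arclength_param_lipschitz[OF al] by (simp add: dist_norm)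
  \<comment> \<open>as \<open>1 \<le> C\<close>, the two end pieces outside the partition may be counted with the factor \<open>C\<close> as well\<close>
  define C where "C = 2 / e\<^sup>2"
  have "e\<^sup>2 \<le> 1" using e by (simp add: power_le_one)
  then have C: "1 \<le> C" using e by (simp add: C_def field_simps)
  obtain n s where s: "mono s" "range s \<subseteq> {0..l}" "l - \<eta> / C \<le> (\<Sum>i<n. dist (\<gamma> (s i)) (\<gamma> (s (Suc i))))"
  proof (cases "l - \<eta> / C < 0")
    case True
    have "mono (\<lambda>i::nat. 0::real)" by (simp add: mono_def)
    with that[of "\<lambda>_. 0" 0] True l0 show thesis by auto
  next
    case False
    have "ennreal (l - \<eta> / C) < curve_length \<gamma> 0 l"
    proof -
      have "curve_length \<gamma> 0 l = ennreal l" using al l0 by (auto simp: arclength_param_def)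
      moreover have "0 < \<eta> / C" using eta C by auto
      ultimately show ?thesis using False by (simp add: ennreal_less_iff)
    qed
    then obtain n s where "mono s" "range s \<subseteq> {0..l}"
      "ennreal (l - \<eta> / C) < (\<Sum>i<n. ennreal (dist (\<gamma> (s i)) (\<gamma> (s (Suc i)))))"
      unfolding curve_length_def less_SUP_iff by auto
    with that[of s n] False show thesis by (auto simp: sum_ennreal ennreal_less_iff less_imp_le)
  qed
  obtain T where T: "T \<in> lmeasurable" "{t \<in> {s 0<..<s n}. \<not> steady \<gamma> e t} \<subseteq> T"
    "measure lebesgue T \<le> C * ((s n - s 0) - (\<Sum>i<n. dist (\<gamma> (s i)) (\<gamma> (s (Suc i)))))"
    using not_steady_partition_measure_le[OF lip s(1,2) e, of n] unfolding C_def by blast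
  have sn: "0 \<le> s 0" "s 0 \<le> s n" "s n \<le> l" using s(2) monoD[OF s(1), of 0 n] by (auto simp: subset_iff)
  define I where "I = {0..s 0} \<union> {s n..l}"
  have I: "I \<in> lmeasurable" "measure lebesgue I \<le> s 0 + (l - s n)"
  proof -
    have "measure lebesgue I \<le> measure lebesgue {0..s 0} + measure lebesgue {s n..l}"
      unfolding I_def by (intro measure_Un_le) auto
    then show "measure lebesgue I \<le> s 0 + (l - s n)" using sn by simp
    show "I \<in> lmeasurable" unfolding I_def by (intro fmeasurable.Un) auto
  qed
  have "measure lebesgue (T \<union> I) \<le> measure lebesgue T + measure lebesgue I"
    using T I by (intro measure_Un_le) (auto simp: fmeasurableD)
  also have "\<dots> \<le> C * ((s n - s 0) - (\<Sum>i<n. dist (\<gamma> (s i)) (\<gamma> (s (Suc i))))) + C * (s 0 + (l - s n))"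
  proof -
    have "1 * (s 0 + (l - s n)) \<le> C * (s 0 + (l - s n))" using C sn by (intro mult_right_mono) auto
    then show ?thesis using T(3) I(2) by simp
  qed
  also have "\<dots> = C * (l - (\<Sum>i<n. dist (\<gamma> (s i)) (\<gamma> (s (Suc i)))))" by (simp add: algebra_simps)
  also have "\<dots> \<le> C * (\<eta> / C)" using s(3) C by (intro mult_left_mono) auto
  also have "\<dots> = \<eta>" using C by simp
  finally have "measure lebesgue (T \<union> I) \<le> \<eta>" .
  moreover have "{t \<in> {0<..<l}. \<not> steady \<gamma> e t} \<subseteq> T \<union> I"
    using T(2) by (force simp: I_def)
  ultimately show "\<exists>T. {t \<in> {0<..<l}. \<not> steady \<gamma> e t} \<subseteq> T \<and> T \<in> lmeasurable \<and> measure lebesgue T \<le> \<eta>"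
    using fmeasurable.Un[OF T(1) I(1)] by blast
qed

text \<open>The unit vectors that witness steadiness for different \<open>e\<close> approximate the same difference
  quotients, so they form a Cauchy sequence.\<close>

lemma steady_imp_unit_derivative:
  fixes \<gamma> :: "real \<Rightarrow> 'a::{real_inner, complete_space}"
  assumes st: "\<And>k::nat. steady \<gamma> (1 / (real k + 1)) t"
  shows "\<exists>v. norm v = 1 \<and> (\<gamma> has_vector_derivative v) (at t)"
proof -
  let ?e = "\<lambda>k::nat. 1 / (real k + 1)"
  have "\<forall>k. \<exists>x d. norm x = 1 \<and> d > 0 \<and> (\<forall>h. \<bar>h\<bar> < d \<longrightarrow> norm (\<gamma> (t + h) - \<gamma> t - h *\<^sub>R x) \<le> ?e k * \<bar>h\<bar>)"
    using st unfolding steady_def by blast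
  then obtain x d where x: "\<And>k. norm (x k) = 1" and d: "\<And>k::nat. d k > (0::real)"
    and xd: "\<And>k h. \<bar>h\<bar> < d k \<Longrightarrow> norm (\<gamma> (t + h) - \<gamma> t - h *\<^sub>R x k) \<le> ?e k * \<bar>h\<bar>"
    by metis
  have xx: "norm (x j - x k) \<le> ?e j + ?e k" for j k
  proof -
    define h where "h = min (d j) (d k) / 2"
    have h: "0 < h" "\<bar>h\<bar> < d j" "\<bar>h\<bar> < d k" using d[of j] d[of k] by (auto simp: h_def min_def)
    have "h * norm (x j - x k) = norm (h *\<^sub>R (x j - x k))" using h by simp
    also have "h *\<^sub>R (x j - x k) = (\<gamma> (t + h) - \<gamma> t - h *\<^sub>R x k) - (\<gamma> (t + h) - \<gamma> t - h *\<^sub>R x j)"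
      by (simp add: algebra_simps)
    also have "norm \<dots> \<le> ?e k * \<bar>h\<bar> + ?e j * \<bar>h\<bar>"
      using norm_triangle_ineq4 xd[OF h(2)] xd[OF h(3)] by (meson add_mono order_trans)
    also have "\<dots> = h * (?e j + ?e k)" using h by (simp add: algebra_simps)
    finally show ?thesis using h by simp
  qed
  have e0: "?e \<longlonglongrightarrow> 0" using LIMSEQ_inverse_real_of_nat by (simp add: inverse_eq_divide add.commute)
  have emono: "?e j \<le> ?e k" if "k \<le> j" for j k using that by (simp add: frac_le)
  have "Cauchy x"
  proof (rule metric_CauchyI)
    fix r :: real assume "r > 0"
    then have "r / 2 > 0" by simp
    then obtain M where M: "\<And>k. k \<ge> M \<Longrightarrow> \<bar>?e k\<bar> < r / 2"
      using LIMSEQ_D[OF e0, of "r/2"] by auto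
    have "dist (x i) (x j) < r" if "i \<ge> M" "j \<ge> M" for i j
      using xx[of i j] M[OF that(1)] M[OF that(2)] unfolding dist_norm by linarith
    then show "\<exists>M. \<forall>m\<ge>M. \<forall>n\<ge>M. dist (x m) (x n) < r" by blast
  qed
  then obtain v where v: "x \<longlonglongrightarrow> v" using Cauchy_convergent_iff convergent_def by blast
  have "norm v = 1"
    using tendsto_norm[OF v] x by (simp add: LIMSEQ_const_iff)
  have xv: "norm (x k - v) \<le> 2 * ?e k" for k
  proof (rule tendsto_upperbound)
    show "(\<lambda>j. norm (x k - x j)) \<longlonglongrightarrow> norm (x k - v)" by (intro tendsto_intros v)
    show "\<forall>\<^sub>F j in sequentially. norm (x k - x j) \<le> 2 * ?e k"
    proof (rule eventually_sequentiallyI[of k])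
      fix j assume "k \<le> j"
      then show "norm (x k - x j) \<le> 2 * ?e k" using xx[of k j] emono[of k j] by linarith
    qed
  qed simp
  have "(\<gamma> has_vector_derivative v) (at t)"
    unfolding has_vector_derivative_def has_derivative_at_alt
  proof (intro conjI allI impI)
    show "bounded_linear (\<lambda>x. x *\<^sub>R v)" by (rule bounded_linear_scaleR_left)
    fix r :: real assume "0 < r"
    then have "r / 3 > 0" by simp
    then obtain k where k: "\<bar>?e k\<bar> < r / 3" using LIMSEQ_D[OF e0, of "r/3"] by auto
    show "\<exists>d>0. \<forall>y. norm (y - t) < d \<longrightarrow> norm (\<gamma> y - \<gamma> t - (y - t) *\<^sub>R v) \<le> r * norm (y - t)"
    proof (intro exI conjI allI impI)
      show "0 < d k" by fact
      fix y assume y: "norm (y - t) < d k"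
      have "\<gamma> y - \<gamma> t - (y - t) *\<^sub>R v = (\<gamma> (t + (y - t)) - \<gamma> t - (y - t) *\<^sub>R x k) + (y - t) *\<^sub>R (x k - v)"
        by (simp add: algebra_simps)
      also have "norm \<dots> \<le> ?e k * \<bar>y - t\<bar> + \<bar>y - t\<bar> * (2 * ?e k)"
      proof (intro norm_triangle_le add_mono)
        show "norm (\<gamma> (t + (y - t)) - \<gamma> t - (y - t) *\<^sub>R x k) \<le> ?e k * \<bar>y - t\<bar>"
          using xd[of "y - t" k] y by simp
        show "norm ((y - t) *\<^sub>R (x k - v)) \<le> \<bar>y - t\<bar> * (2 * ?e k)"
          unfolding norm_scaleR using xv[of k] by (rule mult_left_mono) simp
      qed
      also have "\<dots> = (3 * ?e k) * \<bar>y - t\<bar>" by (simp add: algebra_simps)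
      also have "\<dots> \<le> r * \<bar>y - t\<bar>" using k by (intro mult_right_mono) linarith+
      finally show "norm (\<gamma> y - \<gamma> t - (y - t) *\<^sub>R v) \<le> r * norm (y - t)" by simp
    qed
  qed
  with \<open>norm v = 1\<close> show ?thesis by blast
qed

lemma arclength_param_unit_derivative_ae:
  fixes \<gamma> :: "real \<Rightarrow> 'a::{real_inner, complete_space}"
  assumes "arclength_param \<gamma> l \<Gamma>"
  shows "negligible {t \<in> {0..l}. \<not> (0 < t \<and> t < l \<and> (\<exists>v. norm v = 1 \<and> (\<gamma> has_vector_derivative v) (at t)))}"
proof (rule negligible_subset)
  have "negligible (\<Union>k::nat. {t \<in> {0<..<l}. \<not> steady \<gamma> (1 / (real k + 1)) t})"
    using negligible_not_steady[OF assms] by (intro negligible_countable_Union) auto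
  then show "negligible ((\<Union>k::nat. {t \<in> {0<..<l}. \<not> steady \<gamma> (1 / (real k + 1)) t}) \<union> {0, l})"
    by (intro negligible_Un) auto
  show "{t \<in> {0..l}. \<not> (0 < t \<and> t < l \<and> (\<exists>v. norm v = 1 \<and> (\<gamma> has_vector_derivative v) (at t)))}
      \<subseteq> (\<Union>k::nat. {t \<in> {0<..<l}. \<not> steady \<gamma> (1 / (real k + 1)) t}) \<union> {0, l}"
    using steady_imp_unit_derivative by fastforce
qed

section \<open>Self-crossings and exceptional sets on a curve\<close>

lemma countable_no_limit_points:
  fixes S :: "'b::{t1_space, second_countable_topology} set"
  assumes "\<And>x. x \<in> S \<Longrightarrow> \<not> x islimpt S"
  shows "countable S"
proof -
  obtain B :: "'b set set" where B: "countable B" "topological_basis B"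
    using ex_countable_basis by blast
  have "\<forall>x\<in>S. \<exists>b\<in>B. b \<inter> S = {x}"
  proof
    fix x assume x: "x \<in> S"
    then obtain U where U: "open U" "x \<in> U" "\<forall>y\<in>S. y \<in> U \<longrightarrow> y = x"
      using assms[OF x] unfolding islimpt_def by blast
    then obtain b where "b \<in> B" "x \<in> b" "b \<subseteq> U"
      using topological_basisE[OF B(2) U(1,2)] by blast
    with U x show "\<exists>b\<in>B. b \<inter> S = {x}" by blast
  qed
  then obtain f where f: "\<And>x. x \<in> S \<Longrightarrow> f x \<in> B \<and> f x \<inter> S = {x}" by metis
  have "inj_on f S" by (rule inj_onI) (metis f insertI1 singletonD)
  moreover have "f ` S \<subseteq> B" using f by blast
  ultimately show ?thesis using B(1) by (meson countable_image_inj_on countable_subset)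
qed

lemma nonparallel_lower_bound:
  fixes v w :: "'a::real_inner"
  assumes "v \<noteq> 0" "w \<noteq> 0" "span {v} \<noteq> span {w}"
  shows "\<exists>c>0. \<forall>a b. c * (\<bar>a\<bar> + \<bar>b\<bar>) \<le> norm (a *\<^sub>R v - b *\<^sub>R w)"
proof -
  have *: "\<exists>c>0. \<forall>a b. c * \<bar>a\<bar> \<le> norm (a *\<^sub>R v - b *\<^sub>R w)"
    if w: "w \<noteq> 0" and sp: "v \<notin> span {w}" for v w :: 'a
  proof -
    define u where "u = (w \<bullet> w) *\<^sub>R v - (v \<bullet> w) *\<^sub>R w"
    have wu: "w \<bullet> u = 0" by (simp add: u_def inner_diff_right inner_commute)
    have u0: "u \<noteq> 0"
    proof
      assume "u = 0"
      then have "v = ((v \<bullet> w) / (w \<bullet> w)) *\<^sub>R w"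
        using w by (simp add: u_def) (metis divideR_right inner_eq_zero_iff scaleR_scaleR divide_inverse_commute)
      then show False using sp by (metis span_base span_scale singletonI)
    qed
    \<comment> \<open>pairing with \<open>u\<close> kills \<open>w\<close> and thus isolates the coefficient of \<open>v\<close>\<close>
    have "u \<bullet> u = (w \<bullet> w) * (v \<bullet> u)"
      using wu by (subst (1) u_def) (simp add: inner_diff_left)
    then have "v \<bullet> u \<noteq> 0" using u0 by auto
    then have c: "0 < \<bar>v \<bullet> u\<bar> / norm u" using u0 by simp
    have "\<bar>v \<bullet> u\<bar> / norm u * \<bar>a\<bar> \<le> norm (a *\<^sub>R v - b *\<^sub>R w)" for a b
    proof -
      have "\<bar>a\<bar> * \<bar>v \<bullet> u\<bar> = \<bar>(a *\<^sub>R v - b *\<^sub>R w) \<bullet> u\<bar>"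
        using wu by (simp add: inner_diff_left abs_mult)
      also have "\<dots> \<le> norm (a *\<^sub>R v - b *\<^sub>R w) * norm u" by (rule Cauchy_Schwarz_ineq2)
      finally show ?thesis using u0 by (simp add: field_simps)
    qed
    with c show ?thesis by blast
  qed
  have "v \<notin> span {w}" "w \<notin> span {v}"
  proof -
    have "span {v} = span {w}" if vw: "v \<in> span {w}" "v \<noteq> 0" for v w :: 'a
    proof -
      obtain k where k: "v = k *\<^sub>R w" using vw(1) by (auto simp: span_singleton)
      then have "w = (1/k) *\<^sub>R v" using vw(2) by auto
      then have "w \<in> span {v}" by (metis span_base span_scale singletonI)
      then show ?thesis using vw(1) by (simp add: span_eq)
    qed
    from this[of v w] this[of w v] show "v \<notin> span {w}" "w \<notin> span {v}" using assms by auto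
  qed
  then obtain c c' where c: "c > 0" "\<And>a b. c * \<bar>a\<bar> \<le> norm (a *\<^sub>R v - b *\<^sub>R w)"
    and c': "c' > 0" "\<And>a b. c' * \<bar>a\<bar> \<le> norm (a *\<^sub>R w - b *\<^sub>R v)"
    using *[of w v] *[of v w] assms by metis
  show ?thesis
  proof (intro exI[of _ "min c c' / 2"] conjI allI)
    show "0 < min c c' / 2" using c c' by simp
    fix a b
    have "min c c' * \<bar>a\<bar> \<le> norm (a *\<^sub>R v - b *\<^sub>R w)"
      using c(2)[of a b] mult_right_mono[of "min c c'" c "\<bar>a\<bar>"] by simp
    moreover have "min c c' * \<bar>b\<bar> \<le> norm (a *\<^sub>R v - b *\<^sub>R w)"
      using c'(2)[of b a] mult_right_mono[of "min c c'" c' "\<bar>b\<bar>"] by (simp add: norm_minus_commute)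
    ultimately show "min c c' / 2 * (\<bar>a\<bar> + \<bar>b\<bar>) \<le> norm (a *\<^sub>R v - b *\<^sub>R w)"
      by (simp add: algebra_simps)
  qed
qed

lemma countable_imp_negligible: "countable N \<Longrightarrow> negligible (N :: real set)"
  using countable_imp_null_set_lborel[of N] by (simp add: negligible_iff_null_sets null_sets_completionI)

text \<open>Pairs of times at which two branches cross with different tangents are isolated in the plane: near
  such a pair the branches separate linearly in both parameters.\<close>

lemma countable_transversal_crossings:
  fixes \<gamma> :: "real \<Rightarrow> 'a::real_inner"
  shows "countable {s. \<exists>t v w. \<gamma> s = \<gamma> t \<and> (\<gamma> has_vector_derivative v) (at s) \<and>
     (\<gamma> has_vector_derivative w) (at t) \<and> v \<noteq> 0 \<and> w \<noteq> 0 \<and> span {v} \<noteq> span {w}}"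
proof -
  define Z where "Z = {(s, t). \<gamma> s = \<gamma> t \<and> (\<exists>v w. (\<gamma> has_vector_derivative v) (at s) \<and>
     (\<gamma> has_vector_derivative w) (at t) \<and> v \<noteq> 0 \<and> w \<noteq> 0 \<and> span {v} \<noteq> span {w})}"
  have "countable Z"
  proof (rule countable_no_limit_points)
    fix z assume "z \<in> Z"
    then obtain s t v w where z: "z = (s, t)" and st: "\<gamma> s = \<gamma> t"
      and v: "(\<gamma> has_vector_derivative v) (at s)" and w: "(\<gamma> has_vector_derivative w) (at t)"
      and ne: "v \<noteq> 0" "w \<noteq> 0" "span {v} \<noteq> span {w}"
      unfolding Z_def by blast
    obtain c where c: "c > 0" "\<And>a b. c * (\<bar>a\<bar> + \<bar>b\<bar>) \<le> norm (a *\<^sub>R v - b *\<^sub>R w)"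
      using nonparallel_lower_bound[OF ne] by blast
    have "c / 2 > 0" using c by simp
    then obtain d1 where d1: "d1 > 0"
        "\<And>y. norm (y - s) < d1 \<Longrightarrow> norm (\<gamma> y - \<gamma> s - (y - s) *\<^sub>R v) \<le> c/2 * norm (y - s)"
      using v unfolding has_vector_derivative_def has_derivative_at_alt by blast
    obtain d2 where d2: "d2 > 0"
        "\<And>y. norm (y - t) < d2 \<Longrightarrow> norm (\<gamma> y - \<gamma> t - (y - t) *\<^sub>R w) \<le> c/2 * norm (y - t)"
      using w \<open>c / 2 > 0\<close> unfolding has_vector_derivative_def has_derivative_at_alt by blast
    show "\<not> z islimpt Z"
    proof
      assume "z islimpt Z"
      then obtain z' where z': "z' \<in> Z" "z' \<noteq> z" "dist z' z < min d1 d2"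
        using d1(1) d2(1) unfolding islimpt_approachable by (metis min_less_iff_conj)
      obtain s' t' where [simp]: "z' = (s', t')" by force
      have eq: "\<gamma> s' = \<gamma> t'" using z'(1) by (auto simp: Z_def)
      have d: "norm (s' - s) < d1" "norm (t' - t) < d2"
        using z'(3) dist_fst_le[of z' z] dist_snd_le[of z' z] by (auto simp: z dist_norm)
      have "(s' - s) *\<^sub>R v - (t' - t) *\<^sub>R w =
          (\<gamma> t' - \<gamma> t - (t' - t) *\<^sub>R w) - (\<gamma> s' - \<gamma> s - (s' - s) *\<^sub>R v)"
        using eq st by simp
      also have "norm \<dots> \<le> c/2 * norm (t' - t) + c/2 * norm (s' - s)"
        by (rule order_trans[OF norm_triangle_ineq4 add_mono[OF d2(2)[OF d(2)] d1(2)[OF d(1)]]])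
      finally have "c * (\<bar>s' - s\<bar> + \<bar>t' - t\<bar>) \<le> c/2 * (\<bar>s' - s\<bar> + \<bar>t' - t\<bar>)"
        using c(2)[of "s' - s" "t' - t"] by (simp add: algebra_simps)
      then have "c * (\<bar>s' - s\<bar> + \<bar>t' - t\<bar>) \<le> 0" by simp
      then have "\<bar>s' - s\<bar> + \<bar>t' - t\<bar> \<le> 0" using c(1) by (simp only: mult_le_0_iff) auto
      then show False using z'(2) z by auto
    qed
  qed
  then have "countable (fst ` Z)" by simp
  then show ?thesis by (rule countable_subset[rotated]) (force simp: Z_def image_def)
qed

text \<open>A null set has an open neighbourhood of small measure. A disjoint family of balls in it, enlarged five
  times, covers the null set, which gives a cover suited to Hausdorff measure.\<close>

lemma negligible_small_ball_cover:
  fixes N :: "real set"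
  assumes N: "negligible N" and "0 < \<delta>" "0 < \<eta>"
  shows "\<exists>(C :: (real \<times> real) set). countable C \<and> (\<forall>(a, r)\<in>C. 0 < r \<and> r \<le> \<delta>) \<and>
    N \<subseteq> (\<Union>(a, r)\<in>C. cball a r) \<and> (\<integral>\<^sup>+i. ennreal (snd i) \<partial>count_space C) \<le> ennreal \<eta>"
proof -
  have "N \<in> sets lebesgue" using N by (simp add: negligible_imp_sets)
  then obtain U where U: "open U" "N \<subseteq> U" "U - N \<in> lmeasurable" "emeasure lebesgue (U - N) < ennreal (\<eta>/5)"
    using sets_lebesgue_outer_open[of N "\<eta>/5"] \<open>0 < \<eta>\<close> by auto
  have sU: "U \<in> sets lebesgue" using U(1) by auto
  have "emeasure lebesgue U \<le> emeasure lebesgue (U - N) + emeasure lebesgue N"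
    using emeasure_subadditive[of "U - N" lebesgue N] U \<open>N \<in> sets lebesgue\<close>
    by (metis Diff_partition fmeasurableD sup_commute)
  also have "emeasure lebesgue N = 0"
    using N by (simp add: negligible_iff_null_sets null_setsD1)
  finally have eU: "emeasure lebesgue U \<le> ennreal (\<eta>/5)" using U(4) by simp
  \<comment> \<open>radii at most \<open>\<delta> / 5\<close>, because the covering lemma enlarges them five times\<close>
  define K where "K = {(a, r). 0 < r \<and> r \<le> \<delta> / 5 \<and> cball a r \<subseteq> U}"
  have NK: "N \<subseteq> (\<Union>i\<in>K. cball (fst i) (snd i))"
  proof
      fix x assume "x \<in> N"
      then obtain d where d: "d > 0" "cball x d \<subseteq> U"
        using U open_contains_cball by (metis subsetD)
      then have "(x, min d (\<delta>/5)) \<in> K" using \<open>0 < \<delta>\<close> by (auto simp: K_def)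
      moreover have "x \<in> cball (fst (x, min d (\<delta>/5))) (snd (x, min d (\<delta>/5)))" using d \<open>0 < \<delta>\<close> by auto
      ultimately show "x \<in> (\<Union>i\<in>K. cball (fst i) (snd i))" by blast
  qed
  have "0 < snd i \<and> snd i \<le> \<delta> / 5" if "i \<in> K" for i using that by (auto simp: K_def)
  then obtain C where C: "countable C" "C \<subseteq> K"
    "pairwise (\<lambda>i j. disjnt (cball (fst i) (snd i)) (cball (fst j) (snd j))) C"
    "N \<subseteq> (\<Union>i\<in>C. cball (fst i) (5 * snd i))"
    using Vitali_covering_lemma_cballs[OF NK, of "\<delta>/5"] by (metis (no_types, lifting))
  have K: "0 < snd i" "snd i \<le> \<delta>/5" "cball (fst i) (snd i) \<subseteq> U" if "i \<in> C" for i
  proof -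
    have "i \<in> K" using that C(2) by blast
    then show "0 < snd i" "snd i \<le> \<delta>/5" "cball (fst i) (snd i) \<subseteq> U"
      unfolding K_def by (cases i, simp del: mem_cball)+
  qed
  have "emeasure lebesgue (\<Union>i\<in>C. cball (fst i) (snd i)) = (\<integral>\<^sup>+i. ennreal (2 * snd i) \<partial>count_space C)"
  proof -
    have "disjoint_family_on (\<lambda>i. cball (fst i) (snd i)) C"
      using C(3) by (auto simp: disjoint_family_on_def pairwise_def disjnt_def)
    moreover have "emeasure lebesgue (cball (fst i) (snd i)) = ennreal (2 * snd i)" if "i \<in> C" for i
      using K(1)[OF that] by (simp add: cball_eq_atLeastAtMost)
    ultimately show ?thesis using C(1)
      by (subst emeasure_UN_countable) (auto intro!: nn_integral_cong)
  qed
  moreover have "emeasure lebesgue (\<Union>i\<in>C. cball (fst i) (snd i)) \<le> emeasure lebesgue U"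
    using K(3) sU by (intro emeasure_mono) blast+
  ultimately have I: "(\<integral>\<^sup>+i. ennreal (2 * snd i) \<partial>count_space C) \<le> ennreal (\<eta>/5)" using eU by simp
  define D where "D = (\<lambda>i. (fst i, 5 * snd i)) ` C"
  have inj: "inj_on (\<lambda>i. (fst i, 5 * snd i :: real)) C" by (auto intro!: inj_onI prod_eqI)
  have "(\<integral>\<^sup>+i. ennreal (snd i) \<partial>count_space D) = (\<integral>\<^sup>+i. ennreal (5 * snd i) \<partial>count_space C)"
    unfolding D_def using nn_integral_bij_count_space[OF inj_on_imp_bij_betw[OF inj], of "\<lambda>i. ennreal (snd i)"] by simp
  also have "\<dots> \<le> (\<integral>\<^sup>+i. 5 * ennreal (2 * snd i) \<partial>count_space C)"
    using K(1) by (intro nn_integral_mono)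
      (auto simp: ennreal_mult''[symmetric] ennreal_numeral[symmetric] ennreal_mult[symmetric] less_imp_le simp del: ennreal_numeral intro!: ennreal_leI)
  also have "\<dots> = 5 * (\<integral>\<^sup>+i. ennreal (2 * snd i) \<partial>count_space C)"
    by (rule nn_integral_cmult) simp
  also have "\<dots> \<le> 5 * ennreal (\<eta>/5)" using I by (intro mult_left_mono) auto
  also have "\<dots> = ennreal \<eta>"
    using \<open>0 < \<eta>\<close> by (simp add: ennreal_numeral[symmetric] ennreal_mult[symmetric] del: ennreal_numeral)
  finally have "(\<integral>\<^sup>+i. ennreal (snd i) \<partial>count_space D) \<le> ennreal \<eta>" .
  moreover have "countable D" using C(1) by (simp add: D_def)
  moreover have "\<forall>(a, r)\<in>D. 0 < r \<and> r \<le> \<delta>" using K by (force simp: D_def)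
  moreover have "N \<subseteq> (\<Union>(a, r)\<in>D. cball a r)" using C(4) by (force simp: D_def)
  ultimately show ?thesis by blast
qed

lemma hausdorff1_lipschitz_image_negligible:
  fixes \<gamma> :: "real \<Rightarrow> 'a::real_normed_vector"
  assumes lip: "\<And>s t. s \<in> I \<Longrightarrow> t \<in> I \<Longrightarrow> dist (\<gamma> s) (\<gamma> t) \<le> \<bar>s - t\<bar>"
    and N: "negligible N" "N \<subseteq> I" and A: "A \<subseteq> \<gamma> ` N"
  shows "hausdorff1 A = 0"
proof -
  have "(INF U\<in>{U :: nat \<Rightarrow> 'a set. A \<subseteq> (\<Union>i. U i) \<and> (\<forall>i. bounded (U i) \<and> diameter (U i) \<le> \<delta>)}.
          (\<Sum>i. ennreal (diameter (U i)))) = 0" (is "?I = 0") if "\<delta> > 0" for \<delta>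
  proof -
    have "?I \<le> ennreal \<eta>" if "\<eta> > 0" for \<eta>
    proof -
      obtain C :: "(real \<times> real) set" where C: "countable C" "\<And>a r. (a, r) \<in> C \<Longrightarrow> 0 < r \<and> r \<le> \<delta>/2"
        "N \<subseteq> (\<Union>(a, r)\<in>C. cball a r)" "(\<integral>\<^sup>+i. ennreal (snd i) \<partial>count_space C) \<le> ennreal (\<eta>/2)"
        using negligible_small_ball_cover[OF N(1), of "\<delta>/2" "\<eta>/2"] \<open>\<delta> > 0\<close> \<open>\<eta> > 0\<close> by auto
      define W where "W i = \<gamma> ` (cball (fst i) (snd i) \<inter> N)" for i
      define f where "f = to_nat_on C"
      have f: "bij_betw f C (f ` C)" "inj_on f C"
        using C(1) inj_on_to_nat_on[OF C(1)] by (auto simp: f_def intro: inj_on_imp_bij_betw)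
      \<comment> \<open>covers are indexed by all natural numbers, so a finite family is padded with empty sets\<close>
      define U where "U n = (if n \<in> f ` C then W (inv_into C f n) else {})" for n
      have W: "norm (x - y) \<le> 2 * snd i" if i: "i \<in> C" "x \<in> W i" "y \<in> W i" for x y i
      proof -
        obtain s t where st: "x = \<gamma> s" "y = \<gamma> t" "s \<in> N" "t \<in> N"
          "\<bar>fst i - s\<bar> \<le> snd i" "\<bar>fst i - t\<bar> \<le> snd i"
          using i by (auto simp: W_def dist_real_def)
        then have "dist (\<gamma> s) (\<gamma> t) \<le> \<bar>s - t\<bar>" using lip N(2) by blast
        then show ?thesis using st by (simp add: dist_norm)
      qed
      have W': "bounded (W i)" "diameter (W i) \<le> 2 * snd i" if i: "i \<in> C" for i
      proof -
        have r: "0 < snd i" using C(2)[of "fst i" "snd i"] i by simp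
        show "diameter (W i) \<le> 2 * snd i" using W[OF i] r by (intro diameter_le) auto
        show "bounded (W i)" using W[OF i] unfolding bounded_two_points by (metis dist_norm)
      qed
      have U1: "A \<subseteq> (\<Union>i. U i)"
      proof
        fix x assume "x \<in> A"
        then obtain t where t: "t \<in> N" "x = \<gamma> t" using A by blast
        then obtain i where i: "i \<in> C" "t \<in> cball (fst i) (snd i)" using C(3) by force
        then have "x \<in> U (f i)" using t f by (auto simp: U_def W_def)
        then show "x \<in> (\<Union>i. U i)" by blast
      qed
      have U2: "bounded (U n) \<and> diameter (U n) \<le> \<delta>" for n
      proof (cases "n \<in> f ` C")
        case True
        then obtain i where i: "i \<in> C" "n = f i" by blast
        then have "U n = W i" using f by (simp add: U_def)
        then show ?thesis using W'[OF i(1)] C(2)[of "fst i" "snd i"] i by simp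
      next
        case False then show ?thesis using \<open>\<delta> > 0\<close> by (simp add: U_def)
      qed
      have "(\<Sum>n. ennreal (diameter (U n))) = (\<integral>\<^sup>+n. ennreal (diameter (U n)) \<partial>count_space UNIV)"
        by (simp add: nn_integral_count_space_nat)
      also have "\<dots> = (\<integral>\<^sup>+n. ennreal (diameter (U n)) * indicator (f ` C) n \<partial>count_space UNIV)"
        by (intro nn_integral_cong) (auto simp: U_def indicator_def)
      also have "\<dots> = (\<integral>\<^sup>+n. ennreal (diameter (U n)) \<partial>count_space (f ` C))"
        by (subst nn_integral_count_space_indicator) auto
      also have "\<dots> = (\<integral>\<^sup>+i. ennreal (diameter (U (f i))) \<partial>count_space C)"
        using nn_integral_bij_count_space[OF f(1), of "\<lambda>n. ennreal (diameter (U n))"] by simp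
      also have "\<dots> \<le> (\<integral>\<^sup>+i. 2 * ennreal (snd i) \<partial>count_space C)"
      proof (intro nn_integral_mono)
        fix i assume "i \<in> space (count_space C)"
        then have i: "i \<in> C" by simp
        then have "U (f i) = W i" using f by (simp add: U_def)
        then have "ennreal (diameter (U (f i))) \<le> ennreal (2 * snd i)" using W'[OF i] by (simp add: ennreal_leI)
        then show "ennreal (diameter (U (f i))) \<le> 2 * ennreal (snd i)"
          using C(2)[of "fst i" "snd i"] i by (simp add: ennreal_mult)
      qed
      also have "\<dots> = 2 * (\<integral>\<^sup>+i. ennreal (snd i) \<partial>count_space C)" by (rule nn_integral_cmult) simp
      also have "\<dots> \<le> 2 * ennreal (\<eta>/2)" using C(4) by (intro mult_left_mono) auto
      also have "\<dots> = ennreal \<eta>"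
        using \<open>0 < \<eta>\<close> by (simp add: ennreal_numeral[symmetric] ennreal_mult[symmetric] del: ennreal_numeral)
      finally have le: "(\<Sum>n. ennreal (diameter (U n))) \<le> ennreal \<eta>" .
      have "U \<in> {U :: nat \<Rightarrow> 'a set. A \<subseteq> (\<Union>i. U i) \<and> (\<forall>i. bounded (U i) \<and> diameter (U i) \<le> \<delta>)}"
        using U1 U2 by blast
      from INF_lower2[of U _ "\<lambda>U. \<Sum>i. ennreal (diameter (U i))", OF this le] show ?thesis .
    qed
    then show "?I = 0" by (metis (no_types, lifting) ennreal_0 ennreal_le_epsilon le_zero_eq add_0 zero_less_iff_neq_zero)
  qed
  then show ?thesis unfolding hausdorff1_def by (simp add: SUP_eq_const)
qed

section \<open>Tangents of a curve at almost every point of a set\<close>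

lemma negligible_tangent_leaves:
  fixes \<gamma> :: "real \<Rightarrow> 'a::real_normed_vector"
  assumes lip: "\<And>s t. s \<in> {0..l} \<Longrightarrow> t \<in> {0..l} \<Longrightarrow> dist (\<gamma> s) (\<gamma> t) \<le> \<bar>s - t\<bar>"
    and e: "0 < e"
  shows "negligible {t \<in> {0<..<l}. \<gamma> t \<in> P \<and> (\<exists>v. (\<gamma> has_vector_derivative v) (at t) \<and>
           \<not> (\<exists>d>0. \<forall>h. \<bar>h\<bar> < d \<longrightarrow> infdist (\<gamma> t + h *\<^sub>R v) P \<le> e * \<bar>h\<bar>))}" (is "negligible ?B")
proof -
  define S where "S = {t \<in> {0..l}. \<gamma> t \<in> P}"
  define N where "N = {t\<in>S. \<forall>d>0. \<exists>h. \<bar>h\<bar> < d \<and> e/4 * \<bar>h\<bar> < infdist (t + h) S}"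
  have "negligible N" unfolding N_def using e by (intro negligible_not_infdist_little_o) auto
  moreover have "?B \<subseteq> N"
  proof
    fix t assume t: "t \<in> ?B"
    then obtain v where v: "(\<gamma> has_vector_derivative v) (at t)"
      and nv: "\<And>d. d > 0 \<Longrightarrow> \<exists>h. \<bar>h\<bar> < d \<and> e * \<bar>h\<bar> < infdist (\<gamma> t + h *\<^sub>R v) P"
      by (auto simp: not_le)
    have tS: "t \<in> S" "0 < t" "t < l" using t by (auto simp: S_def)
    show "t \<in> N"
    proof (rule ccontr)
      assume "t \<notin> N"
      then obtain d where d: "d > 0" "\<And>h. \<bar>h\<bar> < d \<Longrightarrow> infdist (t + h) S \<le> e/4 * \<bar>h\<bar>"
      proof -
        have "\<not> (\<forall>d>0. \<exists>h. \<bar>h\<bar> < d \<and> e/4 * \<bar>h\<bar> < infdist (t + h) S)"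
          using \<open>t \<notin> N\<close> tS unfolding N_def by blast
        with that show thesis by (meson not_less)
      qed
      have "e/4 > 0" using e by simp
      then obtain d' where d': "d' > 0"
        "\<And>y. norm (y - t) < d' \<Longrightarrow> norm (\<gamma> y - \<gamma> t - (y - t) *\<^sub>R v) \<le> e/4 * norm (y - t)"
        using v unfolding has_vector_derivative_def has_derivative_at_alt by blast
      obtain h where h: "\<bar>h\<bar> < min (min d d') (min t (l - t))" "e * \<bar>h\<bar> < infdist (\<gamma> t + h *\<^sub>R v) P"
        using nv[of "min (min d d') (min t (l - t))"] d d' tS by auto
      have h0: "h \<noteq> 0" using h(2) t by auto
      have "infdist (t + h) S \<le> e/4 * \<bar>h\<bar>" using d(2) h(1) by auto
      also have "\<dots> < e/2 * \<bar>h\<bar>" using e h0 by simp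
      finally have "infdist (t + h) S < e/2 * \<bar>h\<bar>" .
      moreover have "S \<noteq> {}" using tS by blast
      ultimately obtain s where s: "s \<in> S" "dist (t + h) s < e/2 * \<bar>h\<bar>"
        unfolding infdist_notempty[OF \<open>S \<noteq> {}\<close>] by (subst (asm) cINF_less_iff) auto
      have "infdist (\<gamma> t + h *\<^sub>R v) P \<le> dist (\<gamma> t + h *\<^sub>R v) (\<gamma> s)"
        using s by (intro infdist_le) (auto simp: S_def)
      also have "\<dots> \<le> dist (\<gamma> t + h *\<^sub>R v) (\<gamma> (t + h)) + dist (\<gamma> (t + h)) (\<gamma> s)"
        by (rule dist_triangle)
      also have "dist (\<gamma> t + h *\<^sub>R v) (\<gamma> (t + h)) = norm (\<gamma> (t + h) - \<gamma> t - h *\<^sub>R v)"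
        by (simp add: dist_norm norm_minus_commute diff_diff_eq)
      also have "\<dots> \<le> e/4 * \<bar>h\<bar>" using d'(2)[of "t + h"] h(1) by simp
      also have "dist (\<gamma> (t + h)) (\<gamma> s) \<le> e/2 * \<bar>h\<bar>"
      proof -
        have "t + h \<in> {0..l}" using h(1) by (auto simp: abs_less_iff)
        moreover have "s \<in> {0..l}" using s by (auto simp: S_def)
        ultimately have "dist (\<gamma> (t + h)) (\<gamma> s) \<le> \<bar>t + h - s\<bar>" by (rule lip)
        then show ?thesis using s(2) by (simp add: dist_real_def)
      qed
      finally have "infdist (\<gamma> t + h *\<^sub>R v) P \<le> e/4 * \<bar>h\<bar> + e/2 * \<bar>h\<bar>" by simp
      also have "\<dots> \<le> e * \<bar>h\<bar>" using e by simp
      finally show False using h(2) by simp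
    qed
  qed
  ultimately show ?thesis by (rule negligible_subset)
qed

lemma countable_transversal_zeros:
  fixes \<gamma> :: "real \<Rightarrow> 'a::real_inner"
  shows "countable {t. \<gamma> t \<bullet> e = 0 \<and> (\<exists>v. (\<gamma> has_vector_derivative v) (at t) \<and> v \<bullet> e \<noteq> 0)}"
    (is "countable ?Z")
proof (rule countable_no_limit_points)
  fix t assume t: "t \<in> ?Z"
  then obtain v where v: "(\<gamma> has_vector_derivative v) (at t)" "v \<bullet> e \<noteq> 0" by blast
  have "((\<lambda>s. \<gamma> s \<bullet> e) has_vector_derivative v \<bullet> e) (at t)"
    using v(1) by (rule bounded_linear.has_vector_derivative[OF bounded_linear_inner_left])
  then have "((\<lambda>s. (\<gamma> s \<bullet> e - \<gamma> t \<bullet> e) / (s - t)) \<longlongrightarrow> v \<bullet> e) (at t)"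
    by (simp add: has_real_derivative_iff_has_vector_derivative[symmetric] has_field_derivative_iff)
  then have "\<forall>\<^sub>F s in at t. (\<gamma> s \<bullet> e - \<gamma> t \<bullet> e) / (s - t) \<noteq> 0"
    using v(2) by (rule tendsto_imp_eventually_ne)
  then have "\<forall>\<^sub>F s in at t. s \<notin> ?Z"
    using t by (auto elim!: eventually_mono)
  then show "\<not> t islimpt ?Z"
    by (simp add: islimpt_iff_eventually)
qed

text \<open>Only countably many \<open>e \<in> B\<close> are not orthogonal to the whole curve, since by continuity these are
  detected at rational times; each of them contributes a countable set of times.\<close>

lemma negligible_tangent_leaves_support:
  fixes \<gamma> :: "real \<Rightarrow> 'a::real_inner"
  assumes lip: "\<And>s t. s \<in> {0..l} \<Longrightarrow> t \<in> {0..l} \<Longrightarrow> dist (\<gamma> s) (\<gamma> t) \<le> \<bar>s - t\<bar>"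
    and B: "\<And>p. countable {e \<in> B. p \<bullet> e \<noteq> 0}"
  shows "negligible {t \<in> {0<..<l}. \<exists>e\<in>B. \<gamma> t \<bullet> e = 0 \<and> (\<exists>v. (\<gamma> has_vector_derivative v) (at t) \<and> v \<bullet> e \<noteq> 0)}"
    (is "negligible ?Z")
proof -
  define B' where "B' = (\<Union>q\<in>\<rat> \<inter> {0..l}. {e \<in> B. \<gamma> q \<bullet> e \<noteq> 0})"
  have "countable B'" unfolding B'_def using B countable_rat by (intro countable_UN countable_Int1)
  define Y where "Y = (\<Union>e\<in>B'. {t. \<gamma> t \<bullet> e = 0 \<and> (\<exists>v. (\<gamma> has_vector_derivative v) (at t) \<and> v \<bullet> e \<noteq> 0)})"
  have "countable Y" unfolding Y_def using \<open>countable B'\<close> countable_transversal_zeros by (rule countable_UN)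
  then have "negligible Y" by (rule countable_imp_negligible)
  moreover have "?Z \<subseteq> Y"
  proof
    fix t assume "t \<in> ?Z"
    then obtain e v where t: "0 < t" "t < l" and e: "e \<in> B" "\<gamma> t \<bullet> e = 0"
      and v: "(\<gamma> has_vector_derivative v) (at t)" "v \<bullet> e \<noteq> 0" by auto
    have "e \<in> B'"
    proof (rule ccontr)
      assume "e \<notin> B'"
      then have q0: "\<gamma> q \<bullet> e = 0" if "q \<in> \<rat>" "0 \<le> q" "q \<le> l" for q
        using that e by (auto simp: B'_def)
      have "((\<lambda>s. \<gamma> s \<bullet> e) has_vector_derivative v \<bullet> e) (at t)"
        using v(1) by (rule bounded_linear.has_vector_derivative[OF bounded_linear_inner_left])
      then have "((\<lambda>s. (\<gamma> s \<bullet> e - \<gamma> t \<bullet> e) / (s - t)) \<longlongrightarrow> v \<bullet> e) (at t)"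
        by (simp add: has_real_derivative_iff_has_vector_derivative[symmetric] has_field_derivative_iff)
      then have "\<forall>\<^sub>F s in at t. (\<gamma> s \<bullet> e - \<gamma> t \<bullet> e) / (s - t) \<noteq> 0"
        using v(2) by (rule tendsto_imp_eventually_ne)
      then have "\<forall>\<^sub>F s in at t. \<gamma> s \<bullet> e \<noteq> 0"
        using e by (auto elim!: eventually_mono)
      then obtain d where d: "d > 0" "\<And>s. s \<noteq> t \<Longrightarrow> dist s t < d \<Longrightarrow> \<gamma> s \<bullet> e \<noteq> 0"
        unfolding eventually_at by auto
      obtain q where "q \<in> \<rat>" "max 0 (t - d) < q" "q < t"
        using Rats_dense_in_real[of "max 0 (t - d)" t] t d by auto
      then show False using d(2)[of q] q0[of q] t by (auto simp: dist_real_def)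
    qed
    then show "t \<in> Y" using e v by (auto simp: Y_def)
  qed
  ultimately show ?thesis by (rule negligible_subset)
qed

section \<open>Piecewise locally constant maps\<close>

text \<open>Replaces Borel maps with countably many values on a nonseparable space, where the values vary
  over an uncountable set. Such a map is Borel into the discrete topology on its values, and local
  constancy makes the property pass to pairs.\<close>

definition piecewise_locally_constant :: "'a::topological_space set \<Rightarrow> ('a \<Rightarrow> 'b) \<Rightarrow> bool" where
  "piecewise_locally_constant D f \<longleftrightarrow> (\<exists>A :: nat \<Rightarrow> 'a set. (\<forall>i. A i \<in> sets borel) \<and> D \<subseteq> (\<Union>i. A i) \<and>
     (\<forall>i. \<forall>x\<in>D \<inter> A i. \<exists>U. open U \<and> x \<in> U \<and> (\<forall>y\<in>U \<inter> D \<inter> A i. f y = f x)))"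

lemma piecewise_locally_constant_const: "piecewise_locally_constant D (\<lambda>_. c)"
  unfolding piecewise_locally_constant_def by (intro exI[of _ "\<lambda>_. UNIV"]) (auto intro: exI[of _ UNIV])

lemma piecewise_locally_constant_comp: "piecewise_locally_constant D f \<Longrightarrow> piecewise_locally_constant D (\<lambda>x. h (f x))"
  unfolding piecewise_locally_constant_def by metis

lemma piecewise_locally_constant_subset: "piecewise_locally_constant D f \<Longrightarrow> D' \<subseteq> D \<Longrightarrow> piecewise_locally_constant D' f"
proof -
  assume "piecewise_locally_constant D f" and D': "D' \<subseteq> D"
  then obtain A where A: "\<And>i. A i \<in> sets borel" "D \<subseteq> (\<Union>i::nat. A i)"
    "\<And>i x. x \<in> D \<inter> A i \<Longrightarrow> \<exists>U. open U \<and> x \<in> U \<and> (\<forall>y\<in>U \<inter> D \<inter> A i. f y = f x)"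
    unfolding piecewise_locally_constant_def by metis
  have "\<exists>U. open U \<and> x \<in> U \<and> (\<forall>y\<in>U \<inter> D' \<inter> A i. f y = f x)" if "x \<in> D' \<inter> A i" for i x
  proof -
    have "x \<in> D \<inter> A i" using that D' by blast
    from A(3)[OF this] obtain U where "open U" "x \<in> U" "\<forall>y\<in>U \<inter> D \<inter> A i. f y = f x" by blast
    then show ?thesis using D' by (intro exI[of _ U]) auto
  qed
  then show "piecewise_locally_constant D' f" unfolding piecewise_locally_constant_def using A(1,2) D' by (intro exI[of _ A]) auto
qed

lemma piecewise_locally_constant_cong: "piecewise_locally_constant D f \<Longrightarrow> (\<And>x. x \<in> D \<Longrightarrow> f x = g x) \<Longrightarrow> piecewise_locally_constant D g"
  unfolding piecewise_locally_constant_def by (elim exE, rename_tac A, rule_tac x = A in exI) (metis IntE)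

lemma piecewise_locally_constant_countable_pieces:
  assumes E: "\<And>n::nat. E n \<in> sets borel" "D \<subseteq> (\<Union>n. E n)" and f: "\<And>n. piecewise_locally_constant (D \<inter> E n) f"
  shows "piecewise_locally_constant D f"
proof -
  obtain A where A: "\<And>n i. A n i \<in> sets borel" "\<And>n. D \<inter> E n \<subseteq> (\<Union>i::nat. A n i)"
    "\<And>n i x. x \<in> D \<inter> E n \<inter> A n i \<Longrightarrow> \<exists>U. open U \<and> x \<in> U \<and> (\<forall>y\<in>U \<inter> (D \<inter> E n) \<inter> A n i. f y = f x)"
    using f unfolding piecewise_locally_constant_def by metis
  define A' where "A' k = (case prod_decode k of (n, i) \<Rightarrow> E n \<inter> A n i)" for k
  show ?thesis unfolding piecewise_locally_constant_def
  proof (intro exI[of _ A'] conjI allI ballI)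
    fix k
    show "A' k \<in> sets borel" using E(1) A(1) by (auto simp: A'_def split: prod.split)
    fix x assume x: "x \<in> D \<inter> A' k"
    obtain n i where k: "prod_decode k = (n, i)" by force
    then have "x \<in> D \<inter> E n \<inter> A n i" using x by (auto simp: A'_def)
    from A(3)[OF this] obtain U where "open U" "x \<in> U" "\<forall>y\<in>U \<inter> (D \<inter> E n) \<inter> A n i. f y = f x" by blast
    then show "\<exists>U. open U \<and> x \<in> U \<and> (\<forall>y\<in>U \<inter> D \<inter> A' k. f y = f x)"
      using k by (intro exI[of _ U]) (auto simp: A'_def)
  next
    show "D \<subseteq> (\<Union>k. A' k)"
    proof
      fix x assume "x \<in> D"
      then obtain n i where "x \<in> E n" "x \<in> A n i" using E(2) A(2) by blast
      then have "x \<in> A' (prod_encode (n, i))" by (simp add: A'_def)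
      then show "x \<in> (\<Union>k. A' k)" by blast
    qed
  qed
qed

lemma piecewise_locally_constant_Pair:
  assumes "piecewise_locally_constant D f" "piecewise_locally_constant D g"
  shows "piecewise_locally_constant D (\<lambda>x. (f x, g x))"
proof -
  obtain A where A: "\<And>i. A i \<in> sets borel" "D \<subseteq> (\<Union>i::nat. A i)"
    "\<And>i x. x \<in> D \<inter> A i \<Longrightarrow> \<exists>U. open U \<and> x \<in> U \<and> (\<forall>y\<in>U \<inter> D \<inter> A i. f y = f x)"
    using assms(1) unfolding piecewise_locally_constant_def by metis
  obtain C where C: "\<And>i. C i \<in> sets borel" "D \<subseteq> (\<Union>i::nat. C i)"
    "\<And>i x. x \<in> D \<inter> C i \<Longrightarrow> \<exists>U. open U \<and> x \<in> U \<and> (\<forall>y\<in>U \<inter> D \<inter> C i. g y = g x)"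
    using assms(2) unfolding piecewise_locally_constant_def by metis
  define A' where "A' k = (case prod_decode k of (n, i) \<Rightarrow> A n \<inter> C i)" for k
  show ?thesis unfolding piecewise_locally_constant_def
  proof (intro exI[of _ A'] conjI allI ballI)
    fix k
    show "A' k \<in> sets borel" using A(1) C(1) by (auto simp: A'_def split: prod.split)
    fix x assume x: "x \<in> D \<inter> A' k"
    obtain n i where k: "prod_decode k = (n, i)" by force
    then have x': "x \<in> D \<inter> A n" "x \<in> D \<inter> C i" using x by (auto simp: A'_def)
    obtain U where U: "open U" "x \<in> U" "\<forall>y\<in>U \<inter> D \<inter> A n. f y = f x" using A(3)[OF x'(1)] by blast
    obtain V where V: "open V" "x \<in> V" "\<forall>y\<in>V \<inter> D \<inter> C i. g y = g x" using C(3)[OF x'(2)] by blast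
    show "\<exists>U. open U \<and> x \<in> U \<and> (\<forall>y\<in>U \<inter> D \<inter> A' k. (f y, g y) = (f x, g x))"
      using k U V by (intro exI[of _ "U \<inter> V"]) (auto simp: A'_def)
  next
    show "D \<subseteq> (\<Union>k. A' k)"
    proof
      fix x assume "x \<in> D"
      then obtain n i where "x \<in> A n" "x \<in> C i" using A(2) C(2) by blast
      then have "x \<in> A' (prod_encode (n, i))" by (simp add: A'_def)
      then show "x \<in> (\<Union>k. A' k)" by blast
    qed
  qed
qed

lemma piecewise_locally_constant_map: "(\<And>k. piecewise_locally_constant D (u k)) \<Longrightarrow> piecewise_locally_constant D (\<lambda>x. map (\<lambda>k. u k x) ks)"
proof (induction ks)
  case Nil
  show ?case by (simp add: piecewise_locally_constant_const)
next
  case (Cons k ks)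
  then have "piecewise_locally_constant D (\<lambda>x. (u k x, map (\<lambda>k. u k x) ks))" by (intro piecewise_locally_constant_Pair) auto
  from piecewise_locally_constant_comp[OF this, of "\<lambda>(a, b). a # b"] show ?case by simp
qed

text \<open>Local constancy makes the complement of \<open>{x. x \<in> C (f x)}\<close> relatively open in each piece. With closed
  fibres the union over uncountably many values of \<open>f\<close> thus stays Borel.\<close>

lemma piecewise_locally_constant_closed_fibres:
  assumes f: "piecewise_locally_constant D f" and D: "D \<in> sets borel" and C: "\<And>s. closed (C s)"
  shows "{x \<in> D. x \<in> C (f x)} \<in> sets borel"
proof -
  obtain A where A: "\<And>i. A i \<in> sets borel" "D \<subseteq> (\<Union>i::nat. A i)"
    "\<And>i x. x \<in> D \<inter> A i \<Longrightarrow> \<exists>U. open U \<and> x \<in> U \<and> (\<forall>y\<in>U \<inter> D \<inter> A i. f y = f x)"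
    using f unfolding piecewise_locally_constant_def by metis
  \<comment> \<open>the largest open set that meets the \<open>i\<close>-th piece only in points outside the fibre\<close>
  define Q where "Q i = \<Union>{U. open U \<and> (\<forall>y\<in>U \<inter> D \<inter> A i. y \<notin> C (f y))}" for i
  have Q: "open (Q i)" for i unfolding Q_def by auto
  have "{x \<in> D. x \<in> C (f x)} = (\<Union>i. D \<inter> A i - Q i)"
  proof (intro equalityI subsetI)
    fix x assume x: "x \<in> {x \<in> D. x \<in> C (f x)}"
    then obtain i where i: "x \<in> D \<inter> A i" using A(2) by blast
    then have "x \<notin> Q i" using x unfolding Q_def by blast
    then show "x \<in> (\<Union>i. D \<inter> A i - Q i)" using i by blast
  next
    fix x assume "x \<in> (\<Union>i. D \<inter> A i - Q i)"
    then obtain i where i: "x \<in> D \<inter> A i" "x \<notin> Q i" by blast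
    obtain U where U: "open U" "x \<in> U" "\<forall>y\<in>U \<inter> D \<inter> A i. f y = f x" using A(3)[OF i(1)] by blast
    have "x \<in> C (f x)"
    proof (rule ccontr)
      assume n: "x \<notin> C (f x)"
      have "open (U - C (f x))" using U(1) C by (rule open_Diff)
      moreover have "\<forall>y\<in>(U - C (f x)) \<inter> D \<inter> A i. y \<notin> C (f y)" using U(3) by auto
      ultimately have "U - C (f x) \<subseteq> Q i" unfolding Q_def by blast
      then show False using n U(2) i(2) by blast
    qed
    then show "x \<in> {x \<in> D. x \<in> C (f x)}" using i by blast
  qed
  also have "\<dots> \<in> sets borel"
    using D A(1) Q by (intro sets.countable_UN' sets.Diff sets.Int) auto
  finally show ?thesis .
qed

lemma piecewise_locally_constant_vimage_borel:
  assumes "piecewise_locally_constant D f" "D \<in> sets borel"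
  shows "{x \<in> D. f x \<in> S} \<in> sets borel"
proof -
  have "closed (if s \<in> S then UNIV else {})" for s by simp
  from piecewise_locally_constant_closed_fibres[OF assms, of "\<lambda>s. if s \<in> S then UNIV else {}", OF this]
  have "{x \<in> D. x \<in> (if f x \<in> S then UNIV else {})} \<in> sets borel" .
  moreover have "{x \<in> D. x \<in> (if f x \<in> S then UNIV else {})} = {x \<in> D. f x \<in> S}" by auto
  ultimately show ?thesis by simp
qed

lemma piecewise_locally_constant_measurable:
  assumes "piecewise_locally_constant D f" "D \<in> sets borel"
  shows "f \<in> measurable (restrict_space borel D) (count_space UNIV)"
proof (rule measurableI)
  fix S
  have "f -` S \<inter> space (restrict_space borel D) = {x \<in> D. f x \<in> S}"
    by (auto simp: space_restrict_space)
  also have "\<dots> \<in> sets (restrict_space borel D)"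
    using piecewise_locally_constant_vimage_borel[OF assms, of S] assms(2) by (subst sets_restrict_space_iff) auto
  finally show "f -` S \<inter> space (restrict_space borel D) \<in> sets (restrict_space borel D)" .
qed simp

text \<open>Allows choices such as the first index with a given property.\<close>

lemma piecewise_locally_constant_select:
  assumes D: "D \<in> sets borel" and N: "N \<in> measurable (restrict_space borel D) (count_space UNIV)"
    and f: "\<And>n::nat. piecewise_locally_constant D (f n)"
  shows "piecewise_locally_constant D (\<lambda>x. f (N x) x)"
proof (rule piecewise_locally_constant_countable_pieces)
  let ?E = "\<lambda>n. {x \<in> D. N x = n}"
  show "?E n \<in> sets borel" for n
  proof -
    have "N -` {n} \<inter> space (restrict_space borel D) \<in> sets (restrict_space borel D)"
      using N by (rule measurable_sets) simp
    moreover have "N -` {n} \<inter> space (restrict_space borel D) = ?E n"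
      by (auto simp: space_restrict_space)
    ultimately show ?thesis using D by (simp add: sets_restrict_space_iff)
  qed
  show "D \<subseteq> (\<Union>n. ?E n)" by blast
  show "piecewise_locally_constant (D \<inter> ?E n) (\<lambda>x. f (N x) x)" for n
    using piecewise_locally_constant_subset[OF f[of n], of "D \<inter> ?E n"] by (rule piecewise_locally_constant_cong) auto
qed

text \<open>On each piece the composition with \<open>\<gamma>\<close> is locally constant on a subset of the line, where countably
  many neighbourhoods suffice. A single curve thus meets only countably many values, and null sets may be
  discarded one value at a time.\<close>

lemma piecewise_locally_constant_countable_image_curve:
  fixes \<gamma> :: "real \<Rightarrow> 'a::topological_space"
  assumes f: "piecewise_locally_constant D f" and \<gamma>: "continuous_on S \<gamma>" "\<gamma> ` S \<subseteq> D"
  shows "countable (f ` \<gamma> ` S)"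
proof -
  obtain A where A: "\<And>i. A i \<in> sets borel" "D \<subseteq> (\<Union>i::nat. A i)"
    "\<And>i x. x \<in> D \<inter> A i \<Longrightarrow> \<exists>U. open U \<and> x \<in> U \<and> (\<forall>y\<in>U \<inter> D \<inter> A i. f y = f x)"
    using f unfolding piecewise_locally_constant_def by metis
  have "countable (f ` \<gamma> ` (S \<inter> \<gamma> -` A i))" for i
  proof -
    define T where "T = S \<inter> \<gamma> -` A i"
    have "\<forall>t\<in>T. \<exists>V. open V \<and> t \<in> V \<and> (\<forall>s\<in>V \<inter> T. f (\<gamma> s) = f (\<gamma> t))"
    proof
      fix t assume t: "t \<in> T"
      then have "\<gamma> t \<in> D \<inter> A i" using \<gamma>(2) by (auto simp: T_def)
      from A(3)[OF this] obtain U where U: "open U" "\<gamma> t \<in> U" "\<forall>y\<in>U \<inter> D \<inter> A i. f y = f (\<gamma> t)" by blast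
      obtain V where V: "open V" "V \<inter> S = \<gamma> -` U \<inter> S"
        using \<gamma>(1) U(1) unfolding continuous_on_open_invariant by metis
      then have "t \<in> V" using t U(2) by (auto simp: T_def)
      moreover have "\<forall>s\<in>V \<inter> T. f (\<gamma> s) = f (\<gamma> t)"
      proof
        fix s assume s: "s \<in> V \<inter> T"
        then have "\<gamma> s \<in> U" using V(2) by (auto simp: T_def)
        then have "\<gamma> s \<in> U \<inter> D \<inter> A i" using s \<gamma>(2) by (auto simp: T_def)
        then show "f (\<gamma> s) = f (\<gamma> t)" using U(3) by blast
      qed
      ultimately show "\<exists>V. open V \<and> t \<in> V \<and> (\<forall>s\<in>V \<inter> T. f (\<gamma> s) = f (\<gamma> t))" using V(1) by blast
    qed
    then obtain V where V: "\<And>t. t \<in> T \<Longrightarrow> open (V t) \<and> t \<in> V t \<and> (\<forall>s\<in>V t \<inter> T. f (\<gamma> s) = f (\<gamma> t))"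
      by metis
    obtain F where F: "F \<subseteq> V ` T" "countable F" "\<Union>F = \<Union>(V ` T)"
      using Lindelof[of "V ` T"] V by blast
    obtain T' where T': "T' \<subseteq> T" "countable T'" "F = V ` T'"
      using F(1,2) by (metis countable_subset_image)
    have "f ` \<gamma> ` T \<subseteq> f ` \<gamma> ` T'"
    proof
      fix y assume "y \<in> f ` \<gamma> ` T"
      then obtain s where s: "s \<in> T" "y = f (\<gamma> s)" by blast
      have "s \<in> \<Union>(V ` T)" using V s(1) by blast
      then obtain t where t: "t \<in> T'" "s \<in> V t" unfolding F(3)[symmetric] T'(3) by blast
      then have "f (\<gamma> s) = f (\<gamma> t)" using V[of t] T'(1) s(1) by blast
      then show "y \<in> f ` \<gamma> ` T'" using s(2) t(1) by blast
    qed
    then show ?thesis using T'(2) unfolding T_def by (meson countable_image countable_subset)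
  qed
  then have "countable (\<Union>i. f ` \<gamma> ` (S \<inter> \<gamma> -` A i))" by (intro countable_UN) auto
  moreover have "f ` \<gamma> ` S \<subseteq> (\<Union>i. f ` \<gamma> ` (S \<inter> \<gamma> -` A i))"
  proof
    fix y assume "y \<in> f ` \<gamma> ` S"
    then obtain s where s: "s \<in> S" "y = f (\<gamma> s)" by blast
    then obtain i where "\<gamma> s \<in> A i" using \<gamma>(2) A(2) by blast
    then show "y \<in> (\<Union>i. f ` \<gamma> ` (S \<inter> \<gamma> -` A i))" using s by blast
  qed
  ultimately show ?thesis by (rule countable_subset[rotated])
qed

section \<open>Direction fields from an orthonormal basis\<close>

definition orthonormal :: "'a::real_inner set \<Rightarrow> bool" where
  "orthonormal B \<longleftrightarrow> (\<forall>e\<in>B. norm e = 1) \<and> (\<forall>e\<in>B. \<forall>f\<in>B. e \<noteq> f \<longrightarrow> e \<bullet> f = 0)"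

text \<open>These finite sets exhaust the support of \<open>p\<close>; a single one of them is a discrete datum that
  varies with \<open>p\<close> in a controlled way.\<close>

definition large_coords :: "'a::real_inner set \<Rightarrow> nat \<Rightarrow> 'a \<Rightarrow> 'a set" where
  "large_coords B n p = {e \<in> B. 1 / (real n + 1) < \<bar>p \<bullet> e\<bar>}"

text \<open>A maximal orthonormal set, since a nonzero vector orthogonal to it could be normalized and added.\<close>

lemma ex_total_orthonormal:
  "\<exists>B :: 'a::real_inner set. orthonormal B \<and> (\<forall>x. (\<forall>e\<in>B. x \<bullet> e = 0) \<longrightarrow> x = 0)"
proof -
  have "\<exists>M\<in>{B :: 'a set. orthonormal B}. \<forall>X\<in>{B. orthonormal B}. M \<subseteq> X \<longrightarrow> X = M"
  proof (rule subset_Zorn')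
    fix \<C> :: "'a set set" assume ch: "subset.chain {B. orthonormal B} \<C>"
    have "orthonormal (\<Union>\<C>)" unfolding orthonormal_def
    proof (intro conjI ballI impI)
      fix e assume "e \<in> \<Union>\<C>"
      then show "norm e = 1" using ch by (auto simp: subset_chain_def orthonormal_def)
    next
      fix e f assume "e \<in> \<Union>\<C>" "f \<in> \<Union>\<C>" "e \<noteq> f"
      then obtain X Y where XY: "X \<in> \<C>" "Y \<in> \<C>" "e \<in> X" "f \<in> Y" by blast
      then have "X \<subseteq> Y \<or> Y \<subseteq> X" using ch unfolding subset_chain_def by blast
      then obtain Z where "Z \<in> \<C>" "e \<in> Z" "f \<in> Z" using XY by blast
      moreover then have "orthonormal Z" using ch by (auto simp: subset_chain_def)
      ultimately show "e \<bullet> f = 0" using \<open>e \<noteq> f\<close> by (auto simp: orthonormal_def)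
    qed
    then show "\<Union>\<C> \<in> {B. orthonormal B}" by simp
  qed
  then obtain B :: "'a set" where B: "orthonormal B" "\<And>X. orthonormal X \<Longrightarrow> B \<subseteq> X \<Longrightarrow> X = B"
    by auto
  have "x = 0" if x: "\<forall>e\<in>B. x \<bullet> e = 0" for x
  proof (rule ccontr)
    assume "x \<noteq> 0"
    then have n: "norm (sgn x) = 1" by (simp add: norm_sgn)
    have s: "sgn x \<bullet> e = 0" "e \<bullet> sgn x = 0" if "e \<in> B" for e
      using x that by (simp_all add: sgn_div_norm inner_commute)
    have "orthonormal (insert (sgn x) B)"
      using B(1) n s unfolding orthonormal_def by auto
    then have "sgn x \<in> B" using B(2) by blast
    then have "sgn x \<bullet> sgn x = 0" by (rule s)
    then show False using n by simp
  qed
  with B(1) show ?thesis by blast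
qed

lemma inner_orthonormal_sum:
  assumes "orthonormal B" "finite F" "F \<subseteq> B" "f \<in> B"
  shows "(\<Sum>e\<in>F. c e *\<^sub>R e) \<bullet> f = (if f \<in> F then c f else 0)"
proof -
  have "(\<Sum>e\<in>F. c e *\<^sub>R e) \<bullet> f = (\<Sum>e\<in>F. c e * (e \<bullet> f))" by (simp add: inner_sum_left)
  also have "\<dots> = (\<Sum>e\<in>F. if e = f then c f else 0)"
  proof (rule sum.cong)
    fix e assume "e \<in> F"
    then have "e \<in> B" using assms by blast
    then show "c e * (e \<bullet> f) = (if e = f then c f else 0)"
      using assms by (auto simp: orthonormal_def dot_square_norm)
  qed simp
  finally show ?thesis using assms(2) by simp
qed

lemma norm_orthonormal_sum:
  assumes "orthonormal B" "finite F" "F \<subseteq> B"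
  shows "(norm (\<Sum>e\<in>F. c e *\<^sub>R e))\<^sup>2 = (\<Sum>e\<in>F. (c e)\<^sup>2)"
proof -
  have "(norm (\<Sum>e\<in>F. c e *\<^sub>R e))\<^sup>2 = (\<Sum>f\<in>F. c f * ((\<Sum>e\<in>F. c e *\<^sub>R e) \<bullet> f))"
    unfolding power2_norm_eq_inner by (simp only: inner_sum_right inner_scaleR_right)
  also have "\<dots> = (\<Sum>f\<in>F. (c f)\<^sup>2)"
    using assms by (intro sum.cong) (auto simp: inner_orthonormal_sum subset_iff power2_eq_square)
  finally show ?thesis .
qed

lemma bessel_inequality:
  assumes "orthonormal B" "finite F" "F \<subseteq> B"
  shows "(\<Sum>e\<in>F. (p \<bullet> e)\<^sup>2) \<le> (norm p)\<^sup>2"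
proof -
  let ?y = "\<Sum>e\<in>F. (p \<bullet> e) *\<^sub>R e"
  have 1: "p \<bullet> ?y = (\<Sum>e\<in>F. (p \<bullet> e)\<^sup>2)" by (simp add: inner_sum_right power2_eq_square)
  have 2: "?y \<bullet> ?y = (\<Sum>e\<in>F. (p \<bullet> e)\<^sup>2)" using norm_orthonormal_sum[OF assms, of "\<lambda>e. p \<bullet> e"] by (simp add: power2_norm_eq_inner)
  have "0 \<le> (p - ?y) \<bullet> (p - ?y)" by simp
  also have "\<dots> = p \<bullet> p - 2 * (p \<bullet> ?y) + ?y \<bullet> ?y"
    by (simp only: inner_diff_left inner_diff_right inner_commute[of ?y p])
  also have "\<dots> = p \<bullet> p - (\<Sum>e\<in>F. (p \<bullet> e)\<^sup>2)" using 1 2 by linarith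
  finally show ?thesis by (simp add: power2_norm_eq_inner)
qed

lemma finite_large_coords:
  assumes "orthonormal B"
  shows "finite (large_coords B n p)"
proof (rule ccontr)
  let ?q = "1 / (real n + 1)"
  assume inf: "infinite (large_coords B n p)"
  obtain m where m: "(norm p)\<^sup>2 / ?q\<^sup>2 < real m" using reals_Archimedean2 by blast
  obtain F where F: "F \<subseteq> large_coords B n p" "finite F" "card F = m"
    using infinite_arbitrarily_large[OF inf] by blast
  have "real m * ?q\<^sup>2 = (\<Sum>e\<in>F. ?q\<^sup>2)" using F by simp
  also have "\<dots> \<le> (\<Sum>e\<in>F. (p \<bullet> e)\<^sup>2)"
  proof (rule sum_mono)
    fix e assume "e \<in> F"
    then have "?q < \<bar>p \<bullet> e\<bar>" using F(1) by (auto simp: large_coords_def)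
    then have "\<bar>?q\<bar> \<le> \<bar>p \<bullet> e\<bar>" by simp
    then show "?q\<^sup>2 \<le> (p \<bullet> e)\<^sup>2" by (simp only: abs_le_square_iff)
  qed
  also have "\<dots> \<le> (norm p)\<^sup>2"
    using F by (intro bessel_inequality[OF assms]) (auto simp: large_coords_def)
  finally show False using m by (simp add: field_simps)
qed

lemma large_coords_mono: "m \<le> n \<Longrightarrow> large_coords B m p \<subseteq> large_coords B n p"
proof -
  assume "m \<le> n"
  then have "1 / (real n + 1) \<le> 1 / (real m + 1)" by (simp add: frac_le)
  then show ?thesis by (auto simp: large_coords_def)
qed

lemma Union_large_coords: "(\<Union>n. large_coords B n p) = {e \<in> B. p \<bullet> e \<noteq> 0}"
proof -
  have "\<exists>n. 1 / (real n + 1) < \<bar>x\<bar>" if "x \<noteq> 0" for x :: real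
    using reals_Archimedean[of "\<bar>x\<bar>"] that by (auto simp: inverse_eq_divide add.commute)
  then have "(\<exists>n. 1 / (real n + 1) < \<bar>x\<bar>) \<longleftrightarrow> x \<noteq> 0" for x :: real
    by (metis abs_zero divide_nonneg_nonneg not_less of_nat_0_le_iff add_nonneg_nonneg zero_le_one)
  then show ?thesis by (auto simp: large_coords_def)
qed

lemma countable_support:
  "orthonormal B \<Longrightarrow> countable {e \<in> B. p \<bullet> e \<noteq> 0}"
  unfolding Union_large_coords[symmetric] by (simp add: countable_finite finite_large_coords)

text \<open>By Bessel's inequality the partial sums are Cauchy, and the difference between their limit
  and \<open>w\<close> is orthogonal to \<open>B\<close>.\<close>

lemma fourier_sum_tendsto:
  fixes w :: "'a::{real_inner, complete_space}"
  assumes B: "orthonormal B" and tot: "\<And>x. (\<And>e. e \<in> B \<Longrightarrow> x \<bullet> e = 0) \<Longrightarrow> x = 0"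
  shows "(\<lambda>n. \<Sum>e\<in>large_coords B n w. (w \<bullet> e) *\<^sub>R e) \<longlonglongrightarrow> w"
proof -
  let ?F = "\<lambda>n. large_coords B n w"
  define y where "y n = (\<Sum>e\<in>?F n. (w \<bullet> e) *\<^sub>R e)" for n
  define a where "a n = (\<Sum>e\<in>?F n. (w \<bullet> e)\<^sup>2)" for n
  have fin: "finite (?F n)" "?F n \<subseteq> B" for n
    using finite_large_coords[OF B] by (auto simp: large_coords_def)
  have yy: "(norm (y n - y m))\<^sup>2 = a n - a m" if "m \<le> n" for m n
  proof -
    have sub: "?F m \<subseteq> ?F n" using that by (rule large_coords_mono)
    have "y n - y m = (\<Sum>e\<in>?F n - ?F m. (w \<bullet> e) *\<^sub>R e)" "a n - a m = (\<Sum>e\<in>?F n - ?F m. (w \<bullet> e)\<^sup>2)"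
      unfolding y_def a_def by (simp_all add: sum_diff[OF fin(1) sub])
    then show ?thesis using norm_orthonormal_sum[OF B, of "?F n - ?F m" "\<lambda>e. w \<bullet> e"] fin by auto
  qed
  have "incseq a"
  proof (rule incseq_SucI)
    fix n
    show "a n \<le> a (Suc n)" using yy[of n "Suc n"] by (metis diff_ge_0_iff_ge le_SucI order_refl zero_le_power2)
  qed
  moreover have "a n \<le> (norm w)\<^sup>2" for n
    unfolding a_def using bessel_inequality[OF B fin] .
  ultimately have "convergent a" by (metis incseq_convergent convergent_def)
  then have ca: "Cauchy a" by (rule convergent_Cauchy)
  have "Cauchy y"
  proof (rule metric_CauchyI)
    fix r :: real assume "r > 0"
    then have "r\<^sup>2 > 0" by simp
    then obtain M where M: "\<And>m n. m \<ge> M \<Longrightarrow> n \<ge> M \<Longrightarrow> dist (a m) (a n) < r\<^sup>2"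
      using ca by (meson metric_CauchyD)
    have "dist (y n) (y m) < r" if "m \<ge> M" "m \<le> n" for m n
    proof -
      have "(dist (y n) (y m))\<^sup>2 < r\<^sup>2"
        using M[of n m] that yy[OF that(2)] by (simp add: dist_norm)
      then show ?thesis using \<open>r > 0\<close> by (simp add: power2_less_imp_less)
    qed
    then show "\<exists>M. \<forall>m\<ge>M. \<forall>n\<ge>M. dist (y m) (y n) < r"
      by (metis dist_commute nle_le)
  qed
  then obtain z where z: "y \<longlonglongrightarrow> z" using Cauchy_convergent_iff convergent_def by blast
  have "(w - z) \<bullet> e = 0" if e: "e \<in> B" for e
  proof -
    have "\<forall>\<^sub>F n in sequentially. y n \<bullet> e = w \<bullet> e"
    proof (cases "w \<bullet> e = 0")
      case True
      then show ?thesis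
        unfolding y_def by (intro always_eventually allI) (simp add: inner_orthonormal_sum[OF B fin e] )
    next
      case False
      then obtain m where "e \<in> ?F m" using e Union_large_coords[of B w] by blast
      then have "y n \<bullet> e = w \<bullet> e" if "n \<ge> m" for n
        unfolding y_def using large_coords_mono[OF that] by (auto simp: inner_orthonormal_sum[OF B fin e])
      then show ?thesis by (rule eventually_sequentiallyI)
    qed
    then have "(\<lambda>n. y n \<bullet> e) \<longlonglongrightarrow> w \<bullet> e" by (rule tendsto_eventually)
    moreover have "(\<lambda>n. y n \<bullet> e) \<longlonglongrightarrow> z \<bullet> e" using z by (intro tendsto_intros)
    ultimately show ?thesis using LIMSEQ_unique by (fastforce simp: inner_diff_left)
  qed
  then have "w = z" using tot[of "w - z"] by simp
  then show ?thesis using z unfolding y_def by simp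
qed

lemma ex_dense_seq_span_finite:
  fixes S :: "'a::real_normed_vector set"
  assumes "finite S"
  shows "\<exists>d :: nat \<Rightarrow> 'a. span S \<subseteq> closure (range d)"
proof -
  have "\<exists>D. countable D \<and> span S \<subseteq> closure D"
    using assms
  proof induction
    case empty
    show ?case by (intro exI[of _ "{0}"]) auto
  next
    case (insert b S)
    then obtain D where D: "countable D" "span S \<subseteq> closure D" by blast
    define D' where "D' = (\<lambda>(x, q). x + q *\<^sub>R b) ` (D \<times> \<rat>)"
    have "countable D'" unfolding D'_def using D(1) countable_rat by blast
    moreover have "span (insert b S) \<subseteq> closure D'"
    proof
      fix y assume "y \<in> span (insert b S)"
      then obtain k where k: "y - k *\<^sub>R b \<in> span S" unfolding span_insert by blast
      show "y \<in> closure D'"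
        unfolding closure_approachable
      proof (intro allI impI)
        fix e :: real assume "0 < e"
        then obtain x where x: "x \<in> D" "dist x (y - k *\<^sub>R b) < e / 2"
          using k D(2) closure_approachable by (metis half_gt_zero subsetD)
        have "0 < e / (2 * (norm b + 1))" using \<open>0 < e\<close> by (simp add: add_nonneg_pos)
        then obtain q where q: "q \<in> \<rat>" "k < q" "q < k + e / (2 * (norm b + 1))"
          using Rats_dense_in_real[of k "k + e / (2 * (norm b + 1))"] by auto
        have "norm ((q - k) *\<^sub>R b) \<le> e / (2 * (norm b + 1)) * (norm b + 1)"
          unfolding norm_scaleR using q by (intro mult_mono) auto
        also have "\<dots> = e / 2" by (simp add: field_simps add_nonneg_eq_0_iff)
        finally have qb: "norm ((q - k) *\<^sub>R b) \<le> e / 2" .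
        have "dist (x + q *\<^sub>R b) y = norm ((x - (y - k *\<^sub>R b)) + (q - k) *\<^sub>R b)"
          by (simp add: dist_norm algebra_simps)
        also have "\<dots> < e"
          using norm_triangle_ineq[of "x - (y - k *\<^sub>R b)" "(q - k) *\<^sub>R b"] x(2) qb by (simp add: dist_norm)
        finally show "\<exists>z\<in>D'. dist z y < e"
          using x(1) q(1) by (intro bexI[of _ "x + q *\<^sub>R b"]) (auto simp: D'_def)
      qed
    qed
    ultimately show ?case by blast
  qed
  then obtain D where D: "countable D" "span S \<subseteq> closure D" by blast
  then have "D \<noteq> {}" using span_zero by fastforce
  then show ?thesis using D by (metis range_from_nat_into)
qed

definition dense_seq :: "'a::real_normed_vector set \<Rightarrow> nat \<Rightarrow> 'a" where
  "dense_seq S = (SOME d. span S \<subseteq> closure (range d))"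

text \<open>A countable family of vector fields whose values at \<open>p\<close> approximate every vector in the closed
  span of the support of \<open>p\<close>.\<close>

definition directions :: "'a::real_inner set \<Rightarrow> nat \<Rightarrow> 'a \<Rightarrow> 'a" where
  "directions B k p = (case prod_decode k of (n, j) \<Rightarrow> dense_seq (large_coords B n p) j)"

lemma directions_dense:
  fixes w p :: "'a::{real_inner, complete_space}"
  assumes B: "orthonormal B" and tot: "\<And>x. (\<And>e. e \<in> B \<Longrightarrow> x \<bullet> e = 0) \<Longrightarrow> x = 0"
    and supp: "\<And>e. e \<in> B \<Longrightarrow> p \<bullet> e = 0 \<Longrightarrow> w \<bullet> e = 0" and "0 < \<epsilon>"
  shows "\<exists>k. norm (directions B k p - w) < \<epsilon>"
proof -
  have "\<epsilon> / 2 > 0" using \<open>0 < \<epsilon>\<close> by simp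
  then obtain n where n: "norm ((\<Sum>e\<in>large_coords B n w. (w \<bullet> e) *\<^sub>R e) - w) < \<epsilon> / 2"
    using LIMSEQ_D[OF fourier_sum_tendsto[OF B tot, of w], of "\<epsilon>/2"] by blast
  let ?F = "large_coords B n w"
  have "?F \<subseteq> (\<Union>m. large_coords B m p)"
    unfolding Union_large_coords using supp by (force simp: large_coords_def)
  moreover have "finite ?F" by (rule finite_large_coords[OF B])
  ultimately obtain m where m: "?F \<subseteq> large_coords B m p"
  proof -
    assume "?F \<subseteq> (\<Union>m. large_coords B m p)" and fin: "finite ?F"
    then have "\<forall>e\<in>?F. \<exists>m. e \<in> large_coords B m p" by blast
    then obtain g where g: "\<And>e. e \<in> ?F \<Longrightarrow> e \<in> large_coords B (g e) p" by metis
    have "?F \<subseteq> large_coords B (\<Sum>e\<in>?F. g e) p"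
      using g large_coords_mono[OF member_le_sum[of _ ?F g]] fin by blast
    then show thesis by (rule that)
  qed
  let ?y = "\<Sum>e\<in>?F. (w \<bullet> e) *\<^sub>R e"
  have "?y \<in> span (large_coords B m p)"
    using m by (intro span_sum span_scale span_base) auto
  moreover have "span (large_coords B m p) \<subseteq> closure (range (dense_seq (large_coords B m p)))"
    unfolding dense_seq_def by (rule someI_ex[OF ex_dense_seq_span_finite[OF finite_large_coords[OF B]]])
  ultimately have "?y \<in> closure (range (dense_seq (large_coords B m p)))" by (rule subsetD[rotated])
  then have "\<exists>z\<in>range (dense_seq (large_coords B m p)). dist z ?y < \<epsilon> / 2"
    using \<open>\<epsilon> / 2 > 0\<close> unfolding closure_approachable by blast
  then obtain j where "dist (dense_seq (large_coords B m p) j) ?y < \<epsilon> / 2" by blast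
  then have "norm (directions B (prod_encode (m, j)) p - w) < \<epsilon>"
    using n norm_triangle_ineq[of "directions B (prod_encode (m, j)) p - ?y" "?y - w"]
    by (simp add: directions_def dist_norm)
  then show ?thesis by blast
qed

text \<open>Having at least \<open>m\<close> large coordinates is an open condition. On the Borel set where there are exactly \<open>m\<close>
  of them, the coordinates large at \<open>p\<close> remain large nearby and leave no room for others.\<close>

lemma piecewise_locally_constant_large_coords:
  fixes B :: "'a::real_inner set"
  assumes B: "orthonormal B"
  shows "piecewise_locally_constant UNIV (large_coords B n)"
proof -
  let ?q = "1 / (real n + 1)"
  have opn: "open {p. \<forall>e\<in>F. ?q < \<bar>p \<bullet> e\<bar>}" if "finite F" for F :: "'a set"
  proof -
    have "open (\<Inter>e\<in>F. {p. ?q < \<bar>p \<bullet> e\<bar>})"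
      using that by (intro open_INT ballI open_Collect_less continuous_intros) auto
    moreover have "{p. \<forall>e\<in>F. ?q < \<bar>p \<bullet> e\<bar>} = (\<Inter>e\<in>F. {p. ?q < \<bar>p \<bullet> e\<bar>})" by auto
    ultimately show ?thesis by simp
  qed
  define G where "G m = \<Union>{{p. \<forall>e\<in>F. ?q < \<bar>p \<bullet> e\<bar>} | F. finite F \<and> F \<subseteq> B \<and> card F = m}" for m
  have G: "open (G m)" for m unfolding G_def using opn by (intro open_Union) auto
  have Giff: "p \<in> G m \<longleftrightarrow> m \<le> card (large_coords B n p)" for p m
  proof
    assume "p \<in> G m"
    then obtain F where F: "finite F" "F \<subseteq> B" "card F = m" "\<forall>e\<in>F. ?q < \<bar>p \<bullet> e\<bar>" by (auto simp: G_def)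
    then have "F \<subseteq> large_coords B n p" by (auto simp: large_coords_def)
    then show "m \<le> card (large_coords B n p)" using F(3) card_mono[OF finite_large_coords[OF B]] by blast
  next
    assume "m \<le> card (large_coords B n p)"
    then obtain F where "F \<subseteq> large_coords B n p" "card F = m" "finite F"
      by (metis obtain_subset_with_card_n)
    then show "p \<in> G m" unfolding G_def by (auto simp: large_coords_def)
  qed
  define A where "A m = G m - G (Suc m)" for m
  have Aiff: "p \<in> A m \<longleftrightarrow> card (large_coords B n p) = m" for p m by (auto simp: A_def Giff)
  show ?thesis unfolding piecewise_locally_constant_def
  proof (intro exI[of _ A] conjI allI ballI)
    fix m
    show "A m \<in> sets borel" unfolding A_def using G by auto
    fix p assume p: "p \<in> UNIV \<inter> A m"
    let ?U = "{q. \<forall>e\<in>large_coords B n p. ?q < \<bar>q \<bullet> e\<bar>}"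
    have "large_coords B n q = large_coords B n p" if q: "q \<in> ?U \<inter> UNIV \<inter> A m" for q
    proof -
      have "large_coords B n p \<subseteq> large_coords B n q" using q by (auto simp: large_coords_def)
      moreover have "card (large_coords B n p) = card (large_coords B n q)" using p q Aiff by auto
      ultimately show ?thesis using card_subset_eq[OF finite_large_coords[OF B]] by blast
    qed
    moreover have "open ?U" using opn[OF finite_large_coords[OF B]] .
    moreover have "p \<in> ?U" by (auto simp: large_coords_def)
    ultimately show "\<exists>U. open U \<and> p \<in> U \<and> (\<forall>q\<in>U \<inter> UNIV \<inter> A m. large_coords B n q = large_coords B n p)"
      by (intro exI[of _ ?U]) blast
  qed (auto simp: Aiff)
qed

lemma piecewise_locally_constant_directions: "orthonormal B \<Longrightarrow> piecewise_locally_constant UNIV (directions B k)"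
  unfolding directions_def
  by (cases "prod_decode k") (simp add: piecewise_locally_constant_comp[OF piecewise_locally_constant_large_coords, where h = "\<lambda>S. dense_seq S j" for j])

section \<open>Chains of fitted directions\<close>

text \<open>The points obtained by iterating: each entry \<open>(v, r)\<close> keeps those points from which one can walk
  along \<open>v\<close>, for times up to \<open>r\<close>, staying relatively close to the set obtained so far.\<close>

primrec fit :: "real \<Rightarrow> 'a::real_normed_vector set \<Rightarrow> ('a \<times> real) list \<Rightarrow> 'a set" where
  "fit \<epsilon> E [] = E"
| "fit \<epsilon> E (x # xs) =
     {p \<in> fit \<epsilon> E xs. \<forall>h. \<bar>h\<bar> \<le> snd x \<longrightarrow> infdist (p + h *\<^sub>R fst x) (fit \<epsilon> E xs) \<le> \<epsilon> * \<bar>h\<bar>}"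

text \<open>Quantitative independence: each direction keeps the distance \<open>\<delta>\<close> from the span of the later entries
  of the list. The norm bound leaves room for directions that only approximate unit vectors.\<close>

primrec spread :: "real \<Rightarrow> ('a::real_normed_vector \<times> real) list \<Rightarrow> bool" where
  "spread \<delta> [] \<longleftrightarrow> True"
| "spread \<delta> (x # xs) \<longleftrightarrow>
     spread \<delta> xs \<and> 0 < snd x \<and> norm (fst x) \<le> 2 \<and> \<delta> \<le> infdist (fst x) (span (fst ` set xs))"

text \<open>Bounds the sum of the absolute coefficients of a vector of norm one with respect to a \<open>\<delta>\<close>-spread list
  of \<open>m\<close> directions.\<close>

primrec coeff_bound :: "real \<Rightarrow> nat \<Rightarrow> real" where
  "coeff_bound \<delta> 0 = 0"
| "coeff_bound \<delta> (Suc m) = 1 / \<delta> + coeff_bound \<delta> m * (1 + 2 / \<delta>)"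

definition span_of_at_most :: "nat \<Rightarrow> 'a::real_vector set \<Rightarrow> bool" where
  "span_of_at_most m W \<longleftrightarrow> (\<exists>S. finite S \<and> card S \<le> m \<and> W = span S)"

lemma closed_fit: "closed E \<Longrightarrow> closed (fit \<epsilon> E xs)"
proof (induction xs)
  case (Cons x xs)
  have "fit \<epsilon> E (x # xs) = fit \<epsilon> E xs \<inter>
      (\<Inter>h\<in>{h. \<bar>h\<bar> \<le> snd x}. {p. infdist (p + h *\<^sub>R fst x) (fit \<epsilon> E xs) \<le> \<epsilon> * \<bar>h\<bar>})" by auto
  also have "closed \<dots>"
    using Cons by (intro closed_Int closed_INT ballI closed_Collect_le continuous_intros) auto
  finally show ?case .
qed simp

lemma fit_subset: "fit \<epsilon> E xs \<subseteq> E"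
  by (induction xs) auto

lemma coeff_bound_nonneg: "0 < \<delta> \<Longrightarrow> 0 \<le> coeff_bound \<delta> m"
  by (induction m) auto

text \<open>Walk along the first direction to a nearby point of the smaller chain, then use the induction
  hypothesis there. The errors add up to \<open>\<epsilon>\<close> times the sum of the coefficients of \<open>y\<close>.\<close>

lemma fit_spread_infdist_le:
  fixes E :: "'a::real_normed_vector set"
  assumes "0 < \<delta>" "0 < \<epsilon>"
  shows "spread \<delta> xs \<Longrightarrow> p \<in> fit \<epsilon> E xs \<Longrightarrow> y \<in> span (fst ` set xs) \<Longrightarrow>
    (\<And>x. x \<in> set xs \<Longrightarrow> coeff_bound \<delta> (length xs) * norm y \<le> snd x) \<Longrightarrow>
    infdist (p + y) E \<le> \<epsilon> * (coeff_bound \<delta> (length xs) * norm y)"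
proof (induction xs arbitrary: p y)
  case Nil
  then show ?case by simp
next
  case (Cons x xs)
  define v where "v = fst x"
  define M where "M = coeff_bound \<delta> (length xs)"
  have M0: "0 \<le> M" unfolding M_def using assms(1) by (rule coeff_bound_nonneg)
  have sp: "spread \<delta> xs" "norm v \<le> 2" "\<delta> \<le> infdist v (span (fst ` set xs))"
    using Cons.prems(1) by (auto simp: v_def)
  obtain h where h: "y - h *\<^sub>R v \<in> span (fst ` set xs)"
    using Cons.prems(3) by (auto simp: span_insert v_def)
  define y' where "y' = y - h *\<^sub>R v"
  have hy: "\<bar>h\<bar> \<le> norm y / \<delta>"
  proof (cases "h = 0")
    case False
    have "- (1 / h) *\<^sub>R y' \<in> span (fst ` set xs)" using h unfolding y'_def by (intro span_scale)
    then have "\<delta> \<le> dist v (- (1 / h) *\<^sub>R y')" using sp(3) infdist_le order_trans by blast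
    also have "v - (- (1 / h) *\<^sub>R y') = (1 / h) *\<^sub>R y" using False by (simp add: y'_def algebra_simps)
    then have "dist v (- (1 / h) *\<^sub>R y') = norm y / \<bar>h\<bar>" unfolding dist_norm by simp
    finally show ?thesis using False assms(1) by (simp add: field_simps)
  qed (use assms in simp)
  have "norm y' \<le> norm y + \<bar>h\<bar> * norm v"
    unfolding y'_def using norm_triangle_ineq4[of y "h *\<^sub>R v"] by simp
  also have "\<dots> \<le> norm y + (norm y / \<delta>) * 2"
    using hy sp(2) by (intro add_left_mono mult_mono) auto
  also have "\<dots> = (1 + 2 / \<delta>) * norm y" by (simp add: algebra_simps)
  finally have y': "norm y' \<le> (1 + 2 / \<delta>) * norm y" .
  have len: "coeff_bound \<delta> (length (x # xs)) * norm y = norm y / \<delta> + M * ((1 + 2 / \<delta>) * norm y)"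
    by (simp add: M_def algebra_simps)
  have My': "M * norm y' \<le> M * ((1 + 2 / \<delta>) * norm y)" using y' M0 by (rule mult_left_mono)
  have nn: "0 \<le> norm y / \<delta>" "0 \<le> M * ((1 + 2 / \<delta>) * norm y)" using assms(1) M0 by auto
  have hx: "\<bar>h\<bar> \<le> snd x" using Cons.prems(4)[of x] len hy nn by auto
  have small: "M * norm y' \<le> snd z" if "z \<in> set xs" for z
    using Cons.prems(4)[of z] that len My' nn by auto
  have p: "p \<in> fit \<epsilon> E xs" "infdist (p + h *\<^sub>R v) (fit \<epsilon> E xs) \<le> \<epsilon> * \<bar>h\<bar>"
    using Cons.prems(2) hx by (auto simp: v_def)
  have "infdist (p + y) E \<le> \<epsilon> * (norm y / \<delta> + M * ((1 + 2 / \<delta>) * norm y)) + \<eta>" if "0 < \<eta>" for \<eta>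
  proof -
    have ne: "fit \<epsilon> E xs \<noteq> {}" using p(1) by blast
    have "infdist (p + h *\<^sub>R v) (fit \<epsilon> E xs) < \<epsilon> * \<bar>h\<bar> + \<eta>" using p(2) that by simp
    then obtain p' where p': "p' \<in> fit \<epsilon> E xs" "dist (p + h *\<^sub>R v) p' < \<epsilon> * \<bar>h\<bar> + \<eta>"
      unfolding infdist_notempty[OF ne] by (subst (asm) cINF_less_iff) (use ne in auto)
    have "infdist (p' + y') E \<le> \<epsilon> * (M * norm y')"
      unfolding M_def using sp(1) p'(1) h small by (intro Cons.IH) (auto simp: y'_def M_def)
    moreover have "dist (p + y) (p' + y') = dist (p + h *\<^sub>R v) p'"
      by (simp add: y'_def dist_norm algebra_simps)
    ultimately have "infdist (p + y) E \<le> \<epsilon> * (M * norm y') + (\<epsilon> * \<bar>h\<bar> + \<eta>)"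
      using infdist_triangle[of "p + y" E "p' + y'"] p'(2) by linarith
    also have "\<dots> = \<epsilon> * (\<bar>h\<bar> + M * norm y') + \<eta>" by (simp add: algebra_simps)
    also have "\<dots> \<le> \<epsilon> * (norm y / \<delta> + M * ((1 + 2 / \<delta>) * norm y)) + \<eta>"
    proof -
      have "\<bar>h\<bar> + M * norm y' \<le> norm y / \<delta> + M * ((1 + 2 / \<delta>) * norm y)" using hy My' by linarith
      then show ?thesis using assms(2) by simp
    qed
    finally show ?thesis .
  qed
  then show ?case unfolding len by (rule field_le_epsilon)
qed

lemma spread_independent:
  "0 < \<delta> \<Longrightarrow> spread \<delta> xs \<Longrightarrow> independent (fst ` set xs) \<and> card (fst ` set xs) = length xs"
proof (induction xs)
  case (Cons x xs)
  then have "fst x \<notin> span (fst ` set xs)"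
    using infdist_zero[of "fst x" "span (fst ` set xs)"] by auto
  with Cons show ?case
    using span_base[of "fst x" "fst ` set xs"] by (auto simp: independent_insert)
qed (simp add: independent_empty)

text \<open>A spread list of length \<open>d\<close> would produce a \<open>d\<close>-plane \<open>V\<close> such that every point of \<open>V\<close> in a small ball
  around \<open>p\<close> is too close to \<open>E\<close>. Longer lists are excluded because their tails are spread as well.\<close>

lemma badly_fits_bounds_spread_length:
  fixes E :: "'a::real_normed_vector set"
  assumes E: "badly_fits d E" and d: "1 \<le> d" and \<delta>: "0 < \<delta>"
  shows "\<exists>\<epsilon>>0. \<forall>xs p. spread \<delta> xs \<longrightarrow> p \<in> fit \<epsilon> E xs \<longrightarrow> length xs < d"
proof -
  obtain \<epsilon>\<^sub>0 where e0: "\<epsilon>\<^sub>0 > 0" "\<And>V c r. V \<in> planes d \<Longrightarrow> r > 0 \<Longrightarrow> diameter (V \<inter> cball c r) > 0 \<Longrightarrow>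
        \<not> V \<inter> cball c r \<subseteq> closed_nbhd (\<epsilon>\<^sub>0 * diameter (V \<inter> cball c r)) E"
    using E unfolding badly_fits_def by blast
  define M where "M = coeff_bound \<delta> d"
  have M0: "0 \<le> M" unfolding M_def using \<delta> by (rule coeff_bound_nonneg)
  define \<epsilon> where "\<epsilon> = \<epsilon>\<^sub>0 / (M + 1)"
  have e: "0 < \<epsilon>" using e0(1) M0 by (simp add: \<epsilon>_def)
  have eM: "\<epsilon> * M \<le> \<epsilon>\<^sub>0" using e0(1) M0 by (simp add: \<epsilon>_def field_simps)
  have ne: "length xs \<noteq> d" if xs: "spread \<delta> xs" "p \<in> fit \<epsilon> E xs" for xs p
  proof
    assume len: "length xs = d"
    define S where "S = fst ` set xs"
    have S: "independent S" "card S = d" "finite S"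
      using spread_independent[OF \<delta> xs(1)] len by (auto simp: S_def)
    define V where "V = (+) p ` span S"
    have V: "V \<in> planes d" unfolding planes_def lin_subspaces_def V_def using S by blast
    have pos: "snd x > 0" if "x \<in> set xs" for x using xs(1) that by (induction xs) auto
    define R where "R = Min (insert 1 (snd ` set xs))"
    have R: "R > 0" "\<And>x. x \<in> set xs \<Longrightarrow> R \<le> snd x" using pos by (auto simp: R_def)
    define \<rho> where "\<rho> = R / (M + 1)"
    have \<rho>: "0 < \<rho>" "M * \<rho> \<le> R" using R M0 by (auto simp: \<rho>_def field_simps)
    have bd: "bounded (V \<inter> cball p \<rho>)" by (simp add: bounded_Int)
    obtain v where v: "v \<in> S" using S d by fastforce
    have "v \<noteq> 0" using v S(1) dependent_zero by blast
    have "p + 0 \<in> V" "p + (\<rho> / norm v) *\<^sub>R v \<in> V"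
      unfolding V_def using v by (auto intro: span_base span_scale span_zero)
    then have "p \<in> V \<inter> cball p \<rho>" "p + (\<rho> / norm v) *\<^sub>R v \<in> V \<inter> cball p \<rho>"
      using \<rho>(1) \<open>v \<noteq> 0\<close> by (auto simp: dist_norm)
    then have "dist p (p + (\<rho> / norm v) *\<^sub>R v) \<le> diameter (V \<inter> cball p \<rho>)"
      by (rule diameter_bounded_bound[OF bd])
    then have D: "\<rho> \<le> diameter (V \<inter> cball p \<rho>)" using \<rho>(1) \<open>v \<noteq> 0\<close> by (simp add: dist_norm)
    have "x \<in> closed_nbhd (\<epsilon>\<^sub>0 * diameter (V \<inter> cball p \<rho>)) E" if x: "x \<in> V \<inter> cball p \<rho>" for x
    proof -
      obtain y where y: "y \<in> span S" "x = p + y" using x by (auto simp: V_def)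
      have yr: "norm y \<le> \<rho>" using x y by (simp add: dist_norm)
      then have My: "M * norm y \<le> M * \<rho>" using M0 by (rule mult_left_mono)
      have "infdist (p + y) E \<le> \<epsilon> * (coeff_bound \<delta> (length xs) * norm y)"
      proof (rule fit_spread_infdist_le[OF \<delta> e xs])
        show "y \<in> span (fst ` set xs)" using y by (simp add: S_def)
        show "coeff_bound \<delta> (length xs) * norm y \<le> snd x" if "x \<in> set xs" for x
          using My \<rho>(2) R(2)[OF that] unfolding len M_def[symmetric] by linarith
      qed
      also have "\<dots> = (\<epsilon> * M) * norm y" by (simp add: len M_def)
      also have "\<dots> \<le> \<epsilon>\<^sub>0 * diameter (V \<inter> cball p \<rho>)"
        using eM yr D e0(1) by (intro mult_mono) auto
      finally show ?thesis
        using y(2) xs(2) fit_subset unfolding closed_nbhd_def by blast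
    qed
    then show False using e0(2)[OF V \<rho>(1), of p] D \<rho>(1) by (meson less_le_trans subsetI)
  qed
  have "length xs < d" if "spread \<delta> xs" "p \<in> fit \<epsilon> E xs" for xs p
    using that
  proof (induction xs)
    case Nil
    then show ?case using d by simp
  next
    case (Cons x xs)
    then have "length xs < d" by simp
    moreover have "length (x # xs) \<noteq> d" using ne Cons.prems by blast
    ultimately show ?case by simp
  qed
  then show ?thesis using e by blast
qed

text \<open>\<open>W p\<close> is spanned by a longest chain at \<open>p\<close>, taken from the countable family of direction fields. At almost
  every time, a tangent \<open>v\<close> far from \<open>W\<close> is fitted by the set of the current chain. Then so is a
  nearby member of the family, and it prolongs the chain.\<close>

lemma approximate_tangent_field:
  fixes E B :: "'a::{real_inner, complete_space} set"
  assumes E: "closed E" "badly_fits d E" and d: "1 \<le> d" and \<delta>: "0 < \<delta>"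
    and B: "orthonormal B" and tot: "\<And>x. (\<And>e. e \<in> B \<Longrightarrow> x \<bullet> e = 0) \<Longrightarrow> x = 0"
  shows "\<exists>W. piecewise_locally_constant E W \<and> (\<forall>p\<in>E. span_of_at_most (d - 1) (W p)) \<and>
    (\<forall>\<gamma> l \<Gamma>. arclength_param \<gamma> l \<Gamma> \<longrightarrow>
      negligible {t \<in> {0<..<l}. \<gamma> t \<in> E \<and>
        (\<exists>v. norm v = 1 \<and> (\<gamma> has_vector_derivative v) (at t) \<and> \<delta> < infdist v (W (\<gamma> t)))})"
proof -
  obtain \<epsilon> where e: "\<epsilon> > 0" "\<And>xs p. spread \<delta> xs \<Longrightarrow> p \<in> fit \<epsilon> E xs \<Longrightarrow> length xs < d"
    using badly_fits_bounds_spread_length[OF E(2) d \<delta>] by blast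
  define u :: "nat \<times> nat \<Rightarrow> 'a \<Rightarrow> 'a \<times> real" where "u i p = (directions B (fst i) p, 1 / (real (snd i) + 1))" for i p
  define tuple where "tuple ks p = map (\<lambda>i. u i p) ks" for ks p
  have pw: "piecewise_locally_constant E (tuple ks)" for ks
  proof -
    have "piecewise_locally_constant UNIV (u i)" for i
      unfolding u_def using piecewise_locally_constant_comp[OF piecewise_locally_constant_directions[OF B], where h = "\<lambda>x. (x, 1 / (real (snd i) + 1))"] .
    then have "piecewise_locally_constant E (u i)" for i using piecewise_locally_constant_subset[OF _ subset_UNIV] by blast
    then have "piecewise_locally_constant E (\<lambda>p. map (\<lambda>i. u i p) ks)" by (rule piecewise_locally_constant_map)
    then show ?thesis unfolding tuple_def .
  qed
  define good where "good ks p \<longleftrightarrow> spread \<delta> (tuple ks p) \<and> p \<in> fit \<epsilon> E (tuple ks p)" for ks p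
  define best where "best c p \<longleftrightarrow> good (from_nat c) p \<and>
      (\<forall>c'. good (from_nat c') p \<longrightarrow> length (from_nat c' :: (nat \<times> nat) list) \<le> length (from_nat c :: (nat \<times> nat) list))" for c p
  define N where "N p = (LEAST c. best c p)" for p
  define W where "W p = span (fst ` set (tuple (from_nat (N p)) p))" for p
  have Eb: "E \<in> sets borel" using E(1) by auto
  have gE: "{p \<in> E. good ks p} \<in> sets borel" for ks
  proof -
    have "{p \<in> E. p \<in> (if spread \<delta> (tuple ks p) then fit \<epsilon> E (tuple ks p) else {})} \<in> sets borel"
      by (rule piecewise_locally_constant_closed_fibres[OF pw Eb]) (auto simp: closed_fit E(1))
    moreover have "{p \<in> E. p \<in> (if spread \<delta> (tuple ks p) then fit \<epsilon> E (tuple ks p) else {})} = {p \<in> E. good ks p}"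
      by (auto simp: good_def)
    ultimately show ?thesis by simp
  qed
  have [measurable]: "Measurable.pred (restrict_space borel E) (good ks)" for ks
    unfolding pred_def using gE[of ks] Eb by (auto simp: space_restrict_space sets_restrict_space_iff)
  have [measurable]: "N \<in> measurable (restrict_space borel E) (count_space UNIV)"
    unfolding N_def best_def by measurable
  have "piecewise_locally_constant E (\<lambda>p. tuple (from_nat (N p)) p)"
    using piecewise_locally_constant_select[OF Eb, of N "\<lambda>c. tuple (from_nat c)"] pw by measurable
  then have pwW: "piecewise_locally_constant E W"
    unfolding W_def by (rule piecewise_locally_constant_comp)
  have best: "best (N p) p" if p: "p \<in> E" for p
  proof -
    have g0: "good [] p" using p by (simp add: good_def tuple_def)
    have "\<forall>ks. good ks p \<longrightarrow> length ks < d" using e(2) by (force simp: good_def tuple_def)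
    then obtain ks where ks: "good ks p" "\<And>ks'. good ks' p \<Longrightarrow> length ks' \<le> length ks"
      using ex_has_greatest_nat[of "\<lambda>ks. good ks p" "[]" length d] g0 by (auto simp: less_imp_le)
    then have "best (to_nat ks) p" by (auto simp: best_def)
    then show ?thesis unfolding N_def by (rule LeastI)
  qed
  have fdW: "span_of_at_most (d - 1) (W p)" if p: "p \<in> E" for p
  proof -
    define xs where "xs = tuple (from_nat (N p)) p"
    have "length xs < d" using best[OF p] e(2) by (auto simp: best_def good_def xs_def)
    moreover have "card (fst ` set xs) \<le> length xs" using card_image_le[of "set xs" fst] card_length[of xs] by simp
    ultimately have "card (fst ` set xs) \<le> d - 1" by simp
    then show ?thesis unfolding span_of_at_most_def W_def xs_def by blast
  qed
  have "negligible {t \<in> {0<..<l}. \<gamma> t \<in> E \<and>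
        (\<exists>v. norm v = 1 \<and> (\<gamma> has_vector_derivative v) (at t) \<and> \<delta> < infdist v (W (\<gamma> t)))}" (is "negligible ?B")
    if al: "arclength_param \<gamma> l \<Gamma>" for \<gamma> l \<Gamma>
  proof -
    have lip: "\<And>s t. s \<in> {0..l} \<Longrightarrow> t \<in> {0..l} \<Longrightarrow> dist (\<gamma> s) (\<gamma> t) \<le> \<bar>s - t\<bar>"
      using arclength_param_lipschitz[OF al] .
    define S where "S = {t \<in> {0..l}. \<gamma> t \<in> E}"
    have "1-lipschitz_on S \<gamma>" using lip by (auto simp: lipschitz_on_def S_def dist_real_def)
    then have cont: "continuous_on S \<gamma>" by (rule lipschitz_on_continuous_on)
    define X where "X = (\<Union>ks. tuple ks ` \<gamma> ` S)"
    have "countable X" unfolding X_def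
      by (intro countable_UN piecewise_locally_constant_countable_image_curve[OF pw cont]) (auto simp: S_def)
    define N1 where "N1 = (\<Union>xs\<in>X. {t \<in> {0<..<l}. \<gamma> t \<in> fit \<epsilon> E xs \<and> (\<exists>v. (\<gamma> has_vector_derivative v) (at t) \<and>
           \<not> (\<exists>d>0. \<forall>h. \<bar>h\<bar> < d \<longrightarrow> infdist (\<gamma> t + h *\<^sub>R v) (fit \<epsilon> E xs) \<le> \<epsilon>/2 * \<bar>h\<bar>))})"
    define N2 where "N2 = {t \<in> {0<..<l}. \<exists>e\<in>B. \<gamma> t \<bullet> e = 0 \<and> (\<exists>v. (\<gamma> has_vector_derivative v) (at t) \<and> v \<bullet> e \<noteq> 0)}"
    have "negligible N1" unfolding N1_def
    proof (intro negligible_countable_Union)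
      fix Y assume "Y \<in> (\<lambda>xs. {t \<in> {0<..<l}. \<gamma> t \<in> fit \<epsilon> E xs \<and> (\<exists>v. (\<gamma> has_vector_derivative v) (at t) \<and>
           \<not> (\<exists>d>0. \<forall>h. \<bar>h\<bar> < d \<longrightarrow> infdist (\<gamma> t + h *\<^sub>R v) (fit \<epsilon> E xs) \<le> \<epsilon>/2 * \<bar>h\<bar>))}) ` X"
      moreover have "\<epsilon>/2 > 0" using e(1) by simp
      ultimately show "negligible Y" using negligible_tangent_leaves[OF lip] by blast
    qed (use \<open>countable X\<close> in simp)
    moreover have "negligible N2" unfolding N2_def
      using lip countable_support[OF B] by (rule negligible_tangent_leaves_support)
    moreover have "?B \<subseteq> N1 \<union> N2"
    proof (rule subsetI, rule ccontr)
      fix t assume t: "t \<in> ?B" and nt: "t \<notin> N1 \<union> N2"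
      then obtain v where v: "norm v = 1" "(\<gamma> has_vector_derivative v) (at t)" "\<delta> < infdist v (W (\<gamma> t))"
        and t': "0 < t" "t < l" "\<gamma> t \<in> E" by auto
      define p where "p = \<gamma> t"
      define ks :: "(nat \<times> nat) list" where "ks = from_nat (N p)"
      define xs where "xs = tuple ks p"
      have b: "best (N p) p" using best t' by (simp add: p_def)
      then have g: "spread \<delta> xs" "p \<in> fit \<epsilon> E xs" by (auto simp: best_def good_def xs_def ks_def)
      have Wp: "W p = span (fst ` set xs)" by (simp add: W_def xs_def ks_def)
      have "t \<in> S" using t' by (simp add: S_def)
      then have "xs \<in> X" unfolding X_def xs_def p_def by blast
      then obtain r where r: "r > 0" "\<And>h. \<bar>h\<bar> < r \<Longrightarrow> infdist (p + h *\<^sub>R v) (fit \<epsilon> E xs) \<le> \<epsilon>/2 * \<bar>h\<bar>"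
        using nt t' v(2) g(2) unfolding N1_def p_def by fastforce
      have supp: "v \<bullet> e = 0" if "e \<in> B" "p \<bullet> e = 0" for e
        using nt t' v(2) that unfolding N2_def p_def by auto
      \<comment> \<open>the three bounds ensure fitting, the norm bound and the distance from \<open>W p\<close> for the perturbed direction\<close>
      define \<eta> where "\<eta> = min (\<epsilon>/2) (min 1 (infdist v (W p) - \<delta>))"
      have "\<eta> > 0" using e(1) v(3) by (simp add: \<eta>_def p_def)
      then obtain k where k: "norm (directions B k p - v) < \<eta>"
        using directions_dense[OF B tot supp] by blast
      define w where "w = directions B k p"
      obtain n where n: "1 / (real n + 1) < r"
        using reals_Archimedean[OF r(1)] by (auto simp: inverse_eq_divide add.commute)
      have w: "norm (w - v) < \<epsilon>/2" "norm (w - v) < 1" "norm (w - v) < infdist v (W p) - \<delta>"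
        using k by (auto simp: w_def \<eta>_def)
      have tup: "tuple ((k, n) # ks) p = (w, 1 / (real n + 1)) # xs"
        by (simp add: tuple_def u_def w_def xs_def)
      have "norm w \<le> 2" using norm_triangle_ineq[of "w - v" v] v(1) w(2) by simp
      moreover have "\<delta> \<le> infdist w (span (fst ` set xs))"
        using infdist_triangle[of v "W p" w] w(3) by (simp add: Wp dist_norm norm_minus_commute)
      ultimately have "spread \<delta> ((w, 1 / (real n + 1)) # xs)" using g(1) by simp
      moreover have "p \<in> fit \<epsilon> E ((w, 1 / (real n + 1)) # xs)"
      proof -
        have "infdist (p + h *\<^sub>R w) (fit \<epsilon> E xs) \<le> \<epsilon> * \<bar>h\<bar>" if h: "\<bar>h\<bar> \<le> 1 / (real n + 1)" for h
        proof -
          have "dist (p + h *\<^sub>R w) (p + h *\<^sub>R v) = \<bar>h\<bar> * norm (w - v)"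
            by (simp add: dist_norm scaleR_diff_right[symmetric])
          also have "\<dots> \<le> \<bar>h\<bar> * (\<epsilon>/2)" using w(1) by (intro mult_left_mono) auto
          finally have "infdist (p + h *\<^sub>R w) (fit \<epsilon> E xs) \<le> \<epsilon>/2 * \<bar>h\<bar> + \<bar>h\<bar> * (\<epsilon>/2)"
            using infdist_triangle[of "p + h *\<^sub>R w" "fit \<epsilon> E xs" "p + h *\<^sub>R v"] r(2)[of h] h n by linarith
          then show ?thesis by (simp add: algebra_simps)
        qed
        then show ?thesis using g(2) by simp
      qed
      ultimately have "good ((k, n) # ks) p" unfolding good_def tup by blast
      then have "good (from_nat (to_nat ((k, n) # ks))) p" by simp
      then have "length ((k, n) # ks) \<le> length ks" using b unfolding best_def ks_def by (metis from_nat_to_nat)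
      then show False by simp
    qed
    ultimately show ?thesis by (meson negligible_Un negligible_subset)
  qed
  then show ?thesis using pwW fdW by blast
qed

section \<open>Orthogonal projections onto finite-dimensional subspaces\<close>

lemma span_of_at_most_iff: "span_of_at_most m W \<longleftrightarrow> W \<in> (\<Union>j\<le>m. lin_subspaces j)"
proof
  assume "span_of_at_most m W"
  then obtain S where S: "finite S" "card S \<le> m" "W = span S" by (auto simp: span_of_at_most_def)
  obtain B where B: "B \<subseteq> S" "independent B" "S \<subseteq> span B" by (rule maximal_independent_subset)
  have "span S = span B" using B by (simp add: span_eq subset_trans[OF B(1) span_superset])
  moreover have "finite B" "card B \<le> m" using B(1) S card_mono[OF S(1) B(1)] by (auto intro: finite_subset)
  ultimately show "W \<in> (\<Union>j\<le>m. lin_subspaces j)" using S(3) B(2) unfolding lin_subspaces_def by auto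
qed (auto simp: lin_subspaces_def span_of_at_most_def)

lemma span_of_at_most_subspace: "span_of_at_most m W \<Longrightarrow> subspace W"
  by (auto simp: span_of_at_most_def)

lemma span_of_at_most_independent:
  assumes "span_of_at_most m W" "independent B" "B \<subseteq> W"
  shows "finite B \<and> card B \<le> m"
proof -
  obtain S where S: "finite S" "card S \<le> m" "W = span S" using assms(1) by (auto simp: span_of_at_most_def)
  then show ?thesis using independent_span_bound[OF S(1) assms(2)] assms(3) by auto
qed

lemma subspace_span_of_at_mostI:
  assumes "subspace W" and "\<And>B. independent B \<Longrightarrow> B \<subseteq> W \<Longrightarrow> finite B \<and> card B \<le> m"
  shows "span_of_at_most m W"
proof -
  obtain B where B: "B \<subseteq> W" "independent B" "W \<subseteq> span B" by (rule maximal_independent_subset)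
  have "W = span B" using B assms(1) span_minimal by blast
  then show ?thesis using assms(2)[OF B(2,1)] unfolding span_of_at_most_def by blast
qed

lemma orth_proj:
  assumes "span_of_at_most m W"
  shows "orth_proj W x \<in> W" and "w \<in> W \<Longrightarrow> (x - orth_proj W x) \<bullet> w = 0"
proof -
  obtain j where "W \<in> lin_subspaces j" using assms by (auto simp: span_of_at_most_iff)
  from theI'[OF orth_proj_exists1[OF this]]
  show "orth_proj W x \<in> W" "w \<in> W \<Longrightarrow> (x - orth_proj W x) \<bullet> w = 0"
    unfolding orth_proj_def[symmetric] by auto
qed

lemma orth_proj_unique:
  assumes "span_of_at_most m W" and "\<And>x. blinfun_apply P x \<in> W" "\<And>x w. w \<in> W \<Longrightarrow> (x - blinfun_apply P x) \<bullet> w = 0"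
  shows "orth_proj W = P"
proof -
  obtain j where "W \<in> lin_subspaces j" using assms by (auto simp: span_of_at_most_iff)
  from the1_equality[OF orth_proj_exists1[OF this], of P] show ?thesis
    unfolding orth_proj_def using assms(2,3) by blast
qed

lemma orth_proj_pythagoras:
  assumes W: "span_of_at_most m W" and w: "w \<in> W"
  shows "(norm (x - w))\<^sup>2 = (norm (x - orth_proj W x))\<^sup>2 + (norm (orth_proj W x - w))\<^sup>2"
proof -
  let ?a = "x - orth_proj W x" and ?b = "orth_proj W x - w"
  have "?b \<in> W" using orth_proj(1)[OF W] w span_of_at_most_subspace[OF W] by (simp add: subspace_diff)
  then have "?a \<bullet> ?b = 0" by (rule orth_proj(2)[OF W])
  then have "(norm (?a + ?b))\<^sup>2 = (norm ?a)\<^sup>2 + (norm ?b)\<^sup>2"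
    by (intro norm_add_Pythagorean) (simp add: orthogonal_def)
  moreover have "?a + ?b = x - w" by simp
  ultimately show ?thesis by simp
qed

lemma orth_proj_fixes: "span_of_at_most m W \<Longrightarrow> w \<in> W \<Longrightarrow> orth_proj W w = w"
proof -
  assume "span_of_at_most m W" "w \<in> W"
  from orth_proj_pythagoras[OF this, of w] show ?thesis
    using sum_power2_eq_zero_iff[of "norm (w - orth_proj W w)" "norm (orth_proj W w - w)"] by simp
qed

lemma norm_orth_proj_le: "span_of_at_most m W \<Longrightarrow> norm (orth_proj W x) \<le> norm x"
proof -
  assume W: "span_of_at_most m W"
  have "0 \<in> W" using subspace_0[OF span_of_at_most_subspace[OF W]] .
  from orth_proj_pythagoras[OF W this, of x]
  have "(norm (orth_proj W x))\<^sup>2 \<le> (norm x)\<^sup>2" by simp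
  then show ?thesis by (rule power2_le_imp_le) simp
qed

lemma infdist_eq_norm_orth_proj:
  assumes W: "span_of_at_most m W"
  shows "infdist x W = norm (x - orth_proj W x)"
proof (rule antisym)
  show "infdist x W \<le> norm (x - orth_proj W x)"
    using infdist_le[OF orth_proj(1)[OF W], of x x] by (simp add: dist_norm)
  have ne: "W \<noteq> {}" using orth_proj(1)[OF W] by blast
  show "norm (x - orth_proj W x) \<le> infdist x W"
    unfolding infdist_notempty[OF ne]
  proof (rule cINF_greatest[OF ne])
    fix w assume "w \<in> W"
    from orth_proj_pythagoras[OF W this, of x]
    have "(norm (x - orth_proj W x))\<^sup>2 \<le> (norm (x - w))\<^sup>2" by simp
    then show "norm (x - orth_proj W x) \<le> dist x w" unfolding dist_norm by (rule power2_le_imp_le) simp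
  qed
qed

lemma orth_proj_self_adjoint:
  assumes W: "span_of_at_most m W"
  shows "orth_proj W x \<bullet> y = x \<bullet> orth_proj W y"
proof -
  have "(y - orth_proj W y) \<bullet> orth_proj W x = 0" "(x - orth_proj W x) \<bullet> orth_proj W y = 0"
    using orth_proj[OF W] by blast+
  then have "y \<bullet> orth_proj W x = orth_proj W y \<bullet> orth_proj W x" "x \<bullet> orth_proj W y = orth_proj W x \<bullet> orth_proj W y"
    by (simp_all add: inner_diff_left)
  then show ?thesis by (metis inner_commute)
qed

text \<open>The vector \<open>z\<close>, the component of \<open>u\<close> orthogonal to \<open>W'\<close>, defines a functional that is not zero on \<open>W\<close> but
  small on vectors close to \<open>W'\<close>. Its kernel in \<open>W\<close> is the smaller subspace.\<close>

lemma smaller_subspace_of_tilted_vector: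
  fixes W W' :: "'a::real_inner set"
  assumes W: "span_of_at_most (Suc m) W" and W': "span_of_at_most m' W'" and \<eta>: "0 < \<eta>"
    and u: "u \<in> W" "\<eta> / 2 * norm u < norm (u - orth_proj W' u)"
  shows "\<exists>V. span_of_at_most m V \<and> (\<forall>v. infdist v V \<le> (1 + 2 / \<eta>) * (infdist v W + infdist v W'))"
proof -
  define z where "z = u - orth_proj W' u"
  have z: "\<eta> / 2 * norm u < norm z" using u by (simp add: z_def)
  have "0 \<le> \<eta> / 2 * norm u" using \<eta> by simp
  then have z0: "z \<noteq> 0" using z by auto
  have zW': "z \<bullet> w = 0" if "w \<in> W'" for w unfolding z_def using W' that by (rule orth_proj(2))
  have uz: "u \<bullet> z = z \<bullet> z"
  proof -
    have "z \<bullet> orth_proj W' u = 0" using zW' orth_proj(1)[OF W'] by blast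
    then have "z \<bullet> (z + orth_proj W' u) = z \<bullet> z" by (simp add: inner_add_right)
    then show ?thesis by (simp add: z_def inner_commute)
  qed
  have sW: "subspace W" using W by (rule span_of_at_most_subspace)
  define V where "V = {v \<in> W. v \<bullet> z = 0}"
  have sV: "subspace V"
    unfolding V_def using sW by (auto simp: subspace_def inner_add_left)
  have "span_of_at_most m V"
  proof (rule subspace_span_of_at_mostI[OF sV])
    fix B assume B: "independent B" "B \<subseteq> V"
    have "u \<notin> V" using uz z0 by (simp add: V_def)
    then have "u \<notin> span B" using B(2) sV span_minimal by blast
    then have "u \<notin> B" "independent (insert u B)" using B(1) span_base by (auto simp: independent_insert)
    moreover have "insert u B \<subseteq> W" using B(2) u(1) by (auto simp: V_def)
    ultimately show "finite B \<and> card B \<le> m"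
      using span_of_at_most_independent[OF W, of "insert u B"] by auto
  qed
  moreover have "infdist v V \<le> (1 + 2 / \<eta>) * (infdist v W + infdist v W')" for v
  proof -
    define a b where "a = infdist v W" and "b = infdist v W'"
    define v0 where "v0 = orth_proj W v"
    have v0: "v0 \<in> W" "norm (v - v0) = a"
      using orth_proj(1)[OF W] infdist_eq_norm_orth_proj[OF W] by (auto simp: v0_def a_def)
    have ab: "0 \<le> a" "0 \<le> b" by (auto simp: a_def b_def infdist_nonneg)
    define t where "t = (v0 \<bullet> z) / (z \<bullet> z)"
    define w where "w = v0 - t *\<^sub>R u"
    have "w \<bullet> z = 0" using z0 by (simp add: w_def t_def inner_diff_left uz)
    then have "w \<in> V" using v0 u(1) sW by (simp add: V_def w_def subspace_diff subspace_scale)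
    have "norm (v0 - orth_proj W' v0) \<le> a + b"
      using infdist_triangle[of v0 W' v] v0(2) infdist_eq_norm_orth_proj[OF W', of v0]
      by (simp add: b_def dist_norm norm_minus_commute)
    moreover have "v0 \<bullet> z = (v0 - orth_proj W' v0) \<bullet> z"
    proof -
      have "orth_proj W' v0 \<bullet> z = 0" using zW'[OF orth_proj(1)[OF W', of v0]] by (simp add: inner_commute)
      then show ?thesis by (simp add: inner_diff_left)
    qed
    ultimately have "\<bar>v0 \<bullet> z\<bar> \<le> (a + b) * norm z"
      using Cauchy_Schwarz_ineq2[of "v0 - orth_proj W' v0" z] mult_right_mono[of _ "a + b" "norm z"]
      by (metis norm_ge_zero order_trans)
    then have "\<bar>t\<bar> \<le> (a + b) / norm z"
      using z0 by (simp add: t_def dot_square_norm power2_eq_square field_simps)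
    then have "norm (t *\<^sub>R u) \<le> (a + b) / norm z * norm u" unfolding norm_scaleR by (rule mult_right_mono) simp
    also have "\<dots> = (a + b) * (norm u / norm z)" by simp
    also have "\<dots> \<le> (a + b) * (2 / \<eta>)"
    proof (rule mult_left_mono)
      show "norm u / norm z \<le> 2 / \<eta>" using z z0 \<eta> by (simp add: field_simps)
    qed (use ab in simp)
    finally have tu: "norm (t *\<^sub>R u) \<le> (a + b) * (2 / \<eta>)" .
    have "infdist v V \<le> norm (v - w)" using infdist_le[OF \<open>w \<in> V\<close>, of v] by (simp add: dist_norm)
    also have "v - w = (v - v0) + t *\<^sub>R u" by (simp add: w_def)
    also have "norm \<dots> \<le> a + (a + b) * (2 / \<eta>)" using norm_triangle_ineq[of "v - v0" "t *\<^sub>R u"] v0(2) tu by linarith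
    also have "\<dots> \<le> (1 + 2 / \<eta>) * (a + b)" using ab by (simp add: algebra_simps)
    finally show ?thesis by (simp add: a_def b_def)
  qed
  ultimately show ?thesis by blast
qed

text \<open>Writing \<open>P - P' = P (1 - P') - (1 - P) P'\<close>, one of the two summands is large, which exhibits a vector
  of one space that is tilted away from the other.\<close>

lemma smaller_subspace_of_distant_projections:
  fixes W W' :: "'a::real_inner set"
  assumes W: "span_of_at_most (Suc m) W" and W': "span_of_at_most (Suc m) W'" and \<eta>: "0 < \<eta>"
    and far: "\<eta> < norm (orth_proj W - orth_proj W')"
  shows "\<exists>V. span_of_at_most m V \<and> (\<forall>v. infdist v V \<le> (1 + 2 / \<eta>) * (infdist v W + infdist v W'))"
proof -
  define P P' where "P = orth_proj W" and "P' = orth_proj W'"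
  obtain x where x: "\<eta> * norm x < norm ((P - P') x)"
  proof -
    have "\<not> (\<forall>x. norm ((P - P') x) \<le> \<eta> * norm x)"
      using norm_blinfun_bound[of \<eta> "P - P'"] far \<eta> by (auto simp: P_def P'_def)
    then show thesis using that by (auto simp: not_le)
  qed
  have "(P - P') x = P (x - P' x) - (P' x - P (P' x))"
    by (simp add: blinfun.diff_left blinfun.diff_right)
  then have "norm ((P - P') x) \<le> norm (P (x - P' x)) + norm (P' x - P (P' x))"
    using norm_triangle_ineq4 by metis
  then consider "\<eta> / 2 * norm x < norm (P (x - P' x))" | "\<eta> / 2 * norm x < norm (P' x - P (P' x))"
    using x by fastforce
  then show ?thesis
  proof cases
    case 1
    define z where "z = P (x - P' x)"
    have zW: "z \<in> W" unfolding z_def P_def by (rule orth_proj(1)[OF W])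
    have "z \<bullet> z = (x - P' x) \<bullet> P z" unfolding z_def P_def by (rule orth_proj_self_adjoint[OF W])
    also have "P z = z" unfolding P_def by (rule orth_proj_fixes[OF W zW])
    also have "(x - P' x) \<bullet> z = x \<bullet> (z - P' z)"
      unfolding P'_def using orth_proj_self_adjoint[OF W', of x z] by (simp add: inner_diff_left inner_diff_right)
    also have "\<dots> \<le> norm x * norm (z - P' z)" by (rule norm_cauchy_schwarz)
    finally have zz: "norm z * norm z \<le> norm x * norm (z - P' z)" by (simp add: dot_square_norm power2_eq_square)
    have z: "\<eta> / 2 * norm x < norm z" using 1 by (simp add: z_def)
    have x0: "norm x > 0" using z \<eta> x by (cases "x = 0") auto
    have "norm z > 0" using z \<eta> x0 by (meson half_gt_zero mult_pos_pos order_less_trans)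
    then have "\<eta> / 2 * norm x * norm z < norm x * norm (z - P' z)" using zz z by (meson less_le_trans mult_strict_right_mono)
    then have "\<eta> / 2 * norm z < norm (z - P' z)" using x0 by (simp add: field_simps)
    then show ?thesis using smaller_subspace_of_tilted_vector[OF W W' \<eta> zW] by (simp add: P'_def)
  next
    case 2
    have "norm (P' x) \<le> norm x" unfolding P'_def by (rule norm_orth_proj_le[OF W'])
    then have "\<eta> / 2 * norm (P' x) \<le> \<eta> / 2 * norm x" using \<eta> by simp
    then have "\<eta> / 2 * norm (P' x) < norm (P' x - P (P' x))" using 2 by linarith
    then have "\<exists>V. span_of_at_most m V \<and> (\<forall>v. infdist v V \<le> (1 + 2 / \<eta>) * (infdist v W' + infdist v W))"
      using smaller_subspace_of_tilted_vector[OF W' W \<eta>, of "P' x"] orth_proj(1)[OF W', of x]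
      by (simp add: P_def P'_def)
    then show ?thesis by (simp add: add.commute)
  qed
qed

text \<open>The pointwise limit \<open>Q\<close> of the projections is also their norm limit, and \<open>V\<close> is its range.
  A projection in the sequence that is within \<open>1/2\<close> of \<open>Q\<close> is injective on \<open>V\<close>, which bounds the dimension.\<close>

lemma Cauchy_orth_proj_limit:
  fixes W :: "nat \<Rightarrow> 'a::{real_inner, complete_space} set"
  assumes W: "\<And>n. span_of_at_most m (W n)"
    and C: "\<And>e. 0 < e \<Longrightarrow> \<exists>N. \<forall>n\<ge>N. \<forall>k\<ge>N. norm (orth_proj (W n) - orth_proj (W k)) \<le> e"
  defines "V \<equiv> {v. (\<lambda>n. orth_proj (W n) v) \<longlonglongrightarrow> v}"
  shows "span_of_at_most m V" and "(\<lambda>n. orth_proj (W n)) \<longlonglongrightarrow> orth_proj V"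
proof -
  define P where "P n = blinfun_apply (orth_proj (W n))" for n
  have frac: "e / (r + 1) * r < e" if "0 < e" "0 \<le> r" for e r :: real
  proof -
    have "e / (r + 1) * r < e / (r + 1) * (r + 1)" using that by (intro mult_strict_left_mono) auto
    then show ?thesis using that by simp
  qed
  have PP: "norm (P n x - P k x) \<le> norm (orth_proj (W n) - orth_proj (W k)) * norm x" for n k x
    unfolding P_def blinfun.diff_left[symmetric] by (rule norm_blinfun)
  have "convergent (\<lambda>n. P n x)" for x
  proof -
    have "Cauchy (\<lambda>n. P n x)"
    proof (rule metric_CauchyI)
      fix e :: real assume "e > 0"
      then have "e / (norm x + 1) > 0" by (simp add: add_nonneg_pos)
      then obtain N where N: "\<And>n k. n \<ge> N \<Longrightarrow> k \<ge> N \<Longrightarrow> norm (orth_proj (W n) - orth_proj (W k)) \<le> e / (norm x + 1)"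
        using C by blast
      have "dist (P n x) (P k x) < e" if "n \<ge> N" "k \<ge> N" for n k
      proof -
        have "dist (P n x) (P k x) \<le> e / (norm x + 1) * norm x"
          unfolding dist_norm using PP[of n x k] mult_right_mono[OF N[OF that] norm_ge_zero[of x]] by linarith
        also have "\<dots> < e" using frac[OF \<open>e > 0\<close> norm_ge_zero] .
        finally show ?thesis .
      qed
      then show "\<exists>N. \<forall>n\<ge>N. \<forall>k\<ge>N. dist (P n x) (P k x) < e" by blast
    qed
    then show ?thesis by (simp add: Cauchy_convergent_iff)
  qed
  then obtain Q where Q: "\<And>x. (\<lambda>n. P n x) \<longlonglongrightarrow> Q x" unfolding convergent_def by metis
  have "bounded_linear Q"
  proof (rule bounded_linear_intro[where K = 1])
    show "Q (x + y) = Q x + Q y" for x y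
      using LIMSEQ_unique[OF Q[of "x + y"]] tendsto_add[OF Q[of x] Q[of y]] by (simp add: P_def blinfun.add_right)
    show "Q (r *\<^sub>R x) = r *\<^sub>R Q x" for r x
      using LIMSEQ_unique[OF Q[of "r *\<^sub>R x"]] tendsto_scaleR[OF tendsto_const[of r] Q[of x]] by (simp add: P_def blinfun.scaleR_right)
    show "norm (Q x) \<le> norm x * 1" for x
      using tendsto_norm[OF Q[of x]] norm_orth_proj_le[OF W] by (intro LIMSEQ_le_const2) (auto simp: P_def)
  qed
  then have Qb: "blinfun_apply (Blinfun Q) = Q" by (rule bounded_linear_Blinfun_apply)
  have PQ: "\<exists>N. \<forall>n\<ge>N. norm (orth_proj (W n) - Blinfun Q) \<le> e" if e: "0 < e" for e
  proof -
    obtain N where N: "\<And>n k. n \<ge> N \<Longrightarrow> k \<ge> N \<Longrightarrow> norm (orth_proj (W n) - orth_proj (W k)) \<le> e"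
      using C[OF e] by blast
    have "norm (orth_proj (W n) - Blinfun Q) \<le> e" if n: "n \<ge> N" for n
    proof (rule norm_blinfun_bound)
      fix x
      have "norm (P n x - Q x) \<le> e * norm x"
      proof (rule LIMSEQ_le_const2)
        show "(\<lambda>k. norm (P n x - P k x)) \<longlonglongrightarrow> norm (P n x - Q x)" by (intro tendsto_intros Q)
        have "norm (P n x - P k x) \<le> e * norm x" if "k \<ge> N" for k
          using PP[of n x k] mult_right_mono[OF N[OF n that] norm_ge_zero[of x]] by linarith
        then show "\<exists>N. \<forall>k\<ge>N. norm (P n x - P k x) \<le> e * norm x" by blast
      qed
      then show "norm (blinfun_apply (orth_proj (W n) - Blinfun Q) x) \<le> e * norm x"
        by (simp add: blinfun.diff_left Qb P_def)
    qed (use e in simp)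
    then show ?thesis by blast
  qed
  have lim: "(\<lambda>n. orth_proj (W n)) \<longlonglongrightarrow> Blinfun Q"
  proof (rule LIMSEQ_I)
    fix r :: real assume "0 < r"
    then obtain N where "\<forall>n\<ge>N. norm (orth_proj (W n) - Blinfun Q) \<le> r / 2" using PQ[of "r/2"] by auto
    moreover have "r / 2 < r" using \<open>0 < r\<close> by simp
    ultimately show "\<exists>no. \<forall>n\<ge>no. norm (orth_proj (W n) - Blinfun Q) < r"
      by (meson order_le_less_trans)
  qed
  have Viff: "v \<in> V \<longleftrightarrow> Q v = v" for v
    using Q[of v] LIMSEQ_unique unfolding V_def P_def by auto
  have sV: "subspace V"
    using \<open>bounded_linear Q\<close> by (auto simp: subspace_def Viff bounded_linear.linear linear_0 linear_add linear_scale)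
  have QV: "Q x \<in> V" for x
  proof -
    have "norm (Q (Q x) - Q x) \<le> 0 + e" if e: "0 < e" for e
    proof -
      have "e / (norm x + 1) > 0" using e by (simp add: add_nonneg_pos)
      then obtain N where N: "\<And>n k. n \<ge> N \<Longrightarrow> k \<ge> N \<Longrightarrow> norm (orth_proj (W n) - orth_proj (W k)) \<le> e / (norm x + 1)"
        using C by blast
      have 1: "norm (P n (P k x) - P k x) \<le> e" if "n \<ge> N" "k \<ge> N" for n k
      proof -
        have "P k (P k x) = P k x" unfolding P_def by (rule orth_proj_fixes[OF W orth_proj(1)[OF W]])
        then have "norm (P n (P k x) - P k x) \<le> norm (orth_proj (W n) - orth_proj (W k)) * norm (P k x)"
          using PP[of n "P k x" k] by simp
        also have "\<dots> \<le> e / (norm x + 1) * norm x"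
          using N[OF that] norm_orth_proj_le[OF W, of k x] e unfolding P_def by (intro mult_mono) auto
        also have "\<dots> \<le> e" using frac[OF e norm_ge_zero[of x]] by simp
        finally show ?thesis .
      qed
      have 2: "norm (P n (Q x) - Q x) \<le> e" if "n \<ge> N" for n
      proof (rule LIMSEQ_le_const2)
        have "(\<lambda>k. P n (P k x)) \<longlonglongrightarrow> P n (Q x)"
          unfolding P_def[of n] by (intro blinfun.tendsto tendsto_const Q)
        then show "(\<lambda>k. norm (P n (P k x) - P k x)) \<longlonglongrightarrow> norm (P n (Q x) - Q x)" by (intro tendsto_intros Q)
        show "\<exists>M. \<forall>k\<ge>M. norm (P n (P k x) - P k x) \<le> e" using 1[OF that] by blast
      qed
      have "norm (Q (Q x) - Q x) \<le> e"
      proof (rule LIMSEQ_le_const2)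
        show "(\<lambda>n. norm (P n (Q x) - Q x)) \<longlonglongrightarrow> norm (Q (Q x) - Q x)" by (intro tendsto_intros Q)
        show "\<exists>M. \<forall>n\<ge>M. norm (P n (Q x) - Q x) \<le> e" using 2 by blast
      qed
      then show ?thesis by simp
    qed
    then have "norm (Q (Q x) - Q x) \<le> 0" by (rule field_le_epsilon)
    then show ?thesis by (simp add: Viff)
  qed
  have perp: "(x - Q x) \<bullet> w = 0" if "w \<in> V" for x w
  proof -
    have "(\<lambda>n. (x - P n x) \<bullet> P n w) \<longlonglongrightarrow> (x - Q x) \<bullet> Q w" by (intro tendsto_intros Q)
    moreover have "(x - P n x) \<bullet> P n w = 0" for n
      unfolding P_def using orth_proj[OF W] by blast
    ultimately have "(x - Q x) \<bullet> Q w = 0" by (simp add: LIMSEQ_const_iff)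
    then show ?thesis using that by (simp add: Viff)
  qed
  show V: "span_of_at_most m V"
  proof (rule subspace_span_of_at_mostI[OF sV])
    fix B assume B: "independent B" "B \<subseteq> V"
    obtain n where n: "norm (orth_proj (W n) - Blinfun Q) \<le> 1/2" using PQ[of "1/2"] by auto
    have lin: "linear (P n)" unfolding P_def by (rule bounded_linear.linear[OF blinfun.bounded_linear_right])
    have "span B \<subseteq> V" using B(2) sV by (rule span_minimal)
    have "v = 0" if "v \<in> span B" "P n v = 0" for v
    proof -
      have "Q v = v" using that(1) \<open>span B \<subseteq> V\<close> Viff by blast
      then have "norm v = norm (blinfun_apply (orth_proj (W n) - Blinfun Q) v)"
        using that(2) by (simp add: blinfun.diff_left Qb P_def)
      also have "\<dots> \<le> 1/2 * norm v"
        using norm_blinfun[of "orth_proj (W n) - Blinfun Q" v] mult_right_mono[OF n norm_ge_zero[of v]] by linarith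
      finally show ?thesis by simp
    qed
    then have inj: "inj_on (P n) (span B)" unfolding linear_injective_on_subspace_0[OF lin subspace_span] by blast
    with lin B(1) have "independent (P n ` B)" by (rule linear_independent_injective_image)
    moreover have "P n ` B \<subseteq> W n" unfolding P_def using orth_proj(1)[OF W] by blast
    ultimately have "finite (P n ` B) \<and> card (P n ` B) \<le> m" using span_of_at_most_independent[OF W] by blast
    moreover have "inj_on (P n) B" by (rule inj_on_subset[OF inj span_superset])
    ultimately show "finite B \<and> card B \<le> m" by (simp add: card_image finite_image_iff)
  qed
  have "orth_proj V = Blinfun Q" using V QV perp by (intro orth_proj_unique) (auto simp: Qb)
  then show "(\<lambda>n. orth_proj (W n)) \<longlonglongrightarrow> orth_proj V" using lim by simp
qed

section \<open>Fields of asymptotic directions\<close>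

definition borel_subspace_field :: "nat \<Rightarrow> 'a::real_inner set \<Rightarrow> ('a \<Rightarrow> 'a set) \<Rightarrow> bool" where
  "borel_subspace_field m D \<tau> \<longleftrightarrow> (\<forall>p\<in>D. span_of_at_most m (\<tau> p)) \<and>
     (\<lambda>p. orth_proj (\<tau> p)) \<in> borel_measurable (restrict_space borel D)"

lemma borel_subspace_field_glue:
  fixes D :: "nat \<Rightarrow> 'a::real_inner set"
  assumes D: "\<And>i. D i \<in> sets borel" and E: "E \<in> sets borel" "E \<subseteq> (\<Union>i. D i)"
    and \<tau>: "\<And>i. borel_subspace_field m (D i) (\<tau> i)"
  shows "\<exists>\<sigma>. borel_subspace_field m E \<sigma> \<and> (\<forall>p\<in>E. \<exists>i. p \<in> D i \<and> \<sigma> p = \<tau> i p)"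
proof -
  define N where "N p = (LEAST i. p \<in> D i)" for p
  define \<sigma> where "\<sigma> p = \<tau> (N p) p" for p
  have N: "p \<in> D (N p)" if "p \<in> E" for p
    unfolding N_def by (rule LeastI_ex) (use that E(2) in blast)
  define C where "C i = E \<inter> D i - (\<Union>j<i. D j)" for i
  have C: "C i \<in> sets borel" for i unfolding C_def using D E by auto
  have NC: "N p = i" if "p \<in> C i" for p i
    unfolding N_def
  proof (rule Least_equality)
    show "p \<in> D i" using that by (simp add: C_def)
    show "i \<le> j" if "p \<in> D j" for j
      using \<open>p \<in> C i\<close> that by (cases "j < i") (auto simp: C_def)
  qed
  have EC: "p \<in> C (N p)" if "p \<in> E" for p
  proof -
    have "p \<notin> D j" if "j < N p" for j using that unfolding N_def by (rule not_less_Least)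
    then show ?thesis using N[OF that] that by (auto simp: C_def)
  qed
  have "(\<lambda>p. orth_proj (\<sigma> p)) \<in> borel_measurable (restrict_space borel E)"
  proof (rule measurable_piecewise_restrict[where C = "range C"])
    show "space (restrict_space borel E) \<subseteq> \<Union>(range C)"
      using EC by (auto simp: space_restrict_space)
    fix \<Omega> assume "\<Omega> \<in> range C"
    then obtain i where i: "\<Omega> = C i" by blast
    have CE: "C i \<subseteq> E" "C i \<subseteq> D i" by (auto simp: C_def)
    show "\<Omega> \<inter> space (restrict_space borel E) \<in> sets (restrict_space borel E)"
      using C[of i] E(1) CE by (auto simp: i sets_restrict_space_iff space_restrict_space Int_absorb2)
    have eq: "restrict_space (restrict_space borel E) \<Omega> = restrict_space borel (C i)"
      using CE(1) by (simp add: i restrict_restrict_space Int_absorb1 E C)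
    have "(\<lambda>p. orth_proj (\<tau> i p)) \<in> borel_measurable (restrict_space borel (C i))"
    proof -
      have "(\<lambda>p. orth_proj (\<tau> i p)) \<in> borel_measurable (restrict_space (restrict_space borel (D i)) (C i))"
        using \<tau>[of i] unfolding borel_subspace_field_def by (blast intro: measurable_restrict_space1)
      moreover have "restrict_space (restrict_space borel (D i)) (C i) = restrict_space borel (C i)"
        using CE(2) by (simp add: restrict_restrict_space Int_absorb1 D C)
      ultimately show ?thesis by simp
    qed
    then show "(\<lambda>p. orth_proj (\<sigma> p)) \<in> borel_measurable (restrict_space (restrict_space borel E) \<Omega>)"
      unfolding eq by (rule measurable_cong[THEN iffD1, rotated])
        (auto simp: space_restrict_space \<sigma>_def NC)
  qed auto
  moreover have "span_of_at_most m (\<sigma> p)" if "p \<in> E" for p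
    using \<tau>[of "N p"] N[OF that] by (auto simp: borel_subspace_field_def \<sigma>_def)
  moreover have "\<forall>p\<in>E. \<exists>i. p \<in> D i \<and> \<sigma> p = \<tau> i p" using N by (auto simp: \<sigma>_def)
  ultimately show ?thesis unfolding borel_subspace_field_def by blast
qed

text \<open>Induction on \<open>m\<close>, with the convergent case and the reduction of dimension as described at the
  beginning. The set of points is divided according to whether the projections are Cauchy and, if not, according
  to a gap \<open>\<eta> q\<close> that occurs infinitely often; with a fixed gap the constant in the reduction is fixed too.\<close>

lemma ex_borel_asymptotic_field:
  fixes W :: "nat \<Rightarrow> 'a::{real_inner, complete_space} \<Rightarrow> 'a set"
  assumes "D \<in> sets borel" "\<And>n. piecewise_locally_constant D (W n)" "\<And>n p. p \<in> D \<Longrightarrow> span_of_at_most m (W n p)"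
  shows "\<exists>\<tau>. borel_subspace_field m D \<tau> \<and>
    (\<forall>p\<in>D. \<forall>v. (\<lambda>n. infdist v (W n p)) \<longlonglongrightarrow> 0 \<longrightarrow> v \<in> \<tau> p)"
  using assms
proof (induction m arbitrary: D W)
  case 0
  have W0: "W n p = {0}" if p: "p \<in> D" for n p
  proof -
    obtain S where "finite S" "card S \<le> 0" "W n p = span S"
      using "0.prems"(3)[OF p, of n] unfolding span_of_at_most_def by blast
    then show ?thesis by simp
  qed
  have "borel_subspace_field 0 D (\<lambda>_. {0 :: 'a})"
    unfolding borel_subspace_field_def span_of_at_most_def by (auto intro!: exI[of _ "{}"])
  moreover have "v \<in> {0}" if "p \<in> D" "(\<lambda>n. infdist v (W n p)) \<longlonglongrightarrow> 0" for p v
    using that(2) by (simp add: W0[OF that(1)] LIMSEQ_const_iff)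
  ultimately show ?case by blast
next
  case (Suc m)
  note D = Suc.prems(1) and W = Suc.prems(2) and sW = Suc.prems(3)
  define \<eta> :: "nat \<Rightarrow> real" where "\<eta> q = 1 / (real q + 1)" for q
  have eta: "\<eta> q > 0" for q by (simp add: \<eta>_def)
  define far where "far q n k p \<longleftrightarrow> \<eta> q < norm (orth_proj (W n p) - orth_proj (W k p))" for q n k p
  have far_sets: "{p \<in> D. far q n k p} \<in> sets borel" for q n k
    using piecewise_locally_constant_vimage_borel[OF piecewise_locally_constant_Pair[OF W[of n] W[of k]] D, of "{(U, V). \<eta> q < norm (orth_proj U - orth_proj V)}"]
    by (simp add: far_def)
  define D2 where "D2 q = {p \<in> D. \<forall>i. \<exists>n\<ge>i. \<exists>k\<ge>i. far q n k p}" for q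
  have D2: "D2 q \<in> sets borel" for q
  proof -
    have "D2 q = D \<inter> (\<Inter>i. \<Union>n\<in>{i..}. \<Union>k\<in>{i..}. {p \<in> D. far q n k p})" unfolding D2_def by fastforce
    also have "\<dots> \<in> sets borel"
      using D far_sets by (intro sets.Int sets.countable_INT' sets.countable_UN') auto
    finally show ?thesis .
  qed
  define D1 where "D1 = D - (\<Union>q. D2 q)"
  have D1: "D1 \<in> sets borel" unfolding D1_def using D D2 by auto
  define \<tau>1 where "\<tau>1 p = {v. (\<lambda>n. orth_proj (W n p) v) \<longlonglongrightarrow> v}" for p
  have cauchy: "\<exists>N. \<forall>n\<ge>N. \<forall>k\<ge>N. norm (orth_proj (W n p) - orth_proj (W k p)) \<le> e"
    if p: "p \<in> D1" and e: "0 < e" for p e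
  proof -
    obtain q where q: "\<eta> q < e"
      using reals_Archimedean[OF e] by (auto simp: \<eta>_def inverse_eq_divide add.commute)
    have "p \<in> D" "p \<notin> D2 q" using p by (auto simp: D1_def)
    then obtain i where "\<And>n k. n \<ge> i \<Longrightarrow> k \<ge> i \<Longrightarrow> \<not> far q n k p" unfolding D2_def by blast
    then have "\<forall>n\<ge>i. \<forall>k\<ge>i. norm (orth_proj (W n p) - orth_proj (W k p)) \<le> e"
      using q unfolding far_def not_less by (meson less_imp_le order_trans)
    then show ?thesis by blast
  qed
  have \<tau>1: "span_of_at_most (Suc m) (\<tau>1 p)" "(\<lambda>n. orth_proj (W n p)) \<longlonglongrightarrow> orth_proj (\<tau>1 p)" if p: "p \<in> D1" for p
  proof -
    have s: "span_of_at_most (Suc m) (W n p)" for n using p by (intro sW) (auto simp: D1_def)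
    show "span_of_at_most (Suc m) (\<tau>1 p)" "(\<lambda>n. orth_proj (W n p)) \<longlonglongrightarrow> orth_proj (\<tau>1 p)"
      unfolding \<tau>1_def using Cauchy_orth_proj_limit[of "Suc m" "\<lambda>n. W n p", OF s cauchy[OF p]] by auto
  qed
  have field1: "borel_subspace_field (Suc m) D1 \<tau>1"
    unfolding borel_subspace_field_def
  proof (intro conjI ballI)
    show "(\<lambda>p. orth_proj (\<tau>1 p)) \<in> borel_measurable (restrict_space borel D1)"
    proof (rule borel_measurable_LIMSEQ_metric)
      fix n
      have "piecewise_locally_constant D1 (W n)" using W by (rule piecewise_locally_constant_subset) (auto simp: D1_def)
      then have "W n \<in> measurable (restrict_space borel D1) (count_space UNIV)"
        using D1 by (rule piecewise_locally_constant_measurable)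
      then show "(\<lambda>p. orth_proj (W n p)) \<in> borel_measurable (restrict_space borel D1)"
        by (rule measurable_compose) simp
    qed (use \<tau>1 in \<open>auto simp: space_restrict_space\<close>)
  qed (use \<tau>1 in blast)
  have prop1: "v \<in> \<tau>1 p" if p: "p \<in> D1" and v: "(\<lambda>n. infdist v (W n p)) \<longlonglongrightarrow> 0" for p v
  proof -
    have s: "span_of_at_most (Suc m) (W n p)" for n using p by (intro sW) (auto simp: D1_def)
    have "(\<lambda>n. norm (orth_proj (W n p) v - v)) \<longlonglongrightarrow> 0"
      using v by (simp add: infdist_eq_norm_orth_proj[OF s] norm_minus_commute)
    then show ?thesis unfolding \<tau>1_def using Lim_null tendsto_norm_zero_iff by blast
  qed
  have "\<exists>\<tau>. borel_subspace_field m (D2 q) \<tau> \<and>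
    (\<forall>p\<in>D2 q. \<forall>v. (\<lambda>n. infdist v (W n p)) \<longlonglongrightarrow> 0 \<longrightarrow> v \<in> \<tau> p)" for q
  proof -
    \<comment> \<open>\<open>V i\<close> reduces the first pair of distant projections with both indices at least \<open>i\<close>\<close>
    define red where "red = (\<lambda>(U :: 'a set, U' :: 'a set). SOME V. span_of_at_most m V \<and>
        (\<forall>v. infdist v V \<le> (1 + 2 / \<eta> q) * (infdist v U + infdist v U')))"
    define pair where "pair i c p \<longleftrightarrow> fst (prod_decode c) \<ge> i \<and> snd (prod_decode c) \<ge> i \<and>
        far q (fst (prod_decode c)) (snd (prod_decode c)) p" for i c p
    define c where "c i p = (LEAST c. pair i c p)" for i p
    define V where "V i p = red (W (fst (prod_decode (c i p))) p, W (snd (prod_decode (c i p))) p)" for i p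
    have sub: "D2 q \<subseteq> D" by (auto simp: D2_def)
    have [measurable]: "Measurable.pred (restrict_space borel (D2 q)) (far q n k)" for n k
    proof -
      have "{p \<in> D2 q. far q n k p} = D2 q \<inter> {p \<in> D. far q n k p}" using sub by auto
      also have "\<dots> \<in> sets borel" using D2 far_sets by auto
      finally show ?thesis unfolding pred_def using D2[of q]
        by (auto simp: space_restrict_space sets_restrict_space_iff)
    qed
    have cm: "c i \<in> measurable (restrict_space borel (D2 q)) (count_space UNIV)" for i
      unfolding c_def pair_def by measurable
    have pV: "piecewise_locally_constant (D2 q) (V i)" for i
    proof -
      have "piecewise_locally_constant (D2 q) (\<lambda>p. (W (fst (prod_decode k)) p, W (snd (prod_decode k)) p))" for k
        by (intro piecewise_locally_constant_Pair piecewise_locally_constant_subset[OF W sub])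
      from piecewise_locally_constant_comp[OF piecewise_locally_constant_select[OF D2 cm this], where h = red] show ?thesis
        unfolding V_def .
    qed
    have pair: "pair i (c i p) p" if p: "p \<in> D2 q" for i p
    proof -
      obtain n k where "n \<ge> i" "k \<ge> i" "far q n k p" using p unfolding D2_def by blast
      then have "pair i (prod_encode (n, k)) p" by (simp add: pair_def)
      then show ?thesis unfolding c_def by (rule LeastI)
    qed
    have V: "span_of_at_most m (V i p) \<and> (\<forall>v. infdist v (V i p) \<le> (1 + 2 / \<eta> q) *
        (infdist v (W (fst (prod_decode (c i p))) p) + infdist v (W (snd (prod_decode (c i p))) p)))"
      if p: "p \<in> D2 q" for i p
    proof -
      have pD: "p \<in> D" using p sub by blast
      have "\<eta> q < norm (orth_proj (W (fst (prod_decode (c i p))) p) - orth_proj (W (snd (prod_decode (c i p))) p))"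
        using pair[OF p, of i] by (simp add: pair_def far_def)
      from someI_ex[OF smaller_subspace_of_distant_projections[OF sW[OF pD] sW[OF pD] eta this]]
      show ?thesis unfolding V_def red_def by simp
    qed
    have V0: "(\<lambda>i. infdist v (V i p)) \<longlonglongrightarrow> 0" if p: "p \<in> D2 q" and v: "(\<lambda>n. infdist v (W n p)) \<longlonglongrightarrow> 0" for p v
    proof -
      let ?n = "\<lambda>i. fst (prod_decode (c i p))" and ?k = "\<lambda>i. snd (prod_decode (c i p))"
      have "filterlim ?n sequentially sequentially" "filterlim ?k sequentially sequentially"
        using pair[OF p] unfolding pair_def
        by (auto intro!: filterlim_at_top_mono[OF filterlim_ident])
      then have "(\<lambda>i. infdist v (W (?n i) p)) \<longlonglongrightarrow> 0" "(\<lambda>i. infdist v (W (?k i) p)) \<longlonglongrightarrow> 0"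
        using filterlim_compose[OF v] by blast+
      then have "(\<lambda>i. (1 + 2 / \<eta> q) * (infdist v (W (?n i) p) + infdist v (W (?k i) p))) \<longlonglongrightarrow> (1 + 2 / \<eta> q) * (0 + 0)"
        by (intro tendsto_intros)
      then have "(\<lambda>i. (1 + 2 / \<eta> q) * (infdist v (W (?n i) p) + infdist v (W (?k i) p))) \<longlonglongrightarrow> 0" by simp
      moreover have "\<forall>\<^sub>F i in sequentially. infdist v (V i p) \<le> (1 + 2 / \<eta> q) * (infdist v (W (?n i) p) + infdist v (W (?k i) p))"
        using V[OF p] by (intro always_eventually) blast
      moreover have "\<forall>\<^sub>F i in sequentially. 0 \<le> infdist v (V i p)"
        by (intro always_eventually allI infdist_nonneg)
      ultimately show ?thesis
        using tendsto_sandwich[of "\<lambda>_. 0" "\<lambda>i. infdist v (V i p)" sequentially] by simp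
    qed
    obtain \<tau> where "borel_subspace_field m (D2 q) \<tau>"
      "\<forall>p\<in>D2 q. \<forall>v. (\<lambda>i. infdist v (V i p)) \<longlonglongrightarrow> 0 \<longrightarrow> v \<in> \<tau> p"
      using Suc.IH[of "D2 q" V, OF D2 pV] V by blast
    then show ?thesis using V0 by blast
  qed
  then obtain \<tau>2 where \<tau>2: "\<And>q. borel_subspace_field m (D2 q) (\<tau>2 q)"
    "\<And>q p v. p \<in> D2 q \<Longrightarrow> (\<lambda>n. infdist v (W n p)) \<longlonglongrightarrow> 0 \<Longrightarrow> v \<in> \<tau>2 q p" by metis
  define D' where "D' i = (case i of 0 \<Rightarrow> D1 | Suc q \<Rightarrow> D2 q)" for i
  define \<tau>' where "\<tau>' i = (case i of 0 \<Rightarrow> \<tau>1 | Suc q \<Rightarrow> \<tau>2 q)" for i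
  have "borel_subspace_field (Suc m) (D2 q) (\<tau>2 q)" for q
    using \<tau>2(1)[of q] unfolding borel_subspace_field_def span_of_at_most_def by (meson le_SucI)
  then have "borel_subspace_field (Suc m) (D' i) (\<tau>' i)" for i
    using field1 by (auto simp: D'_def \<tau>'_def split: nat.split)
  moreover have "D' i \<in> sets borel" for i using D1 D2 by (auto simp: D'_def split: nat.split)
  moreover have "D \<subseteq> (\<Union>i. D' i)"
  proof
    fix p assume p: "p \<in> D"
    show "p \<in> (\<Union>i. D' i)"
    proof (cases "\<exists>q. p \<in> D2 q")
      case True
      then obtain q where "p \<in> D' (Suc q)" by (auto simp: D'_def)
      then show ?thesis by blast
    next
      case False
      then have "p \<in> D' 0" using p by (simp add: D'_def D1_def)
      then show ?thesis by blast
    qed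
  qed
  ultimately obtain \<sigma> where \<sigma>: "borel_subspace_field (Suc m) D \<sigma>" "\<forall>p\<in>D. \<exists>i. p \<in> D' i \<and> \<sigma> p = \<tau>' i p"
    using borel_subspace_field_glue[OF _ D, of D' "Suc m" \<tau>'] by blast
  have "v \<in> \<sigma> p" if p: "p \<in> D" and v: "(\<lambda>n. infdist v (W n p)) \<longlonglongrightarrow> 0" for p v
  proof -
    obtain i where i: "p \<in> D' i" "\<sigma> p = \<tau>' i p" using \<sigma>(2) p by blast
    then show ?thesis using prop1 \<tau>2(2) v by (cases i) (auto simp: D'_def \<tau>'_def)
  qed
  with \<sigma>(1) show ?case by blast
qed

section \<open>The weak tangent field\<close>

lemma badly_fits_closure:
  assumes "badly_fits d A"
  shows "badly_fits d (closure A)"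
proof -
  have "infdist x (closure A) = infdist x A" if "A \<noteq> {}" for x
    using that by (simp add: infdist_eq_setdist)
  then have "closed_nbhd e (closure A) = closed_nbhd e A" for e
    by (cases "A = {}") (simp_all add: closed_nbhd_def)
  then show ?thesis using assms by (simp add: badly_fits_def)
qed

text \<open>Tangents that are \<open>\<delta> n\<close>-close to \<open>W n\<close> for every \<open>n\<close> lie in the asymptotic field.\<close>

lemma tangent_field_closed:
  fixes F :: "'a::{real_inner, complete_space} set"
  assumes F: "closed F" "badly_fits d F" and d: "1 \<le> d"
  shows "\<exists>\<tau>. borel_subspace_field (d - 1) F \<tau> \<and>
    (\<forall>\<gamma> l \<Gamma>. arclength_param \<gamma> l \<Gamma> \<longrightarrow>
      negligible {t \<in> {0<..<l}. \<gamma> t \<in> F \<and>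
        (\<exists>v. norm v = 1 \<and> (\<gamma> has_vector_derivative v) (at t) \<and> v \<notin> \<tau> (\<gamma> t))})"
proof -
  obtain B :: "'a set" where B: "orthonormal B" "\<And>x. (\<And>e. e \<in> B \<Longrightarrow> x \<bullet> e = 0) \<Longrightarrow> x = 0"
    using ex_total_orthonormal by blast
  define \<delta> :: "nat \<Rightarrow> real" where "\<delta> n = 1 / (real n + 1)" for n
  define approx where "approx n W \<longleftrightarrow> piecewise_locally_constant F W \<and> (\<forall>p\<in>F. span_of_at_most (d - 1) (W p)) \<and>
    (\<forall>\<gamma> l \<Gamma>. arclength_param \<gamma> l \<Gamma> \<longrightarrow>
      negligible {t \<in> {0<..<l}. \<gamma> t \<in> F \<and>
        (\<exists>v. norm v = 1 \<and> (\<gamma> has_vector_derivative v) (at t) \<and> \<delta> n < infdist v (W (\<gamma> t)))})" for n W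
  have "\<exists>W. approx n W" for n
  proof -
    have "0 < \<delta> n" by (simp add: \<delta>_def)
    from approximate_tangent_field[OF F d this B] show ?thesis unfolding approx_def .
  qed
  then obtain W where "\<And>n. approx n (W n)" by metis
  then have W: "\<And>n. piecewise_locally_constant F (W n)" "\<And>n p. p \<in> F \<Longrightarrow> span_of_at_most (d - 1) (W n p)"
    "\<And>n \<gamma> l \<Gamma>. arclength_param \<gamma> l \<Gamma> \<Longrightarrow> negligible {t \<in> {0<..<l}. \<gamma> t \<in> F \<and>
        (\<exists>v. norm v = 1 \<and> (\<gamma> has_vector_derivative v) (at t) \<and> \<delta> n < infdist v (W n (\<gamma> t)))}"
    unfolding approx_def by blast+
  have "F \<in> sets borel" using F(1) by simp
  from ex_borel_asymptotic_field[of F W, OF this W(1,2)]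
  obtain \<tau> where \<tau>: "borel_subspace_field (d - 1) F \<tau>"
    "\<And>p v. p \<in> F \<Longrightarrow> (\<lambda>n. infdist v (W n p)) \<longlonglongrightarrow> 0 \<Longrightarrow> v \<in> \<tau> p" by blast
  have "negligible {t \<in> {0<..<l}. \<gamma> t \<in> F \<and>
        (\<exists>v. norm v = 1 \<and> (\<gamma> has_vector_derivative v) (at t) \<and> v \<notin> \<tau> (\<gamma> t))}" (is "negligible ?B")
    if al: "arclength_param \<gamma> l \<Gamma>" for \<gamma> l \<Gamma>
  proof (rule negligible_subset)
    let ?N = "\<Union>n. {t \<in> {0<..<l}. \<gamma> t \<in> F \<and>
        (\<exists>v. norm v = 1 \<and> (\<gamma> has_vector_derivative v) (at t) \<and> \<delta> n < infdist v (W n (\<gamma> t)))}"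
    show "negligible ?N" using W(3)[OF al] by (intro negligible_countable_Union) auto
    show "?B \<subseteq> ?N"
    proof (rule subsetI, rule ccontr)
      fix t assume t: "t \<in> ?B" "t \<notin> ?N"
      then obtain v where v: "norm v = 1" "(\<gamma> has_vector_derivative v) (at t)" "v \<notin> \<tau> (\<gamma> t)" by auto
      have "infdist v (W n (\<gamma> t)) \<le> \<delta> n" for n using t v(1,2) by (force simp: not_less)
      moreover have "\<delta> \<longlonglongrightarrow> 0"
        unfolding \<delta>_def using LIMSEQ_inverse_real_of_nat by (simp add: inverse_eq_divide add.commute)
      ultimately have "(\<lambda>n. infdist v (W n (\<gamma> t))) \<longlonglongrightarrow> 0"
        by (intro tendsto_sandwich[of "\<lambda>_. 0" "\<lambda>n. infdist v (W n (\<gamma> t))" sequentially \<delta>])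
          (auto intro: always_eventually infdist_nonneg)
      then show False using \<tau>(2) t(1) v(3) by auto
    qed
  qed
  then show ?thesis using \<tau>(1) by blast
qed

text \<open>A bad point of the curve is the image of a time in a null set: an end point, or the derivative does not exist or is not
  of norm one, it is not in the field, or another passage through the same point has a different tangent.\<close>

lemma hausdorff1_no_tangent_in_field:
  fixes \<gamma> :: "real \<Rightarrow> 'a::{real_inner, complete_space}"
  assumes al: "arclength_param \<gamma> l \<Gamma>"
    and N: "negligible {t \<in> {0<..<l}. \<gamma> t \<in> E \<and>
        (\<exists>v. norm v = 1 \<and> (\<gamma> has_vector_derivative v) (at t) \<and> v \<notin> \<tau> (\<gamma> t))}"
    and sub: "\<And>p. p \<in> E \<Longrightarrow> subspace (\<tau> p)"
  shows "hausdorff1 {p \<in> \<Gamma> \<inter> E. \<not> (\<exists>T. tangent_line \<gamma> l p T \<and> T \<subseteq> \<tau> p)} = 0"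
proof -
  define N1 where "N1 = {t \<in> {0..l}. \<not> (0 < t \<and> t < l \<and> (\<exists>v. norm v = 1 \<and> (\<gamma> has_vector_derivative v) (at t)))}"
  define N2 where "N2 = {t \<in> {0<..<l}. \<gamma> t \<in> E \<and>
        (\<exists>v. norm v = 1 \<and> (\<gamma> has_vector_derivative v) (at t) \<and> v \<notin> \<tau> (\<gamma> t))}"
  define N3 where "N3 = {s. \<exists>t v w. \<gamma> s = \<gamma> t \<and> (\<gamma> has_vector_derivative v) (at s) \<and>
     (\<gamma> has_vector_derivative w) (at t) \<and> v \<noteq> 0 \<and> w \<noteq> 0 \<and> span {v} \<noteq> span {w}}"
  have "negligible N1" unfolding N1_def using al by (rule arclength_param_unit_derivative_ae)
  moreover have "negligible N2" unfolding N2_def by (rule N)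
  moreover have "negligible N3" unfolding N3_def by (intro countable_imp_negligible countable_transversal_crossings)
  ultimately have neg: "negligible ((N1 \<union> N2 \<union> N3) \<inter> {0..l})" by (intro negligible_Int negligible_Un disjI1)
  show ?thesis
  proof (rule hausdorff1_lipschitz_image_negligible[where I = "{0..l}", OF _ neg])
    show "{p \<in> \<Gamma> \<inter> E. \<not> (\<exists>T. tangent_line \<gamma> l p T \<and> T \<subseteq> \<tau> p)} \<subseteq> \<gamma> ` ((N1 \<union> N2 \<union> N3) \<inter> {0..l})"
    proof (rule subsetI, rule ccontr)
      fix p assume p: "p \<in> {p \<in> \<Gamma> \<inter> E. \<not> (\<exists>T. tangent_line \<gamma> l p T \<and> T \<subseteq> \<tau> p)}"
        and np: "p \<notin> \<gamma> ` ((N1 \<union> N2 \<union> N3) \<inter> {0..l})"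
      have "\<Gamma> = \<gamma> ` {0..l}" using al by (simp add: arclength_param_def)
      then obtain s where s: "s \<in> {0..l}" "p = \<gamma> s" using p by blast
      have good: "t \<notin> N1 \<and> t \<notin> N2 \<and> t \<notin> N3" if "t \<in> {0..l}" "\<gamma> t = p" for t
        using np that by blast
      have der: "\<exists>v. norm v = 1 \<and> (\<gamma> has_vector_derivative v) (at t)" if "t \<in> {0..l}" "\<gamma> t = p" for t
        using good[OF that] that(1) unfolding N1_def by blast
      obtain v where v: "norm v = 1" "(\<gamma> has_vector_derivative v) (at s)" using der s by blast
      have s0: "s \<in> {0<..<l}" using good[of s] s unfolding N1_def by auto
      have "v \<in> \<tau> p" using good[of s] s s0 v p unfolding N2_def by auto
      then have "span {v} \<subseteq> \<tau> p" using sub[of p] p by (intro span_minimal) auto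
      moreover have "tangent_line \<gamma> l p (span {v})"
        unfolding tangent_line_def
      proof (intro conjI ballI impI)
        show "p \<in> \<gamma> ` {0..l}" using s by blast
        fix t assume t: "t \<in> {0..l}" "\<gamma> t = p"
        obtain w where w: "norm w = 1" "(\<gamma> has_vector_derivative w) (at t)" using der[OF t] by blast
        have nz: "v \<noteq> 0" "w \<noteq> 0" using v(1) w(1) by auto
        have "span {v} = span {w}"
        proof (rule ccontr)
          assume "span {v} \<noteq> span {w}"
          then have "s \<in> N3" unfolding N3_def using s(2) t(2) v(2) w(2) nz
            by (intro CollectI exI[of _ t] exI[of _ v] exI[of _ w]) simp
          then show False using good[of s] s by blast
        qed
        then show "\<exists>v'. v' \<noteq> 0 \<and> (\<gamma> has_vector_derivative v') (at t within {0..l}) \<and> span {v} = span {v'}"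
          using nz(2) has_vector_derivative_at_within[OF w(2)] by blast
      qed
      ultimately show False using p by blast
    qed
  qed (use arclength_param_lipschitz[OF al] in auto)
qed

theorem theorem1p4:
  fixes E :: "'a::{real_inner, complete_space} set"
    and d :: nat
    and \<A> :: "'a set set"
  assumes "d \<ge> 1"
    and "E \<in> sets borel"
    and "countable \<A>"
    and "E = \<Union>\<A>"
    and "\<And>A. A \<in> \<A> \<Longrightarrow> badly_fits d A"
  shows "\<exists>\<tau>. pointwise_weak_tangent_field (d - 1) E \<tau>"
proof -
  define F where "F n = (if \<A> = {} then {} else closure (from_nat_into \<A> n))" for n
  have Fc: "closed (F n)" for n by (simp add: F_def)
  have Fb: "badly_fits d (F n)" for n
  proof (cases "\<A> = {}")
    case True
    then show ?thesis unfolding badly_fits_def F_def closed_nbhd_def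
      by (intro exI[of _ 1]) (auto simp: diameter_def)
  next
    case False
    then show ?thesis using badly_fits_closure[OF assms(5)[OF from_nat_into[OF False]]] by (simp add: F_def)
  qed
  have EF: "E \<subseteq> (\<Union>n. F n)"
  proof
    fix p assume "p \<in> E"
    then obtain A where A: "A \<in> \<A>" "p \<in> A" using assms(4) by blast
    then obtain n where "from_nat_into \<A> n = A" using assms(3) from_nat_into_surj by metis
    then have "p \<in> F n" using A closure_subset by (auto simp: F_def)
    then show "p \<in> (\<Union>n. F n)" by blast
  qed
  define field where "field n \<tau> \<longleftrightarrow> borel_subspace_field (d - 1) (F n) \<tau> \<and>
    (\<forall>\<gamma> l \<Gamma>. arclength_param \<gamma> l \<Gamma> \<longrightarrow>
      negligible {t \<in> {0<..<l}. \<gamma> t \<in> F n \<and>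
        (\<exists>v. norm v = 1 \<and> (\<gamma> has_vector_derivative v) (at t) \<and> v \<notin> \<tau> (\<gamma> t))})" for n \<tau>
  have "\<exists>\<tau>. field n \<tau>" for n
    unfolding field_def by (rule tangent_field_closed[OF Fc Fb assms(1)])
  then obtain \<tau> where "\<And>n. field n (\<tau> n)" by metis
  then have \<tau>: "\<And>n. borel_subspace_field (d - 1) (F n) (\<tau> n)"
    "\<And>n \<gamma> l \<Gamma>. arclength_param \<gamma> l \<Gamma> \<Longrightarrow> negligible {t \<in> {0<..<l}. \<gamma> t \<in> F n \<and>
        (\<exists>v. norm v = 1 \<and> (\<gamma> has_vector_derivative v) (at t) \<and> v \<notin> \<tau> n (\<gamma> t))}"
    unfolding field_def by blast+
  have "F n \<in> sets borel" for n using Fc by simp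
  then obtain \<sigma> where \<sigma>: "borel_subspace_field (d - 1) E \<sigma>" "\<forall>p\<in>E. \<exists>n. p \<in> F n \<and> \<sigma> p = \<tau> n p"
    using borel_subspace_field_glue[OF _ assms(2) EF \<tau>(1)] by blast
  have "hausdorff1 {p \<in> \<Gamma> \<inter> E. \<not> (\<exists>T. tangent_line \<gamma> l p T \<and> T \<subseteq> \<sigma> p)} = 0"
    if al: "arclength_param \<gamma> l \<Gamma>" for \<gamma> l \<Gamma>
  proof (rule hausdorff1_no_tangent_in_field[OF al])
    show "negligible {t \<in> {0<..<l}. \<gamma> t \<in> E \<and>
        (\<exists>v. norm v = 1 \<and> (\<gamma> has_vector_derivative v) (at t) \<and> v \<notin> \<sigma> (\<gamma> t))}" (is "negligible ?B")
    proof (rule negligible_subset)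
      let ?N = "\<Union>n. {t \<in> {0<..<l}. \<gamma> t \<in> F n \<and>
        (\<exists>v. norm v = 1 \<and> (\<gamma> has_vector_derivative v) (at t) \<and> v \<notin> \<tau> n (\<gamma> t))}"
      show "negligible ?N" using \<tau>(2)[OF al] by (intro negligible_countable_Union) auto
      show "?B \<subseteq> ?N"
      proof
        fix t assume t: "t \<in> ?B"
        then obtain n where "\<gamma> t \<in> F n" "\<sigma> (\<gamma> t) = \<tau> n (\<gamma> t)" using \<sigma>(2) by blast
        then show "t \<in> ?N" using t by auto
      qed
    qed
    show "subspace (\<sigma> p)" if "p \<in> E" for p
      using \<sigma>(1) that span_of_at_most_subspace unfolding borel_subspace_field_def by blast
  qed
  then show ?thesis
    using \<sigma>(1) unfolding pointwise_weak_tangent_field_def borel_subspace_field_def span_of_at_most_iff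
    by blast
qed

end
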